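(* Consider all pairs $(D,r)$ where $-D<0$ is a fundamental discriminant with odd class number $h(-D)=2k+1$, $k\ge 1$, and $1\le r\le k$. Let $Q_0,Q_1,\bar Q_1,\ldots,Q_k,\bar Q_k$ be the $2k+1$ distinct reduced forms of discriminant $-D$, where $Q_0$ is the principal form and $\bar Q_i$ is the conjugate of $Q_i$, and let $$F_{D,r}(z)=\frac12\left(\sum_{a,b\in\mathbb{Z}}q^{Q_0(a,b)}-\sum_{a,b\in\mathbb{Z}}q^{Q_r(a,b)}\right).$$ Then the pair $(23,1)$ is the only pair $(D,r)$ for which $F_{D,r}(z)$ has an eta quotient representation (that is, for which $F_{D,r}$ is equal to an eta quotient).
   Context: A primitive positive definite integral binary quadratic form $ax^2+bxy+cy^2$ has discriminant $b^2-4ac$; it is reduced if $|b|\le a\le c$, and $b\ge 0$ whenever $|b|=a$ or $a=c$. The conjugate of $ax^2+bxy+cy^2$ is $ax^2-bxy+cy^2$. The class number $h(-D)$ is the number of proper ($\mathrm{SL}_2(\mathbb{Z})$-)equivalence classes of primitive positive definite forms of discriminant $-D$; each class contains exactly one reduced form. For a negative discriminant $d$ the principal form is $x^2-\frac d4y^2$ if $d\equiv 0\pmod 4$ and $x^2+xy+\frac{1-d}{4}y^2$ if $d\equiv 1\pmod 4$. When $h(-D)=2k+1$ is odd, the reduced forms of discriminant $-D$ are the principal form together with $k$ pairs of distinct conjugate forms, so they can be listed as in the claim. Here $q=e^{2\pi iz}$, $z$ in the upper half-plane, $\eta(z)=q^{1/24}\prod_{n\ge1}(1-q^n)$ is the Dedekind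 eta function, and an eta quotient of level $N$ is a function $\prod_{\delta\mid N}\eta(\delta z)^{r_\delta}$ with integers $N\ge 1$ and $r_\delta$. *)

theory Defs
  imports
    "HOL-Analysis.Analysis"
    "HOL-Computational_Algebra.Squarefree"
begin

text \<open>\<open>BQF a b c\<close> is the form $ax^2 + bxy + cy^2$.\<close>

datatype bqf = BQF (coeff_a: int) (coeff_b: int) (coeff_c: int)

definition bqf_eval :: "bqf \<Rightarrow> int \<Rightarrow> int \<Rightarrow> int" where
  "bqf_eval Q x y = coeff_a Q * x\<^sup>2 + coeff_b Q * x * y + coeff_c Q * y\<^sup>2"

definition bqf_disc :: "bqf \<Rightarrow> int" where
  "bqf_disc Q = (coeff_b Q)\<^sup>2 - 4 * coeff_a Q * coeff_c Q"

definition bqf_primitive :: "bqf \<Rightarrow> bool" where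
  "bqf_primitive Q \<longleftrightarrow> gcd (coeff_a Q) (gcd (coeff_b Q) (coeff_c Q)) = 1"

definition bqf_pos_def :: "bqf \<Rightarrow> bool" where
  "bqf_pos_def Q \<longleftrightarrow> (\<forall>x y. (x, y) \<noteq> (0, 0) \<longrightarrow> bqf_eval Q x y > 0)"

definition bqf_reduced :: "bqf \<Rightarrow> bool" where
  "bqf_reduced Q \<longleftrightarrow>
     \<bar>coeff_b Q\<bar> \<le> coeff_a Q \<and> coeff_a Q \<le> coeff_c Q \<and>
     (\<bar>coeff_b Q\<bar> = coeff_a Q \<or> coeff_a Q = coeff_c Q \<longrightarrow> coeff_b Q \<ge> 0)"

definition bqf_conj :: "bqf \<Rightarrow> bqf" where
  "bqf_conj Q = BQF (coeff_a Q) (- coeff_b Q) (coeff_c Q)"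

definition prim_pos_def_forms :: "int \<Rightarrow> bqf set" where
  "prim_pos_def_forms d = {Q. bqf_primitive Q \<and> bqf_pos_def Q \<and> bqf_disc Q = d}"

definition reduced_forms :: "int \<Rightarrow> bqf set" where
  "reduced_forms d = {Q \<in> prim_pos_def_forms d. bqf_reduced Q}"

definition properly_equivalent :: "bqf \<Rightarrow> bqf \<Rightarrow> bool" where
  "properly_equivalent Q Q' \<longleftrightarrow>
     (\<exists>p q r s :: int. p * s - q * r = 1 \<and>
        (\<forall>x y. bqf_eval Q' x y = bqf_eval Q (p * x + q * y) (r * x + s * y)))"

definition class_number :: "int \<Rightarrow> nat" where
  "class_number d =
     card (prim_pos_def_forms d //
           {(Q, Q'). Q \<in> prim_pos_def_forms d \<and> Q' \<in> prim_pos_def_forms d \<and>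
                     properly_equivalent Q Q'})"

definition principal_form :: "int \<Rightarrow> bqf" where
  "principal_form d =
     (if d mod 4 = 0 then BQF 1 0 (- (d div 4)) else BQF 1 1 ((1 - d) div 4))"

text \<open>Fundamental discriminants are the discriminants of quadratic fields; in particular, 1 is
  not counted as one.\<close>

definition fundamental_discriminant :: "int \<Rightarrow> bool" where
  "fundamental_discriminant d \<longleftrightarrow>
     d \<noteq> 1 \<and> d mod 4 = 1 \<and> squarefree d \<or>
     (\<exists>m. d = 4 * m \<and> m mod 4 \<in> {2, 3} \<and> squarefree m)"

text \<open>The values \<open>Q 0, Q 1, \<dots>, Q k\<close> form a listing
  $Q_0, Q_1, \bar Q_1, \ldots, Q_k, \bar Q_k$ of the $2k+1$ distinct reduced forms of
  discriminant $-D$; values of \<open>Q\<close> beyond \<open>k\<close> are irrelevant.\<close>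

definition lists_reduced_forms :: "int \<Rightarrow> nat \<Rightarrow> (nat \<Rightarrow> bqf) \<Rightarrow> bool" where
  "lists_reduced_forms D k Q \<longleftrightarrow>
     Q 0 = principal_form (- D) \<and>
     (let Qs = Q 0 # map Q [1..<k+1] @ map (\<lambda>i. bqf_conj (Q i)) [1..<k+1]
      in distinct Qs \<and> set Qs = reduced_forms (- D))"

definition nome :: "complex \<Rightarrow> complex" where
  "nome z = exp (2 * of_real pi * \<i> * z)"

definition theta_series :: "bqf \<Rightarrow> complex \<Rightarrow> complex" where
  "theta_series Q z = (\<Sum>\<^sub>\<infinity>(a, b) \<in> UNIV. nome z powi bqf_eval Q a b)"

definition theta_diff :: "(nat \<Rightarrow> bqf) \<Rightarrow> nat \<Rightarrow> complex \<Rightarrow> complex" where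
  "theta_diff Q r z = (theta_series (Q 0) z - theta_series (Q r) z) / 2"

text \<open>The factor $q^{1/24}$ is $e^{2\pi i z/24}$. The infinite product starts at index 0, hence
  the successor.\<close>

definition dedekind_eta :: "complex \<Rightarrow> complex" where
  "dedekind_eta z = nome (z / 24) * (\<Prod>n. 1 - nome z ^ Suc n)"

text \<open>Only the values of the function on the upper half-plane matter.\<close>

definition is_eta_quotient :: "(complex \<Rightarrow> complex) \<Rightarrow> bool" where
  "is_eta_quotient f \<longleftrightarrow>
     (\<exists>(N :: nat) (e :: nat \<Rightarrow> int). N \<ge> 1 \<and>
        (\<forall>z. Im z > 0 \<longrightarrow>
           f z = (\<Prod>\<delta> | \<delta> dvd N. dedekind_eta (of_nat \<delta> * z) powi e \<delta>)))"

definition admissible :: "int \<Rightarrow> nat \<Rightarrow> nat \<Rightarrow> (nat \<Rightarrow> bqf) \<Rightarrow> bool" where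
  "admissible D r k Q \<longleftrightarrow>
     D > 0 \<and> fundamental_discriminant (- D) \<and> class_number (- D) = 2 * k + 1 \<and> k \<ge> 1 \<and>
     1 \<le> r \<and> r \<le> k \<and> lists_reduced_forms D k Q"

end

theory Submission
  imports Defs "HOL-Probability.Probability" "HOL-Real_Asymp.Real_Asymp"
begin

text \<open>For $t > 0$ put $F(t) = F_{D,r}(it)$. Applying Poisson summation twice to the Gaussian sums
  gives $\theta_Q(it) = (t\sqrt D)^{-1}\,\theta_Q(i/(Dt))$ for every reduced form $Q$ of
  discriminant $-D$, so $F$ has the same symmetry; and Euler's pentagonal number theorem turns
  $\eta(it)$ into a twisted Gaussian sum, whence $\eta(i/t) = \sqrt t\,\eta(it)$. If
  $F(t) = \prod_{\delta\mid N}\eta(i\delta t)^{r_\delta}$, comparing the two symmetries yields a linear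
  relation between the functions $\ln\eta(i\delta t)$, $\ln\eta(i(D/\delta)t)$, $\ln t$ and $1$.
  These are linearly independent for distinct arguments (look at $t \to \infty$), so
  $r_\delta = r_{D/\delta}$, which vanishes unless $\delta \mid D$, and $\sum r_\delta = 2$. A
  composite $D$ would produce an ambiguous reduced form other than the principal one, hence $D$ is
  prime and $r_1 = r_D = 1$. As $F(t) \sim e^{-2\pi t}$ for $t \to \infty$, it follows that
  $(1 + D)/24 = 1$. Conversely $F_{23,1}(z) = \eta(z)\eta(23z)$ by the pentagonal number theorem and a
  comparison of two sublattices of $\mathbb{Z}^2$.\<close>

section \<open>Euler's pentagonal number theorem\<close>

text \<open>On the imaginary axis every eta factor is a positive real number, so an eta quotient has
  a real logarithm there and a product identity becomes a linear one. Neither the level nor the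
  exponents are restricted beforehand, so the single involution \<open>t -> 1/(D t)\<close> has to
  determine the exponents. It pairs the argument \<open>delta\<close> with \<open>D / delta\<close>,
  which need not be an integer; a divisor without an integral partner must carry exponent 0. The sum
  2 of the exponents comes from the coefficient of \<open>ln t\<close>: each eta contributes 1/2 per
  unit of exponent, a binary theta series contributes 1. Ambiguous forms are excluded because the
  listing pairs every non-principal reduced form with a different reduced form, its conjugate. The
  final equation contains 24 because of the factor \<open>q^(1/24)\<close> in eta, and 1 on the
  right because the leading term of \<open>F\<close> is \<open>q\<close>: the principal form takes
  the value 1 exactly at \<open>(1,0)\<close> and \<open>(-1,0)\<close>, and \<open>Q_r\<close>
  never does. For D = 23 the coincidence 1 + 23 = 24 is also what allows 24 times each form to be
  written as \<open>u^2 + 23 v^2\<close>, the exponent that occurs in the product of two eta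
  series.\<close>

lemma filterlim_symmetric_int_intervals:
  "filterlim (\<lambda>N. {- int N..int N}) (finite_subsets_at_top UNIV) sequentially"
  unfolding filterlim_finite_subsets_at_top
proof (intro allI impI)
  fix X :: "int set" assume X: "finite X \<and> X \<subseteq> UNIV"
  define M where "M = nat (\<Sum>x\<in>X. \<bar>x\<bar>)"
  have "\<bar>x\<bar> \<le> int M" if "x \<in> X" for x
    using member_le_sum[of x X abs] X that unfolding M_def by auto
  hence "X \<subseteq> {- int N..int N}" if "N \<ge> M" for N
    using that by fastforce
  thus "\<forall>\<^sub>F N in sequentially. finite {- int N..int N} \<and> X \<subseteq> {- int N..int N} \<and> {- int N..int N} \<subseteq> UNIV"
    by (auto simp: eventually_sequentially)
qed

lemma summable_on_int_power:
  fixes r :: real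
  assumes "0 \<le> r" "r < 1"
  shows "(\<lambda>n::int. r ^ nat \<bar>n\<bar>) summable_on UNIV"
proof -
  have nat: "(\<lambda>n. r ^ n) summable_on (UNIV::nat set)"
    by (rule norm_summable_imp_summable_on)
      (use assms summable_geometric[of r] in \<open>simp add: norm_power\<close>)
  have "(\<lambda>n. r ^ nat \<bar>n\<bar>) summable_on range int"
    by (subst summable_on_reindex) (use nat in \<open>auto simp: o_def\<close>)
  moreover have "(\<lambda>n. r ^ nat \<bar>n\<bar>) summable_on range (\<lambda>n. - int n)"
    by (subst summable_on_reindex) (use nat in \<open>auto simp: o_def inj_on_def\<close>)
  ultimately have "(\<lambda>n. r ^ nat \<bar>n\<bar>) summable_on (range int \<union> range (\<lambda>n. - int n))"
    by (rule summable_on_union)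
  moreover have "range int \<union> range (\<lambda>n. - int n) = UNIV"
    by (auto intro: int_cases2)
  ultimately show ?thesis by simp
qed

lemma summable_on_int_exp_square:
  fixes c :: real
  assumes "c > 0"
  shows "(\<lambda>n::int. exp (- c * of_int n ^ 2)) summable_on UNIV"
proof (rule summable_on_comparison_test)
  show "(\<lambda>n::int. exp (- c) ^ nat \<bar>n\<bar>) summable_on UNIV"
    by (rule summable_on_int_power) (use assms in auto)
  fix n :: int
  have "\<bar>n\<bar> \<le> n ^ 2"
    using mult_left_mono[of 1 "\<bar>n\<bar>" "\<bar>n\<bar>"] by (cases "n = 0") (auto simp: power2_eq_square)
  hence "real_of_int \<bar>n\<bar> \<le> real_of_int (n ^ 2)" by (rule of_int_le_iff[THEN iffD2])
  hence "c * of_int \<bar>n\<bar> \<le> c * of_int n ^ 2" using assms by simp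
  moreover have "exp (- c) ^ nat \<bar>n\<bar> = exp (- (c * of_int \<bar>n\<bar>))"
    by (simp add: exp_of_nat_mult[symmetric] mult.commute)
  ultimately show "exp (- c * of_int n ^ 2) \<le> exp (- c) ^ nat \<bar>n\<bar>" by simp
qed simp_all

section \<open>The finite and the infinite pentagonal number theorem\<close>

definition triangular :: "nat \<Rightarrow> nat" where "triangular s = s * (s + 1) div 2"
lemma triangular_simps [simp]: "triangular 0 = 0" "triangular (Suc s) = triangular s + Suc s"
  by (auto simp: triangular_def)

text \<open>For \<open>s <= n\<close> this is the ratio \<open>(q;q)_n / (q;q)_s\<close> of
  q-Pochhammer symbols. Writing it as a product avoids division, so the finite identity makes sense
  in any commutative ring.\<close>

definition qpoch :: "'a::comm_ring_1 \<Rightarrow> nat \<Rightarrow> nat \<Rightarrow> 'a" where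
  "qpoch q s n = (\<Prod>i\<in>{s<..n}. 1 - q ^ i)"

lemma qpoch_Suc_right: "s \<le> n \<Longrightarrow> qpoch q s (Suc n) = qpoch q s n * (1 - q ^ Suc n)"
proof -
  assume "s \<le> n"
  hence "{s<..Suc n} = insert (Suc n) {s<..n}" by auto
  thus ?thesis by (simp add: qpoch_def)
qed
lemma qpoch_Suc_left: "s < n \<Longrightarrow> qpoch q s n = (1 - q ^ Suc s) * qpoch q (Suc s) n"
proof -
  assume "s < n"
  hence "{s<..n} = insert (Suc s) {Suc s<..n}" by auto
  thus ?thesis by (simp add: qpoch_def)
qed

text \<open>Shanks' finite form of the pentagonal number theorem: as $n \to \infty$, only the term
  $s = 0$ survives on the left.\<close>

lemma shanks_identity:
  fixes q :: "'a::comm_ring_1"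
  shows "(\<Sum>s\<le>n. (-1) ^ s * qpoch q s n * q ^ (s * n + triangular s)) =
    1 + (\<Sum>s=1..n. (-1) ^ s * (q ^ (s * s + triangular (s - 1)) + q ^ (s * s + triangular s)))"
proof (induction n)
  case 0
  then show ?case by (simp add: qpoch_def)
next
  case (Suc n)
  define T where "T s = qpoch q s n * q ^ (s * n + triangular s)" for s
  \<comment> \<open>Both corrections in passing from \<open>n\<close> to \<open>Suc n\<close> telescope, by the identity \<open>V\<close>.\<close>
  define V where "V s = T s * q ^ (n + s + 1)" for s
  have V: "V s = T (Suc s) * (1 - q ^ Suc s)" if "s < n" for s
  proof -
    have "s * n + triangular s + (n + s + 1) = Suc s * n + triangular (Suc s)" by simp
    hence "q ^ (s * n + triangular s) * q ^ (n + s + 1) = q ^ (Suc s * n + triangular (Suc s))"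
      by (metis power_add)
    hence "V s = qpoch q s n * q ^ (Suc s * n + triangular (Suc s))"
      unfolding V_def T_def by (simp only: mult.assoc)
    thus ?thesis by (simp add: T_def qpoch_Suc_left[OF that] mult_ac)
  qed
  \<comment> \<open>Everything rests on
    \<open>(1 - q^(n+1)) q^s = 1 - (1 - q^s) - q^(n+s+1)\<close>: the first piece reproduces the sum
    for \<open>n\<close>, the other two are the corrections.\<close>
  have T': "qpoch q s (Suc n) * q ^ (s * Suc n + triangular s) = T s - T s * (1 - q ^ s) - V s" if "s \<le> n" for s
  proof -
    have e: "q ^ (s * Suc n + triangular s) = q ^ (s * n + triangular s) * q ^ s"
      by (simp add: power_add[symmetric] algebra_simps)
    have "(1 - q ^ Suc n) * q ^ s = 1 - (1 - q ^ s) - q ^ (n + s + 1)"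
      by (simp add: algebra_simps power_add)
    hence "qpoch q s n * q ^ (s * n + triangular s) * ((1 - q ^ Suc n) * q ^ s) = T s * (1 - (1 - q ^ s) - q ^ (n + s + 1))"
      unfolding T_def by (simp only:)
    thus ?thesis unfolding qpoch_Suc_right[OF that] e V_def
      by (simp add: right_diff_distrib mult_ac)
  qed
  have tel: "(\<Sum>s\<le>m. (-1) ^ s * (T s * (1 - q ^ s) + V s)) = (-1) ^ m * V m" if "m \<le> n" for m
    using that
  proof (induction m)
    case (Suc m)
    then show ?case using V[of m] by (simp add: algebra_simps)
  qed simp
  \<comment> \<open>What is left of the telescoping sum, up to sign \<open>V n\<close>, is the first
    of the two new terms on the right-hand side; the summand \<open>s = Suc n\<close> supplies the
    second.\<close>
  have "n * n + triangular n + (n + n + 1) = Suc n * Suc n + triangular n" by simp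
  hence "q ^ (n * n + triangular n) * q ^ (n + n + 1) = q ^ (Suc n * Suc n + triangular n)"
    by (metis power_add)
  hence Vn: "V n = q ^ (Suc n * Suc n + triangular n)"
    by (simp add: V_def T_def qpoch_def mult.assoc)
  have "(\<Sum>s\<le>Suc n. (-1) ^ s * qpoch q s (Suc n) * q ^ (s * Suc n + triangular s)) =
     (\<Sum>s\<le>n. (-1) ^ s * (qpoch q s (Suc n) * q ^ (s * Suc n + triangular s))) + (-1) ^ Suc n * q ^ (Suc n * Suc n + triangular (Suc n))"
    by (simp add: qpoch_def mult_ac)
  also have "(\<Sum>s\<le>n. (-1) ^ s * (qpoch q s (Suc n) * q ^ (s * Suc n + triangular s))) =
      (\<Sum>s\<le>n. (-1) ^ s * T s - (-1) ^ s * (T s * (1 - q ^ s) + V s))"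
    by (intro sum.cong refl, subst T') (auto simp: algebra_simps)
  also have "\<dots> = (\<Sum>s\<le>n. (-1) ^ s * T s) - (-1) ^ n * V n"
    using tel[of n] by (simp add: sum_subtractf)
  also have "(\<Sum>s\<le>n. (-1) ^ s * T s) = 1 + (\<Sum>s=1..n. (-1) ^ s * (q ^ (s * s + triangular (s - 1)) + q ^ (s * s + triangular s)))"
    using Suc.IH by (simp add: T_def mult_ac)
  finally show ?case unfolding Vn by (simp add: algebra_simps)
qed

text \<open>By \<open>1 + x <= exp x\<close> and the geometric series. The point is uniformity in
  both \<open>s\<close> and \<open>n\<close>, which is needed to discard all terms
  \<open>s >= 1\<close> of Shanks' sum at once.\<close>

lemma norm_qpoch_le:
  fixes q :: complex
  assumes "norm q < 1"
  shows "norm (qpoch q s n) \<le> exp (1 / (1 - norm q))"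
proof -
  have "norm (qpoch q s n) = (\<Prod>i\<in>{s<..n}. norm (1 - q ^ i))"
    by (simp add: qpoch_def prod_norm)
  also have "\<dots> \<le> (\<Prod>i\<in>{s<..n}. exp (norm q ^ i))"
  proof (intro prod_mono conjI)
    fix i
    have "norm (1 - q ^ i) \<le> 1 + norm q ^ i"
      by (metis norm_one norm_power norm_triangle_ineq4)
    also have "\<dots> \<le> exp (norm q ^ i)" by (rule exp_ge_add_one_self)
    finally show "norm (1 - q ^ i) \<le> exp (norm q ^ i)" .
  qed auto
  also have "\<dots> = exp (\<Sum>i\<in>{s<..n}. norm q ^ i)" by (simp add: exp_sum)
  also have "(\<Sum>i\<in>{s<..n}. norm q ^ i) \<le> (\<Sum>i. norm q ^ i)"
    by (rule sum_le_suminf) (use assms in \<open>auto intro: summable_geometric\<close>)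
  also have "(\<Sum>i. norm q ^ i) = 1 / (1 - norm q)"
    using assms by (simp add: suminf_geometric)
  finally show ?thesis by simp
qed

text \<open>Generalised pentagonal numbers, indexed by all integers, with the sign convention for
  which \<open>24 * pent n + 1\<close> is the square of \<open>6 n + 1\<close>.\<close>

definition pent :: "int \<Rightarrow> nat" where
  "pent n = nat (n * (3 * n + 1) div 2)"

lemma two_pent: "2 * int (pent n) = n * (3 * n + 1)"
proof -
  have "even (n * (3 * n + 1))" by auto
  moreover have "n * (3 * n + 1) \<ge> 0"
    by (cases "n \<ge> 0") (auto intro: mult_nonneg_nonneg mult_nonpos_nonpos)
  ultimately show ?thesis by (simp add: pent_def pos_imp_zdiv_nonneg_iff)
qed

lemma abs_le_pent: "nat \<bar>n\<bar> \<le> pent n"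
proof -
  have "2 * \<bar>n\<bar> \<le> n * (3 * n + 1)"
  proof (cases "n \<ge> 0")
    case True
    have "n * 2 \<le> n * (3 * n + 1)" if "n > 0"
      using that by (intro mult_left_mono) auto
    with True show ?thesis by (cases "n = 0") auto
  next
    case False
    have "(-n) * 2 \<le> (-n) * (- (3 * n + 1))"
      using False by (intro mult_left_mono) auto
    with False show ?thesis by (simp add: algebra_simps)
  qed
  thus ?thesis using two_pent[of n] by linarith
qed

lemma two_triangular: "2 * int (triangular s) = int s * (int s + 1)"
  by (induction s) (auto simp: algebra_simps)

lemma pent_of_nat: "pent (int s) = s * s + triangular s"
proof -
  have "2 * int (pent (int s)) = 2 * int (s * s + triangular s)"
    unfolding two_pent using two_triangular[of s] by (simp add: algebra_simps)
  thus ?thesis by (simp only: mult_cancel_left of_nat_eq_iff) simp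
qed

lemma pent_minus_of_nat: "s \<ge> 1 \<Longrightarrow> pent (- int s) = s * s + triangular (s - 1)"
proof -
  assume "s \<ge> 1"
  hence "2 * int (pent (- int s)) = 2 * int (s * s + triangular (s - 1))"
    unfolding two_pent using two_triangular[of "s - 1"] by (simp add: algebra_simps of_nat_diff)
  thus ?thesis by (simp only: mult_cancel_left of_nat_eq_iff) simp
qed

lemma sum_symmetric_int_interval:
  fixes f :: "int \<Rightarrow> 'a::comm_monoid_add"
  shows "(\<Sum>n\<in>{- int N..int N}. f n) = f 0 + (\<Sum>s=1..N. f (- int s) + f (int s))"
proof (induction N)
  case (Suc N)
  have "{- int (Suc N)..int (Suc N)} = insert (- int (Suc N)) (insert (int (Suc N)) {- int N..int N})"
    by auto
  thus ?case using Suc.IH by (simp add: add_ac)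
qed simp

lemma convergent_prod_euler:
  fixes q :: "'a::{real_normed_field, banach}"
  assumes "norm q < 1"
  shows "convergent_prod (\<lambda>n. 1 - q ^ Suc n)"
proof -
  have "summable (\<lambda>n. norm q ^ Suc n)"
    using assms by (subst summable_Suc_iff) (simp add: summable_geometric)
  hence "summable (\<lambda>n. norm ((1 - q ^ Suc n) - 1))" by (simp add: norm_power norm_mult)
  thus ?thesis
    by (intro abs_convergent_prod_imp_convergent_prod summable_imp_abs_convergent_prod)
qed

lemma pentagonal_summable:
  fixes q :: complex
  assumes "norm q < 1"
  shows "(\<lambda>n::int. norm ((-1) ^ nat \<bar>n\<bar> * q ^ pent n)) summable_on UNIV"
proof (rule summable_on_comparison_test)
  show "(\<lambda>n::int. norm q ^ nat \<bar>n\<bar>) summable_on UNIV"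
    using assms by (intro summable_on_int_power) auto
  show "norm ((-1) ^ nat \<bar>n\<bar> * q ^ pent n) \<le> norm q ^ nat \<bar>n\<bar>" for n
    using assms abs_le_pent[of n] by (simp add: norm_mult norm_power power_decreasing)
qed simp_all

theorem pentagonal_number_theorem:
  fixes q :: complex
  assumes q: "norm q < 1"
  shows "((\<lambda>n::int. (-1) ^ nat \<bar>n\<bar> * q ^ pent n) has_sum (\<Prod>n. 1 - q ^ Suc n)) UNIV"
proof -
  define f where "f n = (-1) ^ nat \<bar>n\<bar> * q ^ pent n" for n
  have sumf: "(f has_sum infsum f UNIV) UNIV"
    unfolding f_def by (rule has_sum_infsum[OF abs_summable_summable[OF pentagonal_summable[OF q]]])
  have lim1: "(\<lambda>N. \<Sum>n\<in>{- int N..int N}. f n) \<longlonglongrightarrow> infsum f UNIV"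
    using filterlim_compose[OF sumf[unfolded has_sum_def] filterlim_symmetric_int_intervals] .
  have eq: "(\<Sum>n\<in>{- int N..int N}. f n) =
      qpoch q 0 N + (\<Sum>s=1..N. (-1) ^ s * qpoch q s N * q ^ (s * N + triangular s))" for N
  proof -
    have "(\<Sum>n\<in>{- int N..int N}. f n) = f 0 + (\<Sum>s=1..N. f (- int s) + f (int s))"
      by (rule sum_symmetric_int_interval)
    also have "\<dots> = 1 + (\<Sum>s=1..N. (-1) ^ s * (q ^ (s * s + triangular (s - 1)) + q ^ (s * s + triangular s)))"
    proof (intro arg_cong2[where f = "(+)"] sum.cong refl)
      show "f 0 = 1" by (simp add: f_def pent_def)
    qed (auto simp: f_def pent_of_nat pent_minus_of_nat distrib_left)
    also have "\<dots> = (\<Sum>s\<le>N. (-1) ^ s * qpoch q s N * q ^ (s * N + triangular s))"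
      by (rule shanks_identity[symmetric])
    also have "{..N} = insert 0 {1..N}" by auto
    finally show ?thesis by simp
  qed
  \<comment> \<open>Every exponent with \<open>s >= 1\<close> is at least \<open>N\<close>, so the
    \<open>N\<close> remaining terms together are \<open>O(N |q|^N)\<close>.\<close>
  have lim3: "(\<lambda>N. \<Sum>s=1..N. (-1) ^ s * qpoch q s N * q ^ (s * N + triangular s)) \<longlonglongrightarrow> 0"
  proof (rule Lim_null_comparison)
    define C where "C = exp (1 / (1 - norm q))"
    show "\<forall>\<^sub>F N in sequentially. norm (\<Sum>s=1..N. (-1) ^ s * qpoch q s N * q ^ (s * N + triangular s))
        \<le> C * (of_nat N * norm q ^ N)"
    proof (intro always_eventually allI)
      fix N
      have "norm (\<Sum>s=1..N. (-1) ^ s * qpoch q s N * q ^ (s * N + triangular s)) \<le> (\<Sum>s=1..N. C * norm q ^ N)"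
      proof (rule sum_norm_le)
        fix s assume s: "s \<in> {1..N}"
        have "N \<le> s * N + triangular s" using s by (cases s) auto
        hence "norm q ^ (s * N + triangular s) \<le> norm q ^ N"
          using q by (intro power_decreasing) (simp_all del: One_nat_def)
        thus "norm ((-1) ^ s * qpoch q s N * q ^ (s * N + triangular s)) \<le> C * norm q ^ N"
          using norm_qpoch_le[OF q, of s N] unfolding C_def
          by (auto simp: norm_mult norm_power intro!: mult_mono)
      qed
      thus "norm (\<Sum>s=1..N. (-1) ^ s * qpoch q s N * q ^ (s * N + triangular s)) \<le> C * (of_nat N * norm q ^ N)"
        by (simp add: mult_ac)
    qed
    have "(\<lambda>N. of_nat N * norm q ^ N) \<longlonglongrightarrow> 0"
      using q by (intro powser_times_n_limit_0) auto
    thus "(\<lambda>N. C * (of_nat N * norm q ^ N)) \<longlonglongrightarrow> 0"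
      by (rule tendsto_mult_right_zero)
  qed
  have lim2: "(\<lambda>N. qpoch q 0 N) \<longlonglongrightarrow> (\<Prod>n. 1 - q ^ Suc n)"
  proof -
    have "qpoch q 0 (Suc N) = (\<Prod>i\<le>N. 1 - q ^ Suc i)" for N
      by (induction N) (simp_all add: qpoch_Suc_right, simp add: qpoch_def)
    hence "(\<lambda>N. qpoch q 0 (Suc N)) \<longlonglongrightarrow> (\<Prod>n. 1 - q ^ Suc n)"
      using convergent_prod_LIMSEQ[OF convergent_prod_euler[OF q]] by simp
    thus ?thesis by (rule LIMSEQ_imp_Suc)
  qed
  have "(\<lambda>N. \<Sum>n\<in>{- int N..int N}. f n) \<longlonglongrightarrow> (\<Prod>n. 1 - q ^ Suc n)"
    unfolding eq using tendsto_add[OF lim2 lim3] by simp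
  with lim1 have "infsum f UNIV = (\<Prod>n. 1 - q ^ Suc n)" by (rule LIMSEQ_unique)
  with sumf show ?thesis unfolding f_def by simp
qed

section \<open>Eta as a series of Gaussians\<close>

lemma norm_nome: "norm (nome z) = exp (- 2 * pi * Im z)"
  by (simp add: nome_def norm_exp_eq_Re)

lemma norm_nome_less_1: "Im z > 0 \<Longrightarrow> norm (nome z) < 1"
  by (simp add: norm_nome)

text \<open>The factor \<open>q^(1/24)\<close> completes the square in the pentagonal exponent,
  since \<open>pent n + 1/24 = (6n+1)^2/24\<close>. In this form the terms are Gaussians, to which
  Poisson summation applies.\<close>

definition eta_term :: "complex \<Rightarrow> int \<Rightarrow> complex" where
  "eta_term z n = (-1) ^ nat \<bar>n\<bar> * exp (2 * of_real pi * \<i> * z * of_int ((6 * n + 1)\<^sup>2) / 24)"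

lemma eta_term_eq: "eta_term z n = nome (z / 24) * ((-1) ^ nat \<bar>n\<bar> * nome z ^ pent n)"
proof -
  have "24 * int (pent n) + 1 = (6 * n + 1)\<^sup>2"
    using two_pent[of n] by (simp add: power2_eq_square algebra_simps)
  hence "(of_int ((6 * n + 1)\<^sup>2) :: complex) = of_int (24 * int (pent n) + 1)" by (simp only:)
  hence "(of_int ((6 * n + 1)\<^sup>2) :: complex) = 24 * of_nat (pent n) + 1" by simp
  hence E: "2 * of_real pi * \<i> * z * of_int ((6 * n + 1)\<^sup>2) / 24 =
      2 * of_real pi * \<i> * (z / 24) + of_nat (pent n) * (2 * of_real pi * \<i> * z)"
    by (simp only:) (simp add: field_simps)
  show ?thesis unfolding eta_term_def nome_def E exp_add exp_of_nat_mult by (simp only: mult_ac)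
qed

lemma eta_term_abs_summable:
  assumes "Im z > 0"
  shows "(\<lambda>n. norm (eta_term z n)) summable_on UNIV"
proof -
  have "(\<lambda>n. norm (nome (z / 24)) * norm ((-1) ^ nat \<bar>n\<bar> * nome z ^ pent n)) summable_on UNIV"
    by (intro summable_on_cmult_right pentagonal_summable norm_nome_less_1 assms)
  thus ?thesis by (simp add: eta_term_eq norm_mult)
qed

lemma dedekind_eta_has_sum:
  assumes "Im z > 0"
  shows "(eta_term z has_sum dedekind_eta z) UNIV"
  unfolding dedekind_eta_def eta_term_eq[abs_def]
  by (intro has_sum_cmult_right pentagonal_number_theorem norm_nome_less_1 assms)

section \<open>Poisson summation for Gaussians\<close>

text \<open>This is the characteristic function of the standard normal distribution after the
  substitution \<open>x -> c x\<close> with \<open>c = sqrt (2 pi s)\<close>.\<close>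

lemma gaussian_fourier_transform:
  fixes s k :: real
  assumes "s > 0"
  shows "integrable lborel (\<lambda>x. of_real (exp (- pi * s * x\<^sup>2)) * cis (- 2 * pi * k * x))"
    and "integral\<^sup>L lborel (\<lambda>x. of_real (exp (- pi * s * x\<^sup>2)) * cis (- 2 * pi * k * x)) =
           of_real (exp (- pi * k\<^sup>2 / s) / sqrt s)"
proof -
  define c where "c = sqrt (2 * pi * s)"
  have c: "c > 0" "c\<^sup>2 = 2 * pi * s" using assms by (auto simp: c_def)
  define t where "t = - 2 * pi * k / c"
  have "(CLINT x|lborel. std_normal_density x *\<^sub>R iexp (t * x)) = char std_normal_distribution t"
    unfolding char_def by (subst integral_density) auto
  also have "\<dots> = of_real (exp (- (t\<^sup>2) / 2))" by (simp add: char_std_normal_distribution)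
  also have "t\<^sup>2 = 4 * pi\<^sup>2 * k\<^sup>2 / c\<^sup>2" by (simp add: t_def power_divide power_mult_distrib)
  also have "\<dots> = 2 * pi * k\<^sup>2 / s" unfolding c using assms by (simp add: field_simps power2_eq_square)
  also have "- (2 * pi * k\<^sup>2 / s) / 2 = - pi * k\<^sup>2 / s" by simp
  finally have 1: "(CLINT x|lborel. std_normal_density x *\<^sub>R iexp (t * x)) = of_real (exp (- pi * k\<^sup>2 / s))" .
  \<comment> \<open>The integral of a non-integrable function is 0 by convention, so a nonzero value
    certifies integrability.\<close>
  have nz: "integral\<^sup>L lborel (\<lambda>x. std_normal_density x *\<^sub>R iexp (t * x)) \<noteq> 0" unfolding 1 by simp
  hence int: "integrable lborel (\<lambda>x. std_normal_density x *\<^sub>R iexp (t * x))"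
    using not_integrable_integral_eq by blast
  have eq: "std_normal_density (0 + c * x) *\<^sub>R iexp (t * (0 + c * x)) =
      of_real (1 / sqrt (2 * pi)) * (of_real (exp (- pi * s * x\<^sup>2)) * cis (- 2 * pi * k * x))" for x
  proof -
    have "(c * x)\<^sup>2 / 2 = pi * s * x\<^sup>2" using c by (simp add: power_mult_distrib)
    moreover have "t * (c * x) = - 2 * pi * k * x" using c by (simp add: t_def)
    ultimately show ?thesis
      by (simp add: std_normal_density_def cis_conv_exp scaleR_conv_of_real minus_divide_left[symmetric] mult_ac
          del: minus_divide_left)
  qed
  from lborel_integrable_real_affine[OF int, of c 0] c
  have "integrable lborel (\<lambda>x. of_real (1 / sqrt (2 * pi)) * (of_real (exp (- pi * s * x\<^sup>2)) * cis (- 2 * pi * k * x)))"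
    unfolding eq by simp
  hence "integrable lborel (\<lambda>x. of_real (sqrt (2 * pi)) * (of_real (1 / sqrt (2 * pi)) *
      (of_real (exp (- pi * s * x\<^sup>2)) * cis (- 2 * pi * k * x))))"
    by (rule integrable_mult_right)
  moreover have "of_real (sqrt (2 * pi)) * (of_real (1 / sqrt (2 * pi)) * w) = w" for w :: complex
    by simp
  ultimately show "integrable lborel (\<lambda>x. of_real (exp (- pi * s * x\<^sup>2)) * cis (- 2 * pi * k * x))"
    by (simp only:)
  have "of_real (exp (- pi * k\<^sup>2 / s)) =
      c *\<^sub>R (CLINT x|lborel. std_normal_density (0 + c * x) *\<^sub>R iexp (t * (0 + c * x)))"
    using lborel_integral_real_affine[of c "\<lambda>x. std_normal_density x *\<^sub>R iexp (t * x)" 0] c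
    unfolding 1 by simp
  also have "\<dots> = of_real (c / sqrt (2 * pi)) *
      (CLINT x|lborel. of_real (exp (- pi * s * x\<^sup>2)) * cis (- 2 * pi * k * x))"
    unfolding eq by (simp add: scaleR_conv_of_real)
  also have "c / sqrt (2 * pi) = sqrt s" using assms by (simp add: c_def real_sqrt_mult)
  finally show "integral\<^sup>L lborel (\<lambda>x. of_real (exp (- pi * s * x\<^sup>2)) * cis (- 2 * pi * k * x)) =
           of_real (exp (- pi * k\<^sup>2 / s) / sqrt s)"
    using assms by (simp add: field_simps)
qed

text \<open>The unfolding step of Poisson summation: the translates of \<open>[-1/2, 1/2]\<close> by
  \<open>-N, ..., N\<close> tile an interval, whence the half-integral end points.\<close>

lemma sum_integral_unit_translates:
  fixes f :: "real \<Rightarrow> complex"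
  assumes "continuous_on UNIV f"
  shows "(\<Sum>n\<in>{- int N..int N}. integral {-1/2..1/2} (\<lambda>x. f (x + of_int n))) =
    integral {- (real N + 1/2)..real N + 1/2} f"
proof (induction N)
  case (Suc N)
  have int: "f integrable_on {a..b}" for a b
    by (rule integrable_continuous_real) (use assms continuous_on_subset in blast)
  have shift: "integral {-1/2..1/2} (\<lambda>x. f (x + c)) = integral {c - 1/2..c + 1/2} f" for c
  proof -
    have "((\<lambda>x. f (x + c)) has_integral integral {c - 1/2..c + 1/2} f) {-1/2..1/2}"
      using has_integral_shift_real_ivl_iff[of f "integral {c - 1/2..c + 1/2} f" "c - 1/2" "c + 1/2" c]
        integrable_integral[OF int[of "c - 1/2" "c + 1/2"]] by simp
    thus ?thesis by (rule integral_unique)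
  qed
  have "{- int (Suc N)..int (Suc N)} = insert (- int (Suc N)) (insert (int (Suc N)) {- int N..int N})"
    by auto
  hence "(\<Sum>n\<in>{- int (Suc N)..int (Suc N)}. integral {-1/2..1/2} (\<lambda>x. f (x + of_int n))) =
     integral {- (real N + 1) - 1/2..- (real N + 1) + 1/2} f +
     (integral {real N + 1 - 1/2..real N + 1 + 1/2} f + integral {- (real N + 1/2)..real N + 1/2} f)"
    using Suc.IH shift[of "real N + 1"] shift[of "- (real N + 1)"] by (simp add: add_ac)
  also have "integral {real N + 1 - 1/2..real N + 1 + 1/2} f + integral {- (real N + 1/2)..real N + 1/2} f
     = integral {- (real N + 1/2)..real N + 1 + 1/2} f"
    using Henstock_Kurzweil_Integration.integral_combine[where f = f and a = "- (real N + 1/2)" and c = "real N + 1/2" and b = "real N + 1 + 1/2"] int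
    by (simp add: add_ac)
  also have "integral {- (real N + 1) - 1/2..- (real N + 1) + 1/2} f + \<dots> =
      integral {- (real N + 1) - 1/2..real N + 1 + 1/2} f"
    using Henstock_Kurzweil_Integration.integral_combine[where f = f and a = "- (real N + 1) - 1/2" and c = "- (real N + 1/2)" and b = "real N + 1 + 1/2"] int
    by (simp add: add_ac)
  finally show ?case by (simp add: add_ac)
qed (use assms in simp)

lemma tendsto_integral_symmetric:
  fixes f :: "real \<Rightarrow> complex"
  assumes int: "integrable lborel f"
  shows "(\<lambda>N. integral {- (real N + 1/2)..real N + 1/2} f) \<longlonglongrightarrow> integral\<^sup>L lborel f"
proof -
  define A where "A N = {- (real N + 1/2)..real N + 1/2}" for N
  have "(\<lambda>N. integral\<^sup>L lborel (\<lambda>x. indicator (A N) x *\<^sub>R f x)) \<longlonglongrightarrow> integral\<^sup>L lborel f"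
  proof (rule integral_dominated_convergence)
    show "integrable lborel (\<lambda>x. norm (f x))" using int by simp
    show "f \<in> borel_measurable lborel" using int by simp
    show "(\<lambda>x. indicator (A N) x *\<^sub>R f x) \<in> borel_measurable lborel" for N
      using int unfolding A_def by (intro borel_measurable_scaleR borel_measurable_indicator) auto
    show "AE x in lborel. norm (indicator (A N) x *\<^sub>R f x) \<le> norm (f x)" for N
      by (auto simp: indicator_def)
    show "AE x in lborel. (\<lambda>N. indicator (A N) x *\<^sub>R f x) \<longlonglongrightarrow> f x"
    proof (intro AE_I2 tendsto_eventually)
      fix x :: real
      obtain M :: nat where "\<bar>x\<bar> \<le> real M" using real_arch_simple by blast
      hence "x \<in> A N" if "N \<ge> M" for N using that unfolding A_def by auto
      thus "\<forall>\<^sub>F N in sequentially. indicator (A N) x *\<^sub>R f x = f x"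
        by (auto simp: eventually_sequentially intro!: exI[of _ M])
    qed
  qed
  moreover have "integral\<^sup>L lborel (\<lambda>x. indicator (A N) x *\<^sub>R f x) = integral (A N) f" for N
  proof -
    have "set_integrable lborel (A N) f"
      unfolding set_integrable_def A_def by (intro integrable_mult_indicator int) auto
    from set_borel_integral_eq_integral(2)[OF this] show ?thesis
      by (simp add: set_lebesgue_integral_def)
  qed
  ultimately show ?thesis by (simp add: A_def)
qed

text \<open>If $f(0) \neq 0$, integrate $f$ against powers of the trigonometric polynomial
  $T(x) = \cos 2\pi x + 1 - \cos 2\pi d$: it exceeds 1 only near 0 and is bounded by 1 in absolute value
  elsewhere, so the integrals would grow exponentially.\<close>

lemma fourier_coefficients_zero_imp_zero_at_0:
  fixes f :: "real \<Rightarrow> complex"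
  assumes cont: "continuous_on {-1/2..1/2} f"
    and zero: "\<And>k::int. integral {-1/2..1/2} (\<lambda>x. f x * cis (2 * pi * of_int k * x)) = 0"
  shows "f 0 = 0"
proof (rule ccontr)
  assume f0: "f 0 \<noteq> 0"
  define g where "g x = Re (cnj (f 0) * f x)" for x
  have contg: "continuous_on {-1/2..1/2} g" unfolding g_def by (intro continuous_intros cont)
  have g0: "g 0 > 0"
  proof -
    have "cnj (f 0) * f 0 = of_real ((cmod (f 0))\<^sup>2)"
      by (subst complex_norm_square) (rule mult.commute)
    thus ?thesis using f0 unfolding g_def by (simp only: Re_complex_of_real) simp
  qed
  obtain d0 where d0: "d0 > 0" "\<And>x. x \<in> {-1/2..1/2} \<Longrightarrow> \<bar>x\<bar> < d0 \<Longrightarrow> \<bar>g x - g 0\<bar> < g 0 / 2"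
    using contg g0 unfolding continuous_on_iff dist_real_def
    by (metis (no_types, lifting) atLeastAtMost_iff diff_zero divide_nonneg_nonneg half_gt_zero
        less_eq_real_def divide_minus_left neg_le_0_iff_le zero_le_numeral zero_le_one)
  \<comment> \<open>The bound 1/4 keeps \<open>[-d, d]\<close> inside the period and
    \<open>2 pi d\<close> in the range where the cosine decreases; halving \<open>d0\<close> makes
    the lower bound for \<open>g\<close> valid at the end points too.\<close>
  define d where "d = min (1/4) (d0 / 2)"
  have d: "0 < d" "d \<le> 1/4" "d < d0" using d0 by (auto simp: d_def)
  define e where "e = g 0 / 2"
  have e: "e > 0" using g0 by (simp add: e_def)
  have ge: "g x \<ge> e" if "\<bar>x\<bar> \<le> d" for x
    using d0(2)[of x] that d unfolding e_def by (auto simp: abs_if split: if_splits)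
  define T where "T x = cos (2 * pi * x) + (1 - cos (2 * pi * d))" for x
  have contT: "continuous_on A T" for A unfolding T_def by (intro continuous_intros)
  \<comment> \<open>Multiplication by the cosine shifts the frequency by 1 in both directions, so
    orthogonality to all characters passes from \<open>f T^n\<close> to \<open>f T^(n+1)\<close>.
    The induction therefore has to treat all \<open>k\<close> simultaneously.\<close>
  have vanish: "integral {-1/2..1/2} (\<lambda>x. f x * cis (2 * pi * of_int k * x) * of_real (T x) ^ n) = 0" for n k
  proof (induction n arbitrary: k)
    case 0
    show ?case using zero by simp
  next
    case (Suc n)
    let ?h = "\<lambda>k x. f x * cis (2 * pi * of_int k * x) * of_real (T x) ^ n"
    have int: "?h k integrable_on {-1/2..1/2}" for k
      by (intro integrable_continuous_real continuous_intros cont contT)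
    have "f x * cis (2 * pi * of_int k * x) * of_real (T x) ^ Suc n =
        1/2 * ?h (k + 1) x + 1/2 * ?h (k - 1) x + of_real (1 - cos (2 * pi * d)) * ?h k x" for x
    proof -
      have C: "of_real (cos (2 * pi * x)) = (cis (2 * pi * x) + cis (- (2 * pi * x))) / 2"
        by (simp add: complex_eq_iff)
      have "cis (2 * pi * of_int k * x) * of_real (T x) =
         1/2 * (cis (2 * pi * of_int k * x) * cis (2 * pi * x)) + 1/2 * (cis (2 * pi * of_int k * x) * cis (- (2 * pi * x)))
         + of_real (1 - cos (2 * pi * d)) * cis (2 * pi * of_int k * x)"
        unfolding T_def of_real_add C by (simp add: field_simps)
      also have "cis (2 * pi * of_int k * x) * cis (2 * pi * x) = cis (2 * pi * of_int (k + 1) * x)"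
        by (simp add: cis_mult algebra_simps)
      also have "cis (2 * pi * of_int k * x) * cis (- (2 * pi * x)) = cis (2 * pi * of_int (k - 1) * x)"
        by (simp add: cis_mult algebra_simps)
      finally have "f x * (cis (2 * pi * of_int k * x) * of_real (T x)) * of_real (T x) ^ n = f x *
         (1/2 * cis (2 * pi * of_int (k + 1) * x) + 1/2 * cis (2 * pi * of_int (k - 1) * x)
         + of_real (1 - cos (2 * pi * d)) * cis (2 * pi * of_int k * x)) * of_real (T x) ^ n"
        by (simp only:)
      thus ?thesis by (simp only: power_Suc distrib_left distrib_right mult_ac)
    qed
    hence "(\<lambda>x. f x * cis (2 * pi * of_int k * x) * of_real (T x) ^ Suc n) =
        (\<lambda>x. 1/2 * ?h (k + 1) x + 1/2 * ?h (k - 1) x + of_real (1 - cos (2 * pi * d)) * ?h k x)"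
      by (rule ext)
    moreover have "((\<lambda>x. 1/2 * ?h (k + 1) x + 1/2 * ?h (k - 1) x + of_real (1 - cos (2 * pi * d)) * ?h k x)
        has_integral 1/2 * 0 + 1/2 * 0 + of_real (1 - cos (2 * pi * d)) * 0) {-1/2..1/2}"
    proof -
      have "(?h j has_integral 0) {-1/2..1/2}" for j
        using integrable_integral[OF int[of j]] unfolding Suc.IH .
      thus ?thesis by (intro has_integral_add has_integral_mult_right)
    qed
    ultimately show ?case by (simp add: integral_unique)
  qed
  have vg: "integral {-1/2..1/2} (\<lambda>x. g x * T x ^ n) = 0" for n
  proof -
    have int: "(\<lambda>x. f x * of_real (T x) ^ n) integrable_on {-1/2..1/2}"
      by (intro integrable_continuous_real continuous_intros cont contT)
    have "((\<lambda>x. f x * of_real (T x) ^ n) has_integral 0) {-1/2..1/2}"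
      using integrable_integral[OF int] vanish[of 0 n] by simp
    hence "((\<lambda>x. cnj (f 0) * (f x * of_real (T x) ^ n)) has_integral cnj (f 0) * 0) {-1/2..1/2}"
      by (rule has_integral_mult_right)
    hence "((\<lambda>x. Re (cnj (f 0) * (f x * of_real (T x) ^ n))) has_integral Re (cnj (f 0) * 0)) {-1/2..1/2}"
      by (rule has_integral_linear[OF _ bounded_linear_Re, unfolded o_def])
    moreover have "Re (cnj (f 0) * (f x * of_real (T x) ^ n)) = g x * T x ^ n" for x
      unfolding g_def of_real_power[symmetric] mult.assoc[symmetric] by simp
    ultimately show ?thesis by (simp add: integral_unique)
  qed
  obtain M where M: "\<And>x. x \<in> {-1/2..1/2} \<Longrightarrow> \<bar>g x\<bar> \<le> M"
  proof -
    have "compact (g ` {-1/2..1/2})" by (intro compact_continuous_image contg) auto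
    from compact_imp_bounded[OF this] obtain B where "\<And>y. y \<in> g ` {-1/2..1/2} \<Longrightarrow> norm y \<le> B"
      unfolding bounded_iff by blast
    thus ?thesis by (intro that[of B]) auto
  qed
  have M0: "M \<ge> 0" using M[of 0] by auto
  have cosabs: "cos (2 * pi * x) = cos (2 * pi * \<bar>x\<bar>)" for x by (cases "x \<ge> 0") auto
  define h where "h = cos (pi * d) - cos (2 * pi * d)"
  have h: "h > 0"
    unfolding h_def using d cos_monotone_0_pi[of "pi * d" "2 * pi * d"] by (simp add: pi_gt_zero)
  have T1: "\<bar>T x\<bar> \<le> 1" if "x \<in> {-1/2..1/2}" "\<bar>x\<bar> \<ge> d" for x
  proof -
    have "cos (2 * pi * \<bar>x\<bar>) \<le> cos (2 * pi * d)"
      using that d by (intro cos_monotone_0_pi_le) (auto simp: abs_if)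
    moreover have "cos (2 * pi * x) \<ge> -1" "cos (2 * pi * d) \<le> 1" by auto
    ultimately show ?thesis unfolding T_def using cosabs[of x] by linarith
  qed
  have T2: "T x \<ge> 1" if "\<bar>x\<bar> \<le> d" for x
  proof -
    have "cos (2 * pi * d) \<le> cos (2 * pi * \<bar>x\<bar>)"
      using that d by (intro cos_monotone_0_pi_le) (auto simp: abs_if)
    thus ?thesis unfolding T_def using cosabs[of x] by linarith
  qed
  have T3: "T x \<ge> 1 + h" if "\<bar>x\<bar> \<le> d / 2" for x
  proof -
    have "cos (2 * pi * (d / 2)) \<le> cos (2 * pi * \<bar>x\<bar>)"
      using that d by (intro cos_monotone_0_pi_le mult_left_mono) auto
    thus ?thesis unfolding T_def h_def using cosabs[of x] by simp
  qed
  \<comment> \<open>Adding the constant \<open>M\<close> makes the integrand nonnegative on the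
    whole period. The integral, which equals \<open>M\<close>, is then at least its part over
    \<open>[-d/2, d/2]\<close>, an interval of length \<open>d\<close>.\<close>
  have key: "e * (1 + h) ^ n * d \<le> M" for n
  proof -
    define G where "G x = g x * T x ^ n + M" for x
    have contG: "continuous_on {-1/2..1/2} G"
      unfolding G_def by (intro continuous_intros contg contT)
    have G0: "G x \<ge> 0" if "x \<in> {-1/2..1/2}" for x
    proof (cases "\<bar>x\<bar> \<le> d")
      case True
      thus ?thesis unfolding G_def using T2[of x] ge[of x] e M0 by (intro add_nonneg_nonneg mult_nonneg_nonneg) auto
    next
      case False
      hence "\<bar>g x\<bar> * \<bar>T x\<bar> ^ n \<le> M * 1"
        using M[OF that] T1[OF that] M0 by (intro mult_mono) (auto intro: power_le_one)
      hence "\<bar>g x * T x ^ n\<bar> \<le> M" by (simp add: abs_mult power_abs)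
      thus ?thesis unfolding G_def by linarith
    qed
    have G1: "G x \<ge> e * (1 + h) ^ n" if "x \<in> {-d/2..d/2}" for x
    proof -
      have "\<bar>x\<bar> \<le> d / 2" using that by auto
      hence "g x * T x ^ n \<ge> e * (1 + h) ^ n"
        using ge[of x] T3[of x] e h d by (intro mult_mono power_mono) auto
      thus ?thesis unfolding G_def using M0 by linarith
    qed
    have sub: "{-d/2..d/2} \<subseteq> {-1/2..1/2}" using d by auto
    have i1: "G integrable_on {-d/2..d/2}"
      using contG sub by (intro integrable_continuous_real) (rule continuous_on_subset)
    have i2: "G integrable_on {-1/2..1/2}" using contG by (rule integrable_continuous_real)
    have "e * (1 + h) ^ n * d = integral {-d/2..d/2} (\<lambda>x. e * (1 + h) ^ n)"
      using d by simp
    also have "\<dots> \<le> integral {-d/2..d/2} G" using G1 i1 by (intro integral_le) auto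
    also have "\<dots> \<le> integral {-1/2..1/2} G"
      by (rule integral_subset_le) (use sub i1 i2 G0 in auto)
    also have "\<dots> = integral {-1/2..1/2} (\<lambda>x. g x * T x ^ n) + integral {-1/2..1/2::real} (\<lambda>x. M)"
      unfolding G_def by (intro integral_add integrable_continuous_real continuous_intros contg contT)
    also have "\<dots> = M" using vg[of n] by simp
    finally show ?thesis .
  qed
  obtain n where "M / (e * d) < (1 + h) ^ n" using real_arch_pow[of "1 + h" "M / (e * d)"] h by auto
  hence "M < e * (1 + h) ^ n * d" using e d by (simp add: field_simps)
  with key[of n] show False by simp
qed

text \<open>Both parts follow from uniform convergence by the Weierstrass M-test. The termwise
  integral is stated as a limit over \<open>{- N..N}\<close> so that it can be compared with the
  tiling by unit translates.\<close>

lemma infsum_integral_interval: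
  fixes f :: "int \<Rightarrow> real \<Rightarrow> complex"
  assumes M: "M summable_on UNIV" and le: "\<And>n x. x \<in> {a..b} \<Longrightarrow> norm (f n x) \<le> M n"
    and cont: "\<And>n. continuous_on {a..b} (f n)"
  shows "continuous_on {a..b} (\<lambda>x. \<Sum>\<^sub>\<infinity>n. f n x)"
    and "(\<lambda>N. \<Sum>n\<in>{- int N..int N}. integral {a..b} (f n)) \<longlonglongrightarrow> integral {a..b} (\<lambda>x. \<Sum>\<^sub>\<infinity>n. f n x)"
proof -
  have "uniform_limit {a..b} (\<lambda>X x. \<Sum>n\<in>X. f n x) (\<lambda>x. \<Sum>\<^sub>\<infinity>n. f n x) (finite_subsets_at_top UNIV)"
    by (rule Weierstrass_m_test_general) (use M le in auto)
  hence u: "uniform_limit {a..b} (\<lambda>N x. \<Sum>n\<in>{- int N..int N}. f n x) (\<lambda>x. \<Sum>\<^sub>\<infinity>n. f n x) sequentially"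
    using filterlim_symmetric_int_intervals by (rule filterlim_compose)
  have c: "continuous_on {a..b} (\<lambda>x. \<Sum>n\<in>{- int N..int N}. f n x)" for N
    by (intro continuous_on_sum cont)
  show "continuous_on {a..b} (\<lambda>x. \<Sum>\<^sub>\<infinity>n. f n x)"
    by (rule uniform_limit_theorem[OF _ u]) (use c in auto)
  obtain I J where I: "\<And>N. ((\<lambda>x. \<Sum>n\<in>{- int N..int N}. f n x) has_integral I N) {a..b}"
    and J: "((\<lambda>x. \<Sum>\<^sub>\<infinity>n. f n x) has_integral J) {a..b}" and IJ: "I \<longlonglongrightarrow> J"
    using uniform_limit_integral[OF u c] by auto
  have "I N = (\<Sum>n\<in>{- int N..int N}. integral {a..b} (f n))" for N
  proof -
    have "I N = integral {a..b} (\<lambda>x. \<Sum>n\<in>{- int N..int N}. f n x)"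
      using integral_unique[OF I[of N]] by simp
    also have "\<dots> = (\<Sum>n\<in>{- int N..int N}. integral {a..b} (f n))"
      by (intro integral_sum integrable_continuous_real cont) auto
    finally show ?thesis .
  qed
  hence "I = (\<lambda>N. \<Sum>n\<in>{- int N..int N}. integral {a..b} (f n))" by (rule ext)
  with IJ J show "(\<lambda>N. \<Sum>n\<in>{- int N..int N}. integral {a..b} (f n)) \<longlonglongrightarrow> integral {a..b} (\<lambda>x. \<Sum>\<^sub>\<infinity>n. f n x)"
    by (simp add: integral_unique)
qed

text \<open>From \<open>(u + n)^2 >= n^2/2 - u^2\<close>, which is
  \<open>2 (u + n/2)^2 >= 0\<close>. The majorant does not depend on \<open>u\<close> within the
  bound, as the M-test requires.\<close>

lemma exp_translate_square_le:
  fixes s u :: real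
  assumes "s > 0" "\<bar>u\<bar> \<le> B"
  shows "exp (- pi * s * (u + of_int n)\<^sup>2) \<le> exp (pi * s * B\<^sup>2) * exp (- (pi * s / 2) * of_int n ^ 2)"
proof -
  have "0 \<le> 2 * (u + of_int n / 2)\<^sup>2" by simp
  also have "\<dots> = (u + of_int n)\<^sup>2 + u\<^sup>2 - of_int n ^ 2 / 2" by (simp add: power2_eq_square algebra_simps)
  finally have "of_int n ^ 2 / 2 - u\<^sup>2 \<le> (u + of_int n)\<^sup>2" by simp
  moreover have "u\<^sup>2 \<le> B\<^sup>2" using power_mono[OF assms(2), of 2] by simp
  ultimately have "of_int n ^ 2 / 2 - B\<^sup>2 \<le> (u + of_int n)\<^sup>2" by linarith
  hence "(pi * s) * (of_int n ^ 2 / 2 - B\<^sup>2) \<le> (pi * s) * (u + of_int n)\<^sup>2"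
    using assms by (intro mult_left_mono) auto
  thus ?thesis by (simp add: mult_exp_exp algebra_simps)
qed

lemma summable_gaussian_translates:
  fixes s u :: real
  assumes "s > 0"
  shows "(\<lambda>n::int. exp (- pi * s * (u + of_int n)\<^sup>2)) summable_on UNIV"
proof (rule summable_on_comparison_test)
  have "(\<lambda>n::int. exp (- (pi * s / 2) * of_int n ^ 2)) summable_on UNIV"
    by (rule summable_on_int_exp_square) (use assms in auto)
  thus "(\<lambda>n::int. exp (pi * s * \<bar>u\<bar>\<^sup>2) * exp (- (pi * s / 2) * of_int n ^ 2)) summable_on UNIV"
    by (rule summable_on_cmult_right)
  show "exp (- pi * s * (u + of_int n)\<^sup>2) \<le> exp (pi * s * \<bar>u\<bar>\<^sup>2) * exp (- (pi * s / 2) * of_int n ^ 2)" for n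
    by (rule exp_translate_square_le) (use assms in auto)
qed simp_all

lemma integral_cis_unit_interval:
  "integral {-1/2..1/2} (\<lambda>x. cis (2 * pi * of_int k * x)) = (if k = 0 then 1 else 0)"
proof (cases "k = 0")
  case False
  define F where "F x = cis (2 * pi * of_int k * x) / (2 * pi * of_int k * \<i>)" for x
  have "((\<lambda>x. cis (2 * pi * of_int k * x)) has_integral F (1/2) - F (-1/2)) {-1/2..1/2}"
  proof (rule fundamental_theorem_of_calculus)
    fix x :: real
    have "(F has_vector_derivative (2 * pi * of_int k) *\<^sub>R (\<i> * cis (2 * pi * of_int k * x)) / (2 * pi * of_int k * \<i>))
            (at x within {-1/2..1/2})"
      unfolding F_def cis_conv_exp
      by (auto intro!: derivative_eq_intros has_vector_derivative_real_field simp: scaleR_conv_of_real)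
    thus "(F has_vector_derivative cis (2 * pi * of_int k * x)) (at x within {-1/2..1/2})"
      using False by (simp add: scaleR_conv_of_real)
  qed auto
  moreover have "F (1/2) = F (-1/2)"
  proof -
    have "cis (2 * pi * of_int k * (1/2)) = cis (2 * pi * of_int k * (-1/2)) * cis (2 * pi * of_int k)"
      unfolding cis_mult by (rule arg_cong[of _ _ cis]) (simp add: algebra_simps)
    also have "cis (2 * pi * of_int k) = 1" by (metis cis_multiple_2pi Ints_of_int)
    finally show ?thesis by (simp add: F_def)
  qed
  ultimately show ?thesis using False by (simp add: integral_unique)
qed simp

lemma cis_2pi_int: "cis (2 * pi * of_int k * of_int n) = 1"
  using cis_multiple_2pi[of "of_int (k * n)"] by (simp add: mult_ac)

text \<open>With \<open>\<alpha> + x\<close> in place of \<open>\<alpha>\<close>, both sides become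
  continuous functions of \<open>x\<close> with the same Fourier coefficients: on the left by
  unfolding to the Fourier transform over the real line, on the right by orthogonality of
  characters. Vanishing coefficients force the difference to be 0 at \<open>x = 0\<close>.\<close>

theorem poisson_gaussian:
  fixes s \<alpha> :: real
  assumes s: "s > 0"
  shows "(\<Sum>\<^sub>\<infinity>n::int. of_real (exp (- pi * s * (\<alpha> + of_int n)\<^sup>2))) =
    (\<Sum>\<^sub>\<infinity>k::int. of_real (exp (- pi * of_int k ^ 2 / s) / sqrt s) * cis (2 * pi * of_int k * \<alpha>))"
proof -
  define a where "a n x = complex_of_real (exp (- pi * s * (\<alpha> + x + of_int n)\<^sup>2))" for n :: int and x
  define c where "c k = exp (- pi * of_int k ^ 2 / s) / sqrt s" for k :: int
  define b where "b k x = of_real (c k) * cis (2 * pi * of_int k * (\<alpha> + x))" for k :: int and x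
  define e where "e m x = cis (2 * pi * of_int m * x)" for m :: int and x
  define Ma where "Ma n = exp (pi * s * (\<bar>\<alpha>\<bar> + 1/2)\<^sup>2) * exp (- (pi * s / 2) * of_int n ^ 2)" for n :: int
  have Ma: "Ma summable_on UNIV"
    unfolding Ma_def by (intro summable_on_cmult_right summable_on_int_exp_square) (use s in auto)
  have lea: "norm (a n x) \<le> Ma n" if "x \<in> {-1/2..1/2}" for n x
    unfolding a_def Ma_def using exp_translate_square_le[OF s, of "\<alpha> + x" "\<bar>\<alpha>\<bar> + 1/2" n] that by auto
  have Mc: "c summable_on UNIV"
  proof -
    have "(\<lambda>k::int. exp (- (pi / s) * of_int k ^ 2) * (1 / sqrt s)) summable_on UNIV"
      by (intro summable_on_cmult_left summable_on_int_exp_square) (use s in auto)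
    thus ?thesis unfolding c_def by simp
  qed
  have leb: "norm (b k x) \<le> c k" for k x
  proof -
    have "c k \<ge> 0" using s by (simp add: c_def)
    thus ?thesis by (simp add: b_def norm_mult)
  qed
  have ne: "norm (e m x) = 1" for m x by (simp add: e_def)
  have conte: "continuous_on A (e m)" for A m unfolding e_def by (intro continuous_intros)
  have conta: "continuous_on A (a n)" for A n unfolding a_def by (intro continuous_intros)
  have contb: "continuous_on A (b n)" for A n unfolding b_def by (intro continuous_intros)
  define f where "f x = (\<Sum>\<^sub>\<infinity>n. a n x) - (\<Sum>\<^sub>\<infinity>k. b k x)" for x
  have cA: "continuous_on {-1/2..1/2} (\<lambda>x. \<Sum>\<^sub>\<infinity>n. a n x)"
    by (rule infsum_integral_interval(1)[OF Ma lea conta])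
  have cB: "continuous_on {-1/2..1/2} (\<lambda>x. \<Sum>\<^sub>\<infinity>n. b n x)"
    by (rule infsum_integral_interval(1)[OF Mc leb contb])
  have coefA: "integral {-1/2..1/2} (\<lambda>x. (\<Sum>\<^sub>\<infinity>n. a n x) * e m x) = of_real (c m) * cis (- 2 * pi * of_int m * \<alpha>)" for m
  proof -
    let ?g = "\<lambda>x. a 0 x * e m x"
    \<comment> \<open>The character has period 1, so the \<open>n\<close>-th term is the translate
      by \<open>n\<close> of the term for 0.\<close>
    have tr: "a n x * e m x = ?g (x + of_int n)" for n x
      using cis_2pi_int[of m n] by (simp add: a_def e_def distrib_left cis_mult[symmetric] add_ac)
    have 1: "(\<lambda>N. \<Sum>n\<in>{- int N..int N}. integral {-1/2..1/2} (\<lambda>x. a n x * e m x)) \<longlonglongrightarrow>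
        integral {-1/2..1/2} (\<lambda>x. \<Sum>\<^sub>\<infinity>n. a n x * e m x)"
      by (rule infsum_integral_interval(2)[OF Ma])
         (use lea in \<open>auto simp: norm_mult ne intro!: continuous_intros conte conta\<close>)
    define G where "G x = of_real (exp (- pi * s * x\<^sup>2)) * cis (- 2 * pi * of_int (- m) * x)" for x
    have gG: "?g x = cis (- 2 * pi * of_int m * \<alpha>) * G (\<alpha> + 1 * x)" for x
      by (simp add: a_def e_def G_def distrib_left cis_mult[symmetric])
         (simp add: cis_mult)
    have iG: "integrable lborel G" "integral\<^sup>L lborel G = of_real (c m)"
      using gaussian_fourier_transform[OF s, of "of_int (- m)"] unfolding G_def c_def by simp_all
    have ig: "integrable lborel ?g"
      unfolding gG by (intro integrable_mult_right lborel_integrable_real_affine iG) auto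
    have "integral\<^sup>L lborel ?g = cis (- 2 * pi * of_int m * \<alpha>) * integral\<^sup>L lborel (\<lambda>x. G (\<alpha> + 1 * x))"
      unfolding gG by (rule integral_mult_right_zero)
    also have "integral\<^sup>L lborel (\<lambda>x. G (\<alpha> + 1 * x)) = integral\<^sup>L lborel G"
      using lborel_integral_real_affine[of 1 G \<alpha>] by simp
    finally have Ig: "integral\<^sup>L lborel ?g = cis (- 2 * pi * of_int m * \<alpha>) * of_real (c m)"
      using iG by simp
    have "(\<lambda>N. \<Sum>n\<in>{- int N..int N}. integral {-1/2..1/2} (\<lambda>x. a n x * e m x)) \<longlonglongrightarrow> integral\<^sup>L lborel ?g"
    proof -
      have "(\<Sum>n\<in>{- int N..int N}. integral {-1/2..1/2} (\<lambda>x. a n x * e m x)) =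
          integral {- (real N + 1/2)..real N + 1/2} ?g" for N
      proof -
        have "(\<Sum>n\<in>{- int N..int N}. integral {-1/2..1/2} (\<lambda>x. a n x * e m x)) =
            (\<Sum>n\<in>{- int N..int N}. integral {-1/2..1/2} (\<lambda>x. ?g (x + of_int n)))"
          by (intro sum.cong refl Henstock_Kurzweil_Integration.integral_cong tr)
        also have "\<dots> = integral {- (real N + 1/2)..real N + 1/2} ?g"
          by (rule sum_integral_unit_translates) (intro continuous_on_mult conta conte)
        finally show ?thesis .
      qed
      thus ?thesis using tendsto_integral_symmetric[OF ig] by (simp only:)
    qed
    from LIMSEQ_unique[OF 1 this]
    have "integral {-1/2..1/2} (\<lambda>x. \<Sum>\<^sub>\<infinity>n. a n x * e m x) = of_real (c m) * cis (- 2 * pi * of_int m * \<alpha>)"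
      unfolding Ig by (simp add: mult.commute)
    thus ?thesis by (simp add: infsum_cmult_left')
  qed
  have coefB: "integral {-1/2..1/2} (\<lambda>x. (\<Sum>\<^sub>\<infinity>n. b n x) * e m x) = of_real (c m) * cis (- 2 * pi * of_int m * \<alpha>)" for m
  proof -
    have 1: "(\<lambda>N. \<Sum>n\<in>{- int N..int N}. integral {-1/2..1/2} (\<lambda>x. b n x * e m x)) \<longlonglongrightarrow>
        integral {-1/2..1/2} (\<lambda>x. \<Sum>\<^sub>\<infinity>n. b n x * e m x)"
      by (rule infsum_integral_interval(2)[OF Mc])
         (use leb in \<open>auto simp: norm_mult ne intro!: continuous_intros conte contb\<close>)
    \<comment> \<open>Integrating against frequency \<open>m\<close> picks out the term of frequency
      \<open>- m\<close>, because \<open>e m\<close> is not conjugated.\<close>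
    have "integral {-1/2..1/2} (\<lambda>x. b n x * e m x) = (if n = - m then of_real (c m) * cis (- 2 * pi * of_int m * \<alpha>) else 0)" for n
    proof -
      have "b n x * e m x = (of_real (c n) * cis (2 * pi * of_int n * \<alpha>)) * cis (2 * pi * of_int (n + m) * x)" for x
        by (simp add: b_def e_def distrib_left distrib_right cis_mult[symmetric] mult_ac)
      hence "integral {-1/2..1/2} (\<lambda>x. b n x * e m x) =
        (of_real (c n) * cis (2 * pi * of_int n * \<alpha>)) * integral {-1/2..1/2} (\<lambda>x. cis (2 * pi * of_int (n + m) * x))"
        by simp
      also have "\<dots> = (if n = - m then of_real (c m) * cis (- 2 * pi * of_int m * \<alpha>) else 0)"
        unfolding integral_cis_unit_interval by (auto simp: c_def)
      finally show ?thesis .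
    qed
    hence "(\<Sum>n\<in>{- int N..int N}. integral {-1/2..1/2} (\<lambda>x. b n x * e m x)) =
      (if - m \<in> {- int N..int N} then of_real (c m) * cis (- 2 * pi * of_int m * \<alpha>) else 0)" for N
      by (simp only: sum.delta finite_atLeastAtMost_int)
    moreover have "(\<lambda>N. if - m \<in> {- int N..int N} then of_real (c m) * cis (- 2 * pi * of_int m * \<alpha>) else 0)
        \<longlonglongrightarrow> of_real (c m) * cis (- 2 * pi * of_int m * \<alpha>)"
      by (rule tendsto_eventually, rule eventually_sequentiallyI[of "nat \<bar>m\<bar>"]) auto
    ultimately have "(\<lambda>N. \<Sum>n\<in>{- int N..int N}. integral {-1/2..1/2} (\<lambda>x. b n x * e m x)) \<longlonglongrightarrow>
       of_real (c m) * cis (- 2 * pi * of_int m * \<alpha>)" by simp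
    from LIMSEQ_unique[OF 1 this] show ?thesis by (simp add: infsum_cmult_left')
  qed
  have "f 0 = 0"
  proof (rule fourier_coefficients_zero_imp_zero_at_0)
    show "continuous_on {-1/2..1/2} f" unfolding f_def by (intro continuous_intros cA cB)
    fix m :: int
    have "integral {-1/2..1/2} (\<lambda>x. f x * e m x) = integral {-1/2..1/2} (\<lambda>x. (\<Sum>\<^sub>\<infinity>n. a n x) * e m x) -
      integral {-1/2..1/2} (\<lambda>x. (\<Sum>\<^sub>\<infinity>n. b n x) * e m x)"
      unfolding f_def left_diff_distrib
      by (intro Henstock_Kurzweil_Integration.integral_diff integrable_continuous_real continuous_on_mult cA cB conte)
    also have "\<dots> = 0" unfolding coefA coefB by simp
    finally show "integral {-1/2..1/2} (\<lambda>x. f x * cis (2 * pi * of_int m * x)) = 0" by (simp add: e_def)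
  qed
  thus ?thesis by (simp add: f_def a_def b_def c_def)
qed

section \<open>The eta function on the imaginary axis\<close>

lemma poisson_gaussian_real:
  fixes s \<alpha> :: real
  assumes s: "s > 0"
  shows "(\<Sum>\<^sub>\<infinity>n::int. exp (- pi * s * (\<alpha> + of_int n)\<^sup>2)) =
    (\<Sum>\<^sub>\<infinity>k::int. exp (- pi * of_int k ^ 2 / s) / sqrt s * cos (2 * pi * of_int k * \<alpha>))"
    and "(\<lambda>k::int. exp (- pi * of_int k ^ 2 / s) / sqrt s * cos (2 * pi * of_int k * \<alpha>)) summable_on UNIV"
proof -
  have "(\<lambda>k::int. exp (- (pi / s) * of_int k ^ 2) * (1 / sqrt s)) summable_on UNIV"
    by (intro summable_on_cmult_left summable_on_int_exp_square) (use s in auto)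
  hence "(\<lambda>k::int. norm (complex_of_real (exp (- pi * of_int k ^ 2 / s) / sqrt s) * cis (2 * pi * of_int k * \<alpha>))) summable_on UNIV"
    using s by (simp add: norm_mult norm_divide)
  hence sum: "(\<lambda>k::int. complex_of_real (exp (- pi * of_int k ^ 2 / s) / sqrt s) * cis (2 * pi * of_int k * \<alpha>)) summable_on UNIV"
    by (rule abs_summable_summable)
  have Re_eq: "Re (complex_of_real c * cis w) = c * cos w" for c w by simp
  show "(\<lambda>k::int. exp (- pi * of_int k ^ 2 / s) / sqrt s * cos (2 * pi * of_int k * \<alpha>)) summable_on UNIV"
    using summable_on_Re[OF sum] unfolding Re_eq .
  have "(\<Sum>\<^sub>\<infinity>n::int. exp (- pi * s * (\<alpha> + of_int n)\<^sup>2)) =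
     (\<Sum>\<^sub>\<infinity>n::int. Re (complex_of_real (exp (- pi * s * (\<alpha> + of_int n)\<^sup>2))))" by simp
  also have "\<dots> = Re (\<Sum>\<^sub>\<infinity>n::int. complex_of_real (exp (- pi * s * (\<alpha> + of_int n)\<^sup>2)))"
    by (intro infsum_Re summable_on_of_real summable_gaussian_translates s)
  also have "\<dots> = (\<Sum>\<^sub>\<infinity>k::int. exp (- pi * of_int k ^ 2 / s) / sqrt s * cos (2 * pi * of_int k * \<alpha>))"
    unfolding poisson_gaussian[OF s] infsum_Re[OF sum, symmetric] Re_eq ..
  finally show "(\<Sum>\<^sub>\<infinity>n::int. exp (- pi * s * (\<alpha> + of_int n)\<^sup>2)) =
    (\<Sum>\<^sub>\<infinity>k::int. exp (- pi * of_int k ^ 2 / s) / sqrt s * cos (2 * pi * of_int k * \<alpha>))" .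
qed

lemma infsum_int_even_odd:
  fixes f :: "int \<Rightarrow> real"
  assumes "f summable_on UNIV"
  shows "infsum f UNIV = (\<Sum>\<^sub>\<infinity>m. f (2 * m)) + (\<Sum>\<^sub>\<infinity>m. f (2 * m + 1))"
proof -
  have "(UNIV :: int set) = range (\<lambda>m. 2 * m) \<union> range (\<lambda>m. 2 * m + 1)"
    using oddE by (fastforce elim: evenE)
  hence "infsum f UNIV = infsum f (range (\<lambda>m. 2 * m) \<union> range (\<lambda>m. 2 * m + 1))" by simp
  also have "\<dots> = infsum f (range (\<lambda>m. 2 * m)) + infsum f (range (\<lambda>m. 2 * m + 1))"
    by (intro infsum_Un_disjoint summable_on_subset_banach[OF assms]) (auto, presburger)
  also have "\<dots> = (\<Sum>\<^sub>\<infinity>m. f (2 * m)) + (\<Sum>\<^sub>\<infinity>m. f (2 * m + 1))"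
    by (subst (1 2) infsum_reindex) (auto simp: inj_on_def o_def)
  finally show ?thesis .
qed

text \<open>The value of eta at \<open>i t\<close>, as a real function, so that real logarithms can
  be taken; \<open>pi t / 12\<close> is \<open>2 pi t / 24\<close>.\<close>

definition eta_imag :: "real \<Rightarrow> real" where
  "eta_imag t = exp (- pi * t / 12) * (\<Prod>n. 1 - exp (- 2 * pi * t) ^ Suc n)"

lemma dedekind_eta_imag:
  assumes t: "t > 0"
  shows "dedekind_eta (\<i> * of_real t) = of_real (eta_imag t)"
proof -
  define q where "q = exp (- 2 * pi * t)"
  have q: "0 \<le> q" "q < 1" using t by (auto simp: q_def)
  have n1: "nome (\<i> * of_real t) = of_real q"
    unfolding nome_def q_def exp_of_real[symmetric] by (simp add: mult_ac)
  have n2: "nome (\<i> * of_real t / 24) = of_real (exp (- pi * t / 12))"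
    unfolding nome_def exp_of_real[symmetric] by (simp add: mult_ac)
  have "(\<lambda>n. \<Prod>i\<le>n. 1 - q ^ Suc i) \<longlonglongrightarrow> (\<Prod>n. 1 - q ^ Suc n)"
    by (rule convergent_prod_LIMSEQ[OF convergent_prod_euler]) (use q in simp)
  hence "(\<lambda>n. complex_of_real (\<Prod>i\<le>n. 1 - q ^ Suc i)) \<longlonglongrightarrow> of_real (\<Prod>n. 1 - q ^ Suc n)"
    by (rule tendsto_of_real)
  hence "(\<lambda>n. \<Prod>i\<le>n. 1 - complex_of_real q ^ Suc i) \<longlonglongrightarrow> of_real (\<Prod>n. 1 - q ^ Suc n)"
    by simp
  moreover have "(\<lambda>n. \<Prod>i\<le>n. 1 - complex_of_real q ^ Suc i) \<longlonglongrightarrow> (\<Prod>n. 1 - complex_of_real q ^ Suc n)"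
    by (rule convergent_prod_LIMSEQ, rule convergent_prod_euler) (use q in simp)
  ultimately have "(\<Prod>n. 1 - complex_of_real q ^ Suc n) = of_real (\<Prod>n. 1 - q ^ Suc n)"
    by (rule LIMSEQ_unique[symmetric])
  thus ?thesis unfolding dedekind_eta_def n1 n2 eta_imag_def q_def[symmetric] by (simp only: of_real_mult)
qed

definition alt_sign :: "int \<Rightarrow> real" where "alt_sign n = (if even n then 1 else -1)"

lemma minus_one_power_abs: "(-1) ^ nat \<bar>n\<bar> = (of_real (alt_sign n) :: 'a::real_div_algebra)"
  by (cases "even n") (auto simp: alt_sign_def even_nat_iff uminus_power_if)

lemma eta_imag_has_sum:
  assumes t: "t > 0"
  shows "((\<lambda>n. alt_sign n * exp (- pi * (3 * t) * (1/6 + of_int n)\<^sup>2)) has_sum eta_imag t) UNIV"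
proof -
  have "eta_term (\<i> * of_real t) n = of_real (alt_sign n * exp (- pi * (3 * t) * (1/6 + of_int n)\<^sup>2))" for n
  proof -
    have "- pi * (3 * t) * (1/6 + real_of_int n)\<^sup>2 = - 2 * pi * t * of_int ((6 * n + 1)\<^sup>2) / 24"
      by (simp add: power2_eq_square field_simps)
    moreover have "2 * of_real pi * \<i> * (\<i> * of_real t) * of_int ((6 * n + 1)\<^sup>2) / 24 =
        complex_of_real (- 2 * pi * t * of_int ((6 * n + 1)\<^sup>2) / 24)" by simp
    ultimately show ?thesis
      unfolding eta_term_def minus_one_power_abs by (simp only: exp_of_real of_real_mult[symmetric])
  qed
  hence "eta_term (\<i> * of_real t) = (\<lambda>n. of_real (alt_sign n * exp (- pi * (3 * t) * (1/6 + of_int n)\<^sup>2)))"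
    by (rule ext)
  with dedekind_eta_has_sum[of "\<i> * of_real t"] t show ?thesis
    unfolding dedekind_eta_imag[OF t] by (simp only: has_sum_of_real_iff) simp
qed

lemma cos_pi_plus_int: "cos (pi * of_int n + x) = alt_sign n * cos x"
  by (simp add: cos_add alt_sign_def)

text \<open>Even numbers and odd multiples of 3 are the frequencies that disappear in the eta
  inversion. The class of 5 is written as the negative of the class of 1 because the surviving terms
  are even in the frequency.\<close>

lemma int_mod_6_cases:
  fixes k :: int
  obtains (0) "even k" | (1) n where "k = 6 * n + 1" | (3) n where "k = 6 * n + 3" | (5) n where "k = - (6 * n + 1)"
proof -
  have k: "k = 6 * (k div 6) + k mod 6" by simp
  have "even k \<or> k mod 6 = 1 \<or> k mod 6 = 3 \<or> k mod 6 = 5" by presburger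
  then consider "even k" | "k mod 6 = 1" | "k mod 6 = 3" | "k mod 6 = 5" by blast
  thus ?thesis
  proof cases
    case 4
    hence "k = - (6 * (- (k div 6) - 1) + 1)" by presburger
    thus ?thesis using that(4) by blast
  qed (use that k in metis)+
qed

theorem eta_imag_inversion:
  assumes t: "t > 0"
  shows "eta_imag (1 / t) = sqrt t * eta_imag t"
proof -
  \<comment> \<open>The alternating sum is the difference of two Gaussian sums with shifts \<open>1/12\<close> and \<open>7/12\<close>; on
    the dual side only frequencies \<open>\<plusminus>(6n + 1)\<close> survive.\<close>
  define w where "w = 12 * t"
  have w: "w > 0" using t by (simp add: w_def)
  define F where "F n = alt_sign n * exp (- pi * (3 * t) * (1/6 + of_int n)\<^sup>2)" for n
  have F: "(F has_sum eta_imag t) UNIV" unfolding F_def by (rule eta_imag_has_sum[OF t])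
  define c where "c k = exp (- pi * of_int k ^ 2 / w) / sqrt w" for k :: int
  have c_minus: "c (- k) = c k" for k by (simp add: c_def)
  define G where "G k = c k * (cos (2 * pi * of_int k * (1/12)) - cos (2 * pi * of_int k * (7/12)))" for k :: int
  define p where "p k = c k * cos (2 * pi * of_int k * (1/12))" for k :: int
  define p' where "p' k = c k * cos (2 * pi * of_int k * (7/12))" for k :: int
  have sum_p: "p summable_on UNIV" "p' summable_on UNIV"
    using poisson_gaussian_real(2)[OF w] unfolding p_def p'_def c_def by blast+
  have G_alt: "G = (\<lambda>k. p k + - p' k)"
    by (rule ext) (simp add: G_def p_def p'_def right_diff_distrib)
  have "eta_imag t = infsum F UNIV" using F by (simp add: infsumI)
  also have "\<dots> = (\<Sum>\<^sub>\<infinity>m. F (2 * m)) + (\<Sum>\<^sub>\<infinity>m. F (2 * m + 1))"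
    by (rule infsum_int_even_odd) (use F in \<open>auto simp: summable_on_def\<close>)
  \<comment> \<open>Substituting \<open>n = 2m\<close> turns \<open>3 t (1/6 + n)^2\<close> into
    \<open>12 t (1/12 + m)^2\<close>, which explains \<open>w\<close>; \<open>n = 2m + 1\<close>
    adds 1/2 to the shift.\<close>
  also have "(\<lambda>m. F (2 * m)) = (\<lambda>m. exp (- pi * w * (1/12 + of_int m)\<^sup>2))"
    by (rule ext) (simp add: F_def alt_sign_def w_def power2_eq_square field_simps)
  also have "(\<lambda>m. F (2 * m + 1)) = (\<lambda>m. - exp (- pi * w * (7/12 + of_int m)\<^sup>2))"
    by (rule ext) (simp add: F_def alt_sign_def w_def power2_eq_square field_simps)
  also have "(\<Sum>\<^sub>\<infinity>m::int. exp (- pi * w * (1/12 + of_int m)\<^sup>2)) + (\<Sum>\<^sub>\<infinity>m::int. - exp (- pi * w * (7/12 + of_int m)\<^sup>2)) =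
     (\<Sum>\<^sub>\<infinity>m::int. exp (- pi * w * (1/12 + of_int m)\<^sup>2)) - (\<Sum>\<^sub>\<infinity>m::int. exp (- pi * w * (7/12 + of_int m)\<^sup>2))"
    by (simp add: infsum_uminus)
  also have "\<dots> = infsum p UNIV - infsum p' UNIV"
    unfolding poisson_gaussian_real(1)[OF w] p_def p'_def c_def ..
  also have "\<dots> = infsum G UNIV"
    unfolding G_alt using sum_p by (subst infsum_add) (simp_all add: infsum_uminus summable_on_uminus)
  finally have etaG: "eta_imag t = infsum G UNIV" .
  have sumG: "G summable_on UNIV"
    unfolding G_alt using sum_p by (intro summable_on_add) (simp_all add: summable_on_uminus)
  have G_minus: "G (- k) = G k" for k by (simp add: G_def c_minus)
  have G_eq: "G k = c k * (1 - alt_sign k) * cos (pi * of_int k / 6)" for k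
  proof -
    have "2 * pi * of_int k * (7/12) = pi * of_int k + pi * of_int k / 6" by simp
    hence "cos (2 * pi * of_int k * (7/12)) = alt_sign k * cos (pi * of_int k / 6)" by (simp only: cos_pi_plus_int)
    moreover have "2 * pi * of_int k * (1/12) = pi * of_int k / 6" by simp
    ultimately show ?thesis unfolding G_def by (simp add: algebra_simps)
  qed
  \<comment> \<open>The two shifts differ by half a period, so even frequencies cancel and odd ones
    double; at odd multiples of 3 the cosine itself is 0.\<close>
  have G_even: "G k = 0" if "even k" for k using that by (simp add: G_eq alt_sign_def)
  have G_3: "G (6 * n + 3) = 0" for n
  proof -
    have "pi * of_int (6 * n + 3) / 6 = pi * of_int n + pi / 2" by (simp add: field_simps)
    thus ?thesis unfolding G_eq by (simp only: cos_pi_plus_int cos_pi_half)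
  qed
  have G_1: "G (6 * n + 1) = alt_sign n * exp (- pi * (3 * (1 / t)) * (1/6 + of_int n)\<^sup>2) * (sqrt 3 / sqrt w)" for n
  proof -
    have "pi * of_int (6 * n + 1) / 6 = pi * of_int n + pi / 6" by (simp add: field_simps)
    hence "G (6 * n + 1) = c (6 * n + 1) * (1 - alt_sign (6 * n + 1)) * (alt_sign n * (sqrt 3 / 2))"
      unfolding G_eq by (simp only: cos_pi_plus_int cos_30)
    moreover have "alt_sign (6 * n + 1) = -1" by (simp add: alt_sign_def)
    moreover have "- pi * of_int (6 * n + 1) ^ 2 / w = - pi * (3 * (1 / t)) * (1/6 + of_int n)\<^sup>2"
      unfolding w_def using t by (simp add: power2_eq_square field_simps)
    hence "c (6 * n + 1) = exp (- pi * (3 * (1 / t)) * (1/6 + of_int n)\<^sup>2) / sqrt w" unfolding c_def by (simp only:)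
    ultimately show ?thesis by simp
  qed
  define A where "A = range (\<lambda>n::int. 6 * n + 1)"
  define B where "B = range (\<lambda>n::int. - (6 * n + 1))"
  have "infsum G UNIV = infsum G (A \<union> B)"
  proof (rule infsum_cong_neutral)
    fix k assume "k \<in> UNIV - (A \<union> B)"
    thus "G k = 0" by (cases k rule: int_mod_6_cases) (auto simp: A_def B_def G_even G_3)
  qed auto
  also have "\<dots> = infsum G A + infsum G B"
    by (intro infsum_Un_disjoint summable_on_subset_banach[OF sumG]) (auto simp: A_def B_def, presburger)
  also have "infsum G A = (\<Sum>\<^sub>\<infinity>n. G (6 * n + 1))"
    unfolding A_def by (subst infsum_reindex) (auto simp: inj_on_def o_def)
  also have "infsum G B = (\<Sum>\<^sub>\<infinity>n. G (- (6 * n + 1)))"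
    unfolding B_def by (subst infsum_reindex) (auto simp: inj_on_def o_def)
  also have "\<dots> = (\<Sum>\<^sub>\<infinity>n. G (6 * n + 1))" by (simp only: G_minus)
  also have "(\<Sum>\<^sub>\<infinity>n. G (6 * n + 1)) = eta_imag (1 / t) * (sqrt 3 / sqrt w)"
    unfolding G_1 infsum_cmult_left' using eta_imag_has_sum[of "1 / t"] t by (simp add: infsumI)
  \<comment> \<open>The surviving term carries \<open>2 cos (pi/6) = sqrt 3\<close>, and the two
    classes give another factor 2. Together these cancel against \<open>sqrt 12\<close> in
    \<open>sqrt w\<close> and leave \<open>1 / sqrt t\<close>.\<close>
  also have "sqrt w = 2 * (sqrt 3 * sqrt t)"
    unfolding w_def by (simp add: real_sqrt_mult real_sqrt_mult[of 4 3, simplified])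
  finally show ?thesis unfolding etaG using t by (simp add: field_simps)
qed

section \<open>Logarithmic asymptotics of eta(it) and linear independence\<close>

definition euler_phi :: "real \<Rightarrow> real" where
  "euler_phi q = (\<Prod>n. 1 - q ^ Suc n)"

lemma euler_phi_pos:
  assumes "0 \<le> q" "q < 1"
  shows "euler_phi q > 0"
proof -
  have q: "q ^ Suc n < 1" for n using power_decreasing[of 1 "Suc n" q] assms by simp
  have c: "convergent_prod (\<lambda>n. 1 - q ^ Suc n)" by (rule convergent_prod_euler) (use assms in simp)
  have "euler_phi q \<noteq> 0" unfolding euler_phi_def
    by (rule prodinf_nonzero[OF c]) (use q in \<open>metis diff_gt_0_iff_gt less_irrefl\<close>)
  moreover have "0 \<le> (\<Prod>i\<le>n. 1 - q ^ Suc i)" for n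
    by (intro prod_nonneg) (use q in \<open>simp add: less_imp_le\<close>)
  hence "euler_phi q \<ge> 0" unfolding euler_phi_def
    by (intro LIMSEQ_le_const[OF convergent_prod_LIMSEQ[OF c]]) blast
  ultimately show ?thesis by linarith
qed

text \<open>The lower bound is the Weierstrass product inequality combined with the geometric
  series. Both bounds equal \<open>1 - q\<close> up to \<open>O(q^2)\<close>, so they determine the
  logarithm to first order.\<close>

lemma euler_phi_bounds:
  assumes "0 \<le> q" "q < 1"
  shows "euler_phi q \<le> 1 - q" "euler_phi q \<ge> 1 - q / (1 - q)"
proof -
  define P where "P n = (\<Prod>i\<le>n. 1 - q ^ Suc i)" for n
  have lim: "P \<longlonglongrightarrow> euler_phi q"
    unfolding P_def[abs_def] euler_phi_def by (rule convergent_prod_LIMSEQ[OF convergent_prod_euler]) (use assms in simp)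
  have q: "0 \<le> q ^ Suc n" "q ^ Suc n \<le> 1" for n using assms by (auto intro!: mult_le_one power_le_one)
  have P: "0 \<le> P n \<and> P n \<le> 1 - q \<and> P n \<ge> 1 - (\<Sum>i\<le>n. q ^ Suc i)" for n
  proof (induction n)
    case 0
    show ?case using assms by (simp add: P_def)
  next
    case (Suc n)
    define y where "y = q ^ Suc (Suc n)"
    have y: "0 \<le> y" "y \<le> 1" using q[of "Suc n"] by (simp_all add: y_def)
    have e: "P (Suc n) = P n - P n * y" by (simp add: P_def y_def algebra_simps)
    have "P n \<le> 1" using Suc assms by linarith
    hence "P n * y \<le> 1 * y" using y by (intro mult_right_mono)
    moreover have "P n * y \<le> P n * 1" using y Suc by (intro mult_left_mono) simp_all
    moreover have "0 \<le> P n * y" using y Suc by (intro mult_nonneg_nonneg) simp_all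
    ultimately have "0 \<le> P (Suc n) \<and> P (Suc n) \<le> 1 - q \<and> P (Suc n) \<ge> 1 - (\<Sum>i\<le>n. q ^ Suc i) - y"
      using Suc unfolding e by linarith
    thus ?case by (simp add: y_def)
  qed
  show "euler_phi q \<le> 1 - q" by (rule LIMSEQ_le_const2[OF lim]) (use P in blast)
  have "(\<Sum>i\<le>n. q ^ Suc i) \<le> q / (1 - q)" for n
  proof -
    have "(\<Sum>i\<le>n. q ^ i) \<le> (\<Sum>i. q ^ i)"
      by (rule sum_le_suminf) (use assms in \<open>auto intro: summable_geometric\<close>)
    hence "q * (\<Sum>i\<le>n. q ^ i) \<le> q * (1 / (1 - q))"
      using assms by (intro mult_left_mono) (auto simp: suminf_geometric)
    thus ?thesis by (simp add: sum_distrib_left)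
  qed
  hence "1 - q / (1 - q) \<le> P n" for n using P[of n] by (smt (verit))
  thus "euler_phi q \<ge> 1 - q / (1 - q)" by (intro LIMSEQ_le_const[OF lim]) blast
qed

lemma eta_imag_eq: "eta_imag t = exp (- pi * t / 12) * euler_phi (exp (- 2 * pi * t))"
  by (simp add: eta_imag_def euler_phi_def)

lemma eta_imag_pos: "t > 0 \<Longrightarrow> eta_imag t > 0"
  unfolding eta_imag_eq by (intro mult_pos_pos euler_phi_pos) auto

lemma ln_eta_imag: "t > 0 \<Longrightarrow> ln (eta_imag t) = - pi * t / 12 + ln (euler_phi (exp (- 2 * pi * t)))"
  unfolding eta_imag_eq using euler_phi_pos[of "exp (- 2 * pi * t)"] by (subst ln_mult) auto

lemma ln_euler_phi_asymp:
  "((\<lambda>t. ln (euler_phi (exp (- 2 * pi * t))) * exp (2 * pi * t)) \<longlongrightarrow> -1) at_top"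
proof (rule tendsto_sandwich)
  have bounds: "- 1 / (1 - 2 * exp (- 2 * pi * t)) \<le> ln (euler_phi (exp (- 2 * pi * t))) * exp (2 * pi * t) \<and>
      ln (euler_phi (exp (- 2 * pi * t))) * exp (2 * pi * t) \<le> - 1" if t: "t \<ge> 1" for t
  proof -
    define q where "q = exp (- 2 * pi * t)"
    have "2 * pi * t \<ge> 2 * pi * 1" using t by (intro mult_left_mono) auto
    hence "2 * pi * t > 6" using pi_gt3 by linarith
    moreover have "exp (2 * pi * t) \<ge> 1 + 2 * pi * t" by (rule exp_ge_add_one_self)
    ultimately have "exp (2 * pi * t) > 2" by linarith
    hence q: "0 < q" "q < 1/2" by (auto simp: q_def exp_minus field_simps)
    have e: "exp (2 * pi * t) = 1 / q" by (simp add: q_def exp_minus field_simps)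
    have pos: "euler_phi q > 0" using q by (intro euler_phi_pos) auto
    have "ln (euler_phi q) \<le> euler_phi q - 1" using pos by (rule ln_le_minus_one)
    also have "\<dots> \<le> - q" using euler_phi_bounds(1)[of q] q by linarith
    finally have up: "ln (euler_phi q) \<le> - q" .
    have pos2: "1 - q / (1 - q) > 0" using q by (simp add: field_simps)
    \<comment> \<open>Applying \<open>ln x <= x - 1\<close> to a reciprocal gives a lower bound for
      the logarithm; \<open>t >= 1\<close> ensures \<open>q < 1/2\<close>, so that the reciprocal is
      positive.\<close>
    have "ln (inverse (1 - q / (1 - q))) \<le> inverse (1 - q / (1 - q)) - 1"
      using pos2 by (intro ln_le_minus_one) (simp only: positive_imp_inverse_positive)
    also have "inverse (1 - q / (1 - q)) - 1 = q / (1 - 2 * q)" using q by (simp add: field_simps)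
    finally have "- (q / (1 - 2 * q)) \<le> ln (1 - q / (1 - q))" using pos2 by (simp only: ln_inverse)
    also have "\<dots> \<le> ln (euler_phi q)" using pos2 euler_phi_bounds(2)[of q] q pos by simp
    finally have low: "- (q / (1 - 2 * q)) \<le> ln (euler_phi q)" .
    have "- (q / (1 - 2 * q)) * (1 / q) \<le> ln (euler_phi q) * (1 / q)"
      using q low by (intro mult_right_mono) auto
    moreover have "ln (euler_phi q) * (1 / q) \<le> - q * (1 / q)"
      using q up by (intro mult_right_mono) auto
    ultimately show ?thesis unfolding e q_def[symmetric] using q by simp
  qed
  show "\<forall>\<^sub>F t in at_top. - 1 / (1 - 2 * exp (- 2 * pi * t)) \<le> ln (euler_phi (exp (- 2 * pi * t))) * exp (2 * pi * t)"
    using bounds by (intro eventually_at_top_linorderI[of 1]) blast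
  show "\<forall>\<^sub>F t in at_top. ln (euler_phi (exp (- 2 * pi * t))) * exp (2 * pi * t) \<le> - 1"
    using bounds by (intro eventually_at_top_linorderI[of 1]) blast
  show "((\<lambda>t. - 1 / (1 - 2 * exp (- 2 * pi * t))) \<longlongrightarrow> - 1) at_top" by real_asymp
qed simp_all

text \<open>The weight \<open>exp (2 pi m t)\<close> is the right scale for the argument
  \<open>m\<close> and too weak for every larger one; this isolates the smallest argument in a
  linear relation.\<close>

lemma ln_euler_phi_scaled:
  assumes "x > 0" "m > 0" "m \<le> x"
  shows "((\<lambda>t. ln (euler_phi (exp (- 2 * pi * (x * t)))) * exp (2 * pi * (m * t))) \<longlongrightarrow> (if x = m then -1 else 0)) at_top"
proof -
  have f: "filterlim (\<lambda>t. x * t) at_top at_top" using assms(1) by real_asymp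
  have 1: "((\<lambda>t. ln (euler_phi (exp (- 2 * pi * (x * t)))) * exp (2 * pi * (x * t))) \<longlongrightarrow> -1) at_top"
    using filterlim_compose[OF ln_euler_phi_asymp f] .
  have 2: "((\<lambda>t. exp (- 2 * pi * ((x - m) * t))) \<longlongrightarrow> (if x = m then 1 else 0)) at_top"
  proof (cases "x = m")
    case False
    hence "x - m > 0" using assms by simp
    hence "((\<lambda>t. exp (- 2 * pi * ((x - m) * t))) \<longlongrightarrow> 0) at_top" by real_asymp
    thus ?thesis using False by simp
  qed simp
  have "(\<lambda>t. ln (euler_phi (exp (- 2 * pi * (x * t)))) * exp (2 * pi * (x * t)) * exp (- 2 * pi * ((x - m) * t))) =
      (\<lambda>t. ln (euler_phi (exp (- 2 * pi * (x * t)))) * exp (2 * pi * (m * t)))"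
    by (rule ext) (simp add: mult.assoc mult_exp_exp, simp add: algebra_simps)
  with tendsto_mult[OF 1 2] show ?thesis by (cases "x = m") simp_all
qed

lemma ln_euler_phi_tendsto_0:
  assumes "x > 0"
  shows "((\<lambda>t. ln (euler_phi (exp (- 2 * pi * (x * t))))) \<longlongrightarrow> 0) at_top"
proof -
  have 1: "((\<lambda>t. ln (euler_phi (exp (- 2 * pi * (x * t)))) * exp (2 * pi * (x * t))) \<longlongrightarrow> -1) at_top"
    using ln_euler_phi_scaled[of x x] assms by simp
  have 2: "((\<lambda>t. exp (- 2 * pi * (x * t))) \<longlongrightarrow> 0) at_top" using assms by real_asymp
  have "(\<lambda>t. ln (euler_phi (exp (- 2 * pi * (x * t)))) * exp (2 * pi * (x * t)) * exp (- 2 * pi * (x * t))) =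
      (\<lambda>t. ln (euler_phi (exp (- 2 * pi * (x * t)))))"
    by (rule ext) (simp add: mult.assoc mult_exp_exp)
  with tendsto_mult[OF 1 2] show ?thesis by simp
qed

text \<open>The scales \<open>t\<close>, \<open>ln t\<close> and 1 are separated by dividing by
  \<open>t\<close>, then by \<open>ln t\<close>.\<close>

lemma log_affine_tendsto_0:
  fixes A B w :: real
  assumes "((\<lambda>t. A + w * ln t + B * t) \<longlongrightarrow> 0) at_top"
  shows "A = 0" "B = 0" "w = 0"
proof -
  have "((\<lambda>t. (A + w * ln t + B * t) * (1 / t)) \<longlongrightarrow> 0 * 0) at_top"
    by (intro tendsto_mult assms) real_asymp
  moreover have "((\<lambda>t. (A + w * ln t + B * t) * (1 / t)) \<longlongrightarrow> B) at_top" by real_asymp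
  ultimately show B: "B = 0" using tendsto_unique[OF trivial_limit_at_top_linorder] by fastforce
  have a2: "((\<lambda>t. A + w * ln t) \<longlongrightarrow> 0) at_top" using assms B by simp
  have "((\<lambda>t. (A + w * ln t) * (1 / ln t)) \<longlongrightarrow> 0 * 0) at_top"
    by (intro tendsto_mult a2) real_asymp
  moreover have "((\<lambda>t. (A + w * ln t) * (1 / ln t)) \<longlongrightarrow> w) at_top" by real_asymp
  ultimately show w: "w = 0" using tendsto_unique[OF trivial_limit_at_top_linorder] by fastforce
  have "((\<lambda>t::real. A) \<longlongrightarrow> 0) at_top" using a2 w by simp
  thus "A = 0" by (simp add: tendsto_const_iff)
qed

text \<open>Each logarithm is a linear function of \<open>t\<close> plus an exponentially small
  remainder. The non-decaying parts therefore cancel on their own, which gives \<open>A = 0\<close>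
  and \<open>w = 0\<close>. In the relation left between the remainders, the smallest argument with
  nonzero coefficient dominates, so there is none.\<close>

theorem ln_eta_imag_independent:
  fixes c :: "real \<Rightarrow> real"
  assumes fin: "finite S" and pos: "\<And>x. x \<in> S \<Longrightarrow> x > 0"
    and eq: "\<And>t. t > 0 \<Longrightarrow> (\<Sum>x\<in>S. c x * ln (eta_imag (x * t))) = A + w * ln t"
  shows "A = 0" "w = 0" "\<And>x. x \<in> S \<Longrightarrow> c x = 0"
proof -
  define R where "R x t = ln (euler_phi (exp (- 2 * pi * (x * t))))" for x t
  define B where "B = (\<Sum>x\<in>S. c x * (pi * x / 12))"
  have R_sum: "(\<Sum>x\<in>S. c x * R x t) = A + w * ln t + B * t" if t: "t > 0" for t
  proof -
    have "A + w * ln t = (\<Sum>x\<in>S. c x * ln (eta_imag (x * t)))" using eq[OF t] by simp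
    also have "\<dots> = (\<Sum>x\<in>S. c x * R x t - c x * (pi * x / 12) * t)"
    proof (rule sum.cong)
      fix x assume "x \<in> S"
      hence "x * t > 0" using pos t by simp
      thus "c x * ln (eta_imag (x * t)) = c x * R x t - c x * (pi * x / 12) * t"
        by (simp add: ln_eta_imag R_def algebra_simps)
    qed simp
    also have "\<dots> = (\<Sum>x\<in>S. c x * R x t) - B * t"
      by (simp add: sum_subtractf B_def sum_distrib_right)
    finally show ?thesis by simp
  qed
  have "((\<lambda>t. \<Sum>x\<in>S. c x * R x t) \<longlongrightarrow> (\<Sum>x\<in>S. c x * 0)) at_top"
    unfolding R_def by (intro tendsto_sum tendsto_mult tendsto_const ln_euler_phi_tendsto_0 pos)
  hence z: "((\<lambda>t. A + w * ln t + B * t) \<longlongrightarrow> 0) at_top"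
    by (subst (asm) tendsto_cong[where g = "\<lambda>t. A + w * ln t + B * t"])
       (use R_sum in \<open>auto intro!: eventually_at_top_linorderI[of 1]\<close>)
  show A: "A = 0" by (rule log_affine_tendsto_0(1)[OF z])
  show w: "w = 0" by (rule log_affine_tendsto_0(3)[OF z])
  have B: "B = 0" by (rule log_affine_tendsto_0(2)[OF z])
  have "\<forall>x\<in>S. c x = 0"
  proof (rule ccontr)
    assume neg: "\<not> (\<forall>x\<in>S. c x = 0)"
    define S' where "S' = {x \<in> S. c x \<noteq> 0}"
    have S': "finite S'" "S' \<noteq> {}" using fin neg by (auto simp: S'_def)
    define m where "m = Min S'"
    have m: "m \<in> S'" "\<And>x. x \<in> S' \<Longrightarrow> m \<le> x" using S' by (auto simp: m_def)
    have mpos: "m > 0" using m pos by (auto simp: S'_def)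
    have zero: "(\<Sum>x\<in>S'. c x * (R x t * exp (2 * pi * (m * t)))) = 0" if t: "t > 0" for t
    proof -
      have "(\<Sum>x\<in>S'. c x * R x t) = (\<Sum>x\<in>S. c x * R x t)"
        by (rule sum.mono_neutral_left) (auto simp: S'_def fin)
      also have "\<dots> = 0" using R_sum[OF t] A w B by simp
      finally show ?thesis by (simp add: mult.assoc[symmetric] sum_distrib_right[symmetric])
    qed
    have "((\<lambda>t. \<Sum>x\<in>S'. c x * (R x t * exp (2 * pi * (m * t)))) \<longlongrightarrow> (\<Sum>x\<in>S'. c x * (if x = m then -1 else 0))) at_top"
      unfolding R_def
      by (intro tendsto_sum tendsto_mult tendsto_const ln_euler_phi_scaled mpos m)
         (use pos in \<open>auto simp: S'_def\<close>)
    also have "(\<Sum>x\<in>S'. c x * (if x = m then -1 else 0)) = (\<Sum>x\<in>S'. if x = m then - c m else 0)"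
      by (intro sum.cong) auto
    also have "\<dots> = - c m" using S' m by simp
    finally have "((\<lambda>t::real. 0::real) \<longlongrightarrow> - c m) at_top"
      by (subst (asm) tendsto_cong[where g = "\<lambda>t. 0"])
         (use zero in \<open>auto intro!: eventually_at_top_linorderI[of 1]\<close>)
    hence "c m = 0" by (simp add: tendsto_const_iff)
    thus False using m by (simp add: S'_def)
  qed
  thus "\<And>x. x \<in> S \<Longrightarrow> c x = 0" by blast
qed

section \<open>Theta series of reduced forms\<close>

lemma summable_on_product_nonneg:
  fixes f :: "'a \<Rightarrow> real" and g :: "'b \<Rightarrow> real"
  assumes "f summable_on A" "g summable_on B" "\<And>x. f x \<ge> 0" "\<And>y. g y \<ge> 0"
  shows "(\<lambda>(x, y). f x * g y) summable_on A \<times> B"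
proof (rule summable_on_SigmaI[where g = "\<lambda>x. f x * infsum g B"])
  show "((\<lambda>y. case (x, y) of (x, y) \<Rightarrow> f x * g y) has_sum f x * infsum g B) B" for x
    using has_sum_cmult_right[OF has_sum_infsum[OF assms(2)], of "f x"] by simp
  show "(\<lambda>x. f x * infsum g B) summable_on A"
    by (rule summable_on_cmult_left[OF assms(1)])
  show "(case (x, y) of (x, y) \<Rightarrow> f x * g y) \<ge> 0" for x y using assms(3,4) by simp
qed

lemma summable_gaussian_2d:
  fixes c :: real
  assumes "c > 0"
  shows "(\<lambda>(x::int, y::int). exp (- c * (of_int x ^ 2 + of_int y ^ 2))) summable_on UNIV"
proof -
  have "(\<lambda>(x::int, y::int). exp (- c * of_int x ^ 2) * exp (- c * of_int y ^ 2)) summable_on UNIV \<times> UNIV"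
    by (intro summable_on_product_nonneg summable_on_int_exp_square assms) auto
  moreover have "exp (- c * of_int x ^ 2) * exp (- c * of_int y ^ 2) = exp (- c * (of_int x ^ 2 + of_int y ^ 2))"
    for x y :: int by (simp add: mult_exp_exp algebra_simps)
  ultimately show ?thesis by simp
qed

text \<open>As \<open>|b| <= a\<close>, the cross term is absorbed by
  \<open>2 |x y| <= x^2 + y^2\<close>. This gives the Gaussian majorant for theta series, positive
  definiteness, and bounds on the values a reduced form can take.\<close>

lemma bqf_reduced_lower_bound:
  assumes "bqf_reduced Q"
  shows "coeff_a Q * (x\<^sup>2 + y\<^sup>2) \<le> 2 * bqf_eval Q x y"
proof -
  define a b c where "a = coeff_a Q" "b = coeff_b Q" "c = coeff_c Q"
  have h: "\<bar>b\<bar> \<le> a" "a \<le> c" using assms by (auto simp: bqf_reduced_def a_b_c_def)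
  have "a * y\<^sup>2 \<le> c * y\<^sup>2" using h by (intro mult_right_mono) auto
  moreover have "- (b * x * y) \<le> a * (\<bar>x\<bar> * \<bar>y\<bar>)"
  proof -
    have "- (b * x * y) \<le> \<bar>b * x * y\<bar>" by linarith
    also have "\<dots> = \<bar>b\<bar> * (\<bar>x\<bar> * \<bar>y\<bar>)" by (simp add: abs_mult)
    also have "\<dots> \<le> a * (\<bar>x\<bar> * \<bar>y\<bar>)" using h by (intro mult_right_mono) auto
    finally show ?thesis .
  qed
  moreover have "0 \<le> a * (\<bar>x\<bar> - \<bar>y\<bar>)\<^sup>2" using h by (intro mult_nonneg_nonneg) auto
  moreover have "a * (\<bar>x\<bar> - \<bar>y\<bar>)\<^sup>2 = a * x\<^sup>2 + a * y\<^sup>2 - 2 * (a * (\<bar>x\<bar> * \<bar>y\<bar>))"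
    by (simp add: power2_eq_square algebra_simps)
  ultimately show ?thesis unfolding bqf_eval_def a_b_c_def[symmetric] by (simp add: algebra_simps)
qed

lemma nome_powi: "nome z powi n = exp (2 * of_real pi * \<i> * z * of_int n)"
  unfolding nome_def exp_power_int by (simp add: mult_ac)

lemma norm_nome_powi: "norm (nome z powi n) = exp (- 2 * pi * Im z * of_int n)"
  unfolding nome_powi norm_exp_eq_Re by simp

lemma nome_imag: "nome (\<i> * of_real u) = of_real (exp (- 2 * pi * u))"
  unfolding nome_def exp_of_real[symmetric] by (simp add: mult_ac)

lemma nome_imag_powi: "nome (\<i> * of_real u) powi n = of_real (exp (- 2 * pi * u * of_int n))"
  unfolding nome_imag of_real_power_int[symmetric] exp_power_int by (simp only: mult.commute)

lemma theta_norm_summable: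
  assumes Q: "bqf_reduced Q" "coeff_a Q > 0" and z: "Im z > 0"
  shows "(\<lambda>p. norm (case p of (x, y) \<Rightarrow> nome z powi bqf_eval Q x y)) summable_on UNIV"
proof (rule summable_on_comparison_test)
  show "(\<lambda>(x::int, y::int). exp (- (pi * Im z) * (of_int x ^ 2 + of_int y ^ 2))) summable_on UNIV"
    by (rule summable_gaussian_2d) (use z in simp)
  fix p :: "int \<times> int"
  obtain x y where p: "p = (x, y)" by (cases p)
  have "1 * (x\<^sup>2 + y\<^sup>2) \<le> coeff_a Q * (x\<^sup>2 + y\<^sup>2)" using Q by (intro mult_right_mono) auto
  also have "\<dots> \<le> 2 * bqf_eval Q x y" by (rule bqf_reduced_lower_bound[OF Q(1)])
  finally have "x\<^sup>2 + y\<^sup>2 \<le> 2 * bqf_eval Q x y" by simp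
  hence "real_of_int (x\<^sup>2 + y\<^sup>2) \<le> real_of_int (2 * bqf_eval Q x y)" by (rule of_int_le_iff[THEN iffD2])
  hence "(pi * Im z) * (of_int x ^ 2 + of_int y ^ 2) \<le> (pi * Im z) * (2 * of_int (bqf_eval Q x y))"
    using z by (intro mult_left_mono) auto
  thus "norm (case p of (x, y) \<Rightarrow> nome z powi bqf_eval Q x y) \<le>
      (case p of (x, y) \<Rightarrow> exp (- (pi * Im z) * (of_int x ^ 2 + of_int y ^ 2)))"
    unfolding p by (simp add: norm_nome_powi)
qed simp_all

lemma theta_summable:
  assumes "bqf_reduced Q" "coeff_a Q > 0" "Im z > 0"
  shows "(\<lambda>(x, y). nome z powi bqf_eval Q x y) summable_on UNIV"
  by (rule abs_summable_summable[OF theta_norm_summable[OF assms]])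

text \<open>Two-dimensional Poisson summation leads to the form \<open>(c, -b, a)\<close>, which is
  \<open>Q\<close> after the substitution \<open>(x, y) -> (-y, x)\<close>; hence the same theta
  series reappears. Transforming one variable at a time arrives at \<open>Q\<close>
  directly.\<close>

theorem theta_series_inversion:
  assumes Q: "bqf_reduced Q" "coeff_a Q > 0" "bqf_disc Q = - D" and D: "D > 0" and t: "t > 0"
  shows "theta_series Q (\<i> * of_real t) =
    theta_series Q (\<i> * of_real (1 / (of_int D * t))) / of_real (t * sqrt (of_int D))"
proof -
  define a b c where "a = real_of_int (coeff_a Q)" "b = real_of_int (coeff_b Q)" "c = real_of_int (coeff_c Q)"
  define d where "d = real_of_int D"
  have a: "a > 0" and d: "d > 0" using Q D by (auto simp: a_b_c_def d_def)
  have "real_of_int ((coeff_b Q)\<^sup>2 - 4 * coeff_a Q * coeff_c Q) = real_of_int (- D)"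
    using Q(3) by (simp only: bqf_disc_def)
  hence disc: "b\<^sup>2 - 4 * a * c = - d" by (simp add: a_b_c_def d_def)
  define q where "q x y = a * x\<^sup>2 + b * x * y + c * y\<^sup>2" for x y
  have q: "real_of_int (bqf_eval Q x y) = q (of_int x) (of_int y)" for x y
    by (simp add: bqf_eval_def q_def a_b_c_def)
  have qsq: "q x y = a * (b * y / (2 * a) + x)\<^sup>2 + d / (4 * a) * y\<^sup>2" for x y
  proof -
    have c: "c = (b\<^sup>2 + d) / (4 * a)" using disc a by (simp add: field_simps)
    show ?thesis unfolding q_def c using a by (simp add: field_simps power2_eq_square)
  qed
  have nq: "nome (\<i> * of_real u) powi bqf_eval Q x y = of_real (exp (- 2 * pi * u * q (of_int x) (of_int y)))" for u x y
    by (simp only: nome_imag_powi q)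
  \<comment> \<open>Poisson summation over \<open>x\<close> after completing the square, then backwards over \<open>y\<close> for each
    frequency \<open>k\<close>; the exponents recombine to \<open>Q(n, k)\<close>.\<close>
  define s where "s = 2 * a / (t * d)"
  define u where "u = 1 / (d * t)"
  have s: "s > 0" and u: "u > 0" using a d t by (auto simp: s_def u_def)
  \<comment> \<open>The mixed expression halfway through. By the choice of \<open>s\<close>, the
    Gaussian in \<open>y\<close> left over from completing the square reads
    \<open>exp (- pi y^2 / s)\<close>; so, up to constants, \<open>h k y\<close> is a term on the
    dual side of Poisson summation with parameter \<open>s\<close> and shift
    \<open>k b / (2 a)\<close>.\<close>
  define h where "h k y = complex_of_real (exp (- pi * k\<^sup>2 / (2 * t * a))) * of_real (exp (- pi * y\<^sup>2 / s)) *
      cis (2 * pi * y * (k * b / (2 * a)))" for k y :: real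
  define g where "g v n k = complex_of_real (exp (- 2 * pi * v * q n k))" for v n k
  have sum_h: "(\<lambda>(y::int, k::int). h (of_int k) (of_int y)) summable_on UNIV \<times> UNIV"
  proof -
    have "(\<lambda>(y::int, k::int). exp (- (pi / s) * of_int y ^ 2) * exp (- (pi / (2 * t * a)) * of_int k ^ 2)) summable_on UNIV \<times> UNIV"
      by (intro summable_on_product_nonneg summable_on_int_exp_square) (use s a t in auto)
    hence "(\<lambda>p::int \<times> int. norm (case p of (y, k) \<Rightarrow> h (of_int k) (of_int y))) summable_on UNIV \<times> UNIV"
      by (rule summable_on_cong[THEN iffD1, rotated]) (auto simp: h_def norm_mult mult_ac)
    thus ?thesis by (rule abs_summable_summable)
  qed
  have sum_g: "(\<lambda>(x::int, y::int). g v (of_int x) (of_int y)) summable_on UNIV \<times> UNIV" if "v > 0" for v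
    using theta_summable[OF Q(1,2), of "\<i> * of_real v"] that unfolding nq g_def by simp
  have sum_g': "(\<lambda>(y::int, x::int). g v (of_int x) (of_int y)) summable_on UNIV \<times> UNIV" if "v > 0" for v
    using sum_g[OF that] by (subst (asm) summable_on_swap) (simp add: case_prod_unfold)
  have theta: "theta_series Q (\<i> * of_real v) = (\<Sum>\<^sub>\<infinity>y::int. \<Sum>\<^sub>\<infinity>x::int. g v (of_int x) (of_int y))" if "v > 0" for v
  proof -
    have "theta_series Q (\<i> * of_real v) = infsum (\<lambda>(x::int, y::int). g v (of_int x) (of_int y)) (UNIV \<times> UNIV)"
      unfolding theta_series_def nq g_def by simp
    also have "\<dots> = (\<Sum>\<^sub>\<infinity>x::int. \<Sum>\<^sub>\<infinity>y::int. g v (of_int x) (of_int y))"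
      by (rule infsum_Sigma'_banach[symmetric]) (rule sum_g[OF that])
    also have "\<dots> = (\<Sum>\<^sub>\<infinity>y::int. \<Sum>\<^sub>\<infinity>x::int. g v (of_int x) (of_int y))"
      by (rule infsum_swap_banach) (rule sum_g[OF that])
    finally show ?thesis .
  qed
  have inner1: "(\<Sum>\<^sub>\<infinity>x::int. g t (of_int x) y) = of_real (1 / sqrt (2 * t * a)) * (\<Sum>\<^sub>\<infinity>k::int. h (of_int k) y)" for y
  proof -
    have "g t x y = of_real (exp (- pi * y\<^sup>2 / s)) * of_real (exp (- pi * (2 * t * a) * (b * y / (2 * a) + x)\<^sup>2))" for x
    proof -
      have "- 2 * pi * t * q x y = - pi * y\<^sup>2 / s + - pi * (2 * t * a) * (b * y / (2 * a) + x)\<^sup>2"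
        unfolding qsq s_def using a d t by (simp add: field_simps)
      thus ?thesis unfolding g_def by (simp only: exp_add of_real_mult)
    qed
    hence "(\<Sum>\<^sub>\<infinity>x::int. g t (of_int x) y) = of_real (exp (- pi * y\<^sup>2 / s)) *
       (\<Sum>\<^sub>\<infinity>x::int. of_real (exp (- pi * (2 * t * a) * (b * y / (2 * a) + of_int x)\<^sup>2)))"
      by (simp only: infsum_cmult_right')
    also have "(\<Sum>\<^sub>\<infinity>x::int. complex_of_real (exp (- pi * (2 * t * a) * (b * y / (2 * a) + of_int x)\<^sup>2))) =
      (\<Sum>\<^sub>\<infinity>k::int. of_real (exp (- pi * of_int k ^ 2 / (2 * t * a)) / sqrt (2 * t * a)) * cis (2 * pi * of_int k * (b * y / (2 * a))))"
      by (rule poisson_gaussian) (use a t in simp)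
    also have "of_real (exp (- pi * y\<^sup>2 / s)) * \<dots> = (\<Sum>\<^sub>\<infinity>k::int. of_real (1 / sqrt (2 * t * a)) * h (of_int k) y)"
      unfolding infsum_cmult_right'[symmetric] by (rule infsum_cong) (simp add: h_def mult_ac)
    finally show ?thesis by (simp only: infsum_cmult_right')
  qed
  have inner2: "(\<Sum>\<^sub>\<infinity>y::int. h k (of_int y)) = of_real (sqrt s) * (\<Sum>\<^sub>\<infinity>n::int. g u (of_int n) k)" for k
  proof -
    have gu: "of_real (exp (- pi * k\<^sup>2 / (2 * t * a))) * of_real (exp (- pi * s * (k * b / (2 * a) + n)\<^sup>2)) = g u n k" for n
    proof -
      have "- 2 * pi * u * q n k = - pi * k\<^sup>2 / (2 * t * a) + - pi * s * (k * b / (2 * a) + n)\<^sup>2"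
        unfolding qsq s_def u_def using a d t by (simp add: field_simps)
      thus ?thesis unfolding g_def by (simp only: exp_add of_real_mult)
    qed
    have "(\<Sum>\<^sub>\<infinity>y::int. h k (of_int y)) = (\<Sum>\<^sub>\<infinity>y::int. (of_real (exp (- pi * k\<^sup>2 / (2 * t * a))) * of_real (sqrt s)) *
       (of_real (exp (- pi * of_int y ^ 2 / s) / sqrt s) * cis (2 * pi * of_int y * (k * b / (2 * a)))))"
      by (rule infsum_cong) (use s in \<open>simp add: h_def\<close>)
    also have "\<dots> = of_real (exp (- pi * k\<^sup>2 / (2 * t * a))) * of_real (sqrt s) *
        (\<Sum>\<^sub>\<infinity>n::int. of_real (exp (- pi * s * (k * b / (2 * a) + of_int n)\<^sup>2)))"
      unfolding infsum_cmult_right' poisson_gaussian[OF s] ..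
    also have "\<dots> = of_real (sqrt s) * (\<Sum>\<^sub>\<infinity>n::int. of_real (exp (- pi * k\<^sup>2 / (2 * t * a))) *
       of_real (exp (- pi * s * (k * b / (2 * a) + of_int n)\<^sup>2)))"
      unfolding infsum_cmult_right' by (simp only: mult_ac)
    also have "\<dots> = of_real (sqrt s) * (\<Sum>\<^sub>\<infinity>n::int. g u (of_int n) k)" by (simp only: gu)
    finally show ?thesis .
  qed
  have "theta_series Q (\<i> * of_real t) = (\<Sum>\<^sub>\<infinity>y::int. \<Sum>\<^sub>\<infinity>x::int. g t (of_int x) (of_int y))"
    by (rule theta[OF t])
  also have "\<dots> = of_real (1 / sqrt (2 * t * a)) * (\<Sum>\<^sub>\<infinity>y::int. \<Sum>\<^sub>\<infinity>k::int. h (of_int k) (of_int y))"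
    unfolding inner1 infsum_cmult_right' ..
  also have "(\<Sum>\<^sub>\<infinity>y::int. \<Sum>\<^sub>\<infinity>k::int. h (of_int k) (of_int y)) = (\<Sum>\<^sub>\<infinity>k::int. \<Sum>\<^sub>\<infinity>y::int. h (of_int k) (of_int y))"
    by (rule infsum_swap_banach) (rule sum_h)
  also have "\<dots> = of_real (sqrt s) * (\<Sum>\<^sub>\<infinity>k::int. \<Sum>\<^sub>\<infinity>n::int. g u (of_int n) (of_int k))"
    unfolding inner2 infsum_cmult_right' ..
  also have "(\<Sum>\<^sub>\<infinity>k::int. \<Sum>\<^sub>\<infinity>n::int. g u (of_int n) (of_int k)) = theta_series Q (\<i> * of_real u)"
    by (rule theta[OF u, symmetric])
  also have "of_real (1 / sqrt (2 * t * a)) * (of_real (sqrt s) * theta_series Q (\<i> * of_real u)) =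
      of_real (sqrt s / sqrt (2 * t * a)) * theta_series Q (\<i> * of_real u)" by simp
  also have "sqrt s / sqrt (2 * t * a) = 1 / (t * sqrt d)"
  proof -
    have "sqrt s / sqrt (2 * t * a) = sqrt (s / (2 * t * a))" by (simp add: real_sqrt_divide)
    also have "s / (2 * t * a) = 1 / (t\<^sup>2 * d)" using a t by (simp add: s_def power2_eq_square field_simps)
    also have "sqrt \<dots> = 1 / (t * sqrt d)" using t by (simp add: real_sqrt_divide real_sqrt_mult)
    finally show ?thesis .
  qed
  finally show ?thesis by (simp add: u_def d_def)
qed

section \<open>Reduced forms of discriminant \<open>- D\<close>\<close>

lemma bqf_conj_conj [simp]: "bqf_conj (bqf_conj P) = P"
  by (cases P) (simp add: bqf_conj_def)

lemma pos_def_coeff_a_pos: "bqf_pos_def P \<Longrightarrow> coeff_a P > 0"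
  unfolding bqf_pos_def_def by (drule spec[of _ 1], drule spec[of _ 0]) (simp add: bqf_eval_def)

lemma reduced_pos_def: "bqf_reduced P \<Longrightarrow> coeff_a P > 0 \<Longrightarrow> bqf_pos_def P"
  unfolding bqf_pos_def_def
proof (intro allI impI)
  fix x y :: int assume P: "bqf_reduced P" "coeff_a P > 0" and xy: "(x, y) \<noteq> (0, 0)"
  have "0 < x\<^sup>2 + y\<^sup>2" using xy by (auto simp: sum_power2_gt_zero_iff)
  hence "0 < coeff_a P * (x\<^sup>2 + y\<^sup>2)" using P by simp
  also have "\<dots> \<le> 2 * bqf_eval P x y" by (rule bqf_reduced_lower_bound[OF P(1)])
  finally show "bqf_eval P x y > 0" by simp
qed

lemma reduced_formsI:
  assumes "gcd a (gcd b c) = 1" "b\<^sup>2 - 4 * a * c = d" "a > 0" "bqf_reduced (BQF a b c)"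
  shows "BQF a b c \<in> reduced_forms d"
  using assms reduced_pos_def[of "BQF a b c"]
  by (simp add: reduced_forms_def prim_pos_def_forms_def bqf_primitive_def bqf_disc_def)

lemma reduced_formsD:
  assumes "P \<in> reduced_forms (- D)"
  shows "bqf_reduced P" "bqf_disc P = - D" "coeff_a P > 0" "3 * (coeff_a P)\<^sup>2 \<le> D"
proof -
  show P: "bqf_reduced P" "bqf_disc P = - D" "coeff_a P > 0"
    using assms pos_def_coeff_a_pos by (auto simp: reduced_forms_def prim_pos_def_forms_def)
  have "(coeff_b P)\<^sup>2 \<le> (coeff_a P)\<^sup>2"
    using P(1) power_mono[of "\<bar>coeff_b P\<bar>" "coeff_a P" 2] by (simp add: bqf_reduced_def)
  moreover have "coeff_a P * coeff_a P \<le> coeff_a P * coeff_c P"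
    using P by (intro mult_left_mono) (auto simp: bqf_reduced_def)
  ultimately show "3 * (coeff_a P)\<^sup>2 \<le> D"
    using P(2) unfolding bqf_disc_def power2_eq_square by linarith
qed

lemma listed_forms:
  assumes "lists_reduced_forms D k Q"
  defines "X \<equiv> Q ` {1..<k+1}" and "Y \<equiv> (\<lambda>i. bqf_conj (Q i)) ` {1..<k+1}"
  shows "Q 0 = principal_form (- D)" "Q 0 \<notin> X" "X \<inter> Y = {}" "reduced_forms (- D) = insert (Q 0) (X \<union> Y)"
proof -
  have d: "distinct (Q 0 # map Q [1..<k+1] @ map (\<lambda>i. bqf_conj (Q i)) [1..<k+1])"
    and e: "set (Q 0 # map Q [1..<k+1] @ map (\<lambda>i. bqf_conj (Q i)) [1..<k+1]) = reduced_forms (- D)"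
    and z: "Q 0 = principal_form (- D)"
    using assms(1) unfolding lists_reduced_forms_def Let_def by blast+
  show "Q 0 = principal_form (- D)" by (rule z)
  show "Q 0 \<notin> X" "X \<inter> Y = {}"
    using d unfolding X_def Y_def distinct.simps distinct_append set_append set_map set_upt by blast+
  show "reduced_forms (- D) = insert (Q 0) (X \<union> Y)"
    using e unfolding X_def Y_def list.set set_append set_map set_upt by (rule sym)
qed

text \<open>Conjugation exchanges the two disjoint halves of the list. Either conclusion can fail
  for an ambiguous form: \<open>(a, 0, c)\<close> is its own conjugate, while
  \<open>(a, a, c)\<close> and \<open>(a, b, a)\<close> with \<open>b > 0\<close> have conjugates
  that are not reduced.\<close>

lemma no_ambiguous_forms:
  assumes "lists_reduced_forms D k Q" "P \<in> reduced_forms (- D)" "P \<noteq> principal_form (- D)"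
  shows "bqf_conj P \<in> reduced_forms (- D)" "bqf_conj P \<noteq> P"
proof -
  define X where "X = Q ` {1..<k+1}"
  define Y where "Y = (\<lambda>i. bqf_conj (Q i)) ` {1..<k+1}"
  have eq: "reduced_forms (- D) = insert (Q 0) (X \<union> Y)" and disj: "X \<inter> Y = {}"
    and Q0: "Q 0 = principal_form (- D)"
    using listed_forms[OF assms(1)] unfolding X_def Y_def by blast+
  have XY: "bqf_conj p \<in> Y" if "p \<in> X" for p using that by (auto simp: X_def Y_def)
  have YX: "bqf_conj p \<in> X" if "p \<in> Y" for p using that by (auto simp: X_def Y_def)
  have "P \<in> X \<or> P \<in> Y" using assms(2,3) eq Q0 by auto
  thus "bqf_conj P \<in> reduced_forms (- D)" "bqf_conj P \<noteq> P"
    using XY[of P] YX[of P] disj unfolding eq by auto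
qed

lemma listed_form_not_principal:
  assumes "lists_reduced_forms D k Q" "1 \<le> r" "r \<le> k"
  shows "Q r \<in> reduced_forms (- D)" "Q r \<noteq> principal_form (- D)"
proof -
  have "Q r \<in> Q ` {1..<k+1}" using assms by auto
  thus "Q r \<in> reduced_forms (- D)" "Q r \<noteq> principal_form (- D)"
    using listed_forms[OF assms(1)] by (blast, metis)
qed

text \<open>For an even discriminant \<open>-4n\<close> with \<open>n > 2\<close>, an ambiguous form
  with first coefficient 2 is written down: \<open>(2, 0, n/2)\<close> or
  \<open>(2, 2, (n+1)/2)\<close>. The congruence for \<open>n\<close> makes the last coefficient
  odd, hence the form primitive.\<close>

lemma admissible_odd:
  assumes adm: "admissible D r k Q"
  shows "D mod 4 = 3 \<and> squarefree D"
proof (rule ccontr)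
  assume neg: "\<not> (D mod 4 = 3 \<and> squarefree D)"
  have D: "D > 0" "1 \<le> r" "r \<le> k" and L: "lists_reduced_forms D k Q" and f: "fundamental_discriminant (- D)"
    using adm by (auto simp: admissible_def)
  have "(- D) mod 4 = 1 \<Longrightarrow> D mod 4 = 3" by presburger
  with neg f have "\<exists>m. - D = 4 * m \<and> m mod 4 \<in> {2, 3}"
    unfolding fundamental_discriminant_def by auto
  then obtain m where m: "- D = 4 * m" "m mod 4 \<in> {2, 3}" by blast
  define n where "n = - m"
  have n: "D = 4 * n" "n > 0" "n mod 4 = 2 \<or> n mod 4 = 1"
  proof -
    show "D = 4 * n" "n > 0" using m D by (simp_all add: n_def)
    have "m mod 4 = 2 \<or> m mod 4 = 3" using m by simp
    thus "n mod 4 = 2 \<or> n mod 4 = 1" unfolding n_def by presburger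
  qed
  have pr: "principal_form (- D) = BQF 1 0 n"
    unfolding principal_form_def using n by simp
  consider "n \<le> 2" | "n > 2" "n mod 4 = 2" | "n > 2" "n mod 4 = 1" using n by linarith
  thus False
  proof cases
    \<comment> \<open>Discriminants -4 and -8 have only the principal reduced form, so there is no
      room for \<open>Q r\<close>.\<close>
    case 1
    obtain a b c where abc: "Q r = BQF a b c" by (cases "Q r")
    have R: "\<bar>b\<bar> \<le> a" "b\<^sup>2 - 4 * a * c = - D" "a > 0" "3 * a\<^sup>2 \<le> D"
      using reduced_formsD[OF listed_form_not_principal(1)[OF L D(2,3)]]
      unfolding abc by (auto simp: bqf_reduced_def bqf_disc_def)
    have "a = 1"
    proof (rule ccontr)
      assume "a \<noteq> 1"
      hence "2 * 2 \<le> a * a" using R by (intro mult_mono) auto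
      thus False using R(4) 1 n by (simp add: power2_eq_square)
    qed
    have "b = -1 \<or> b = 0 \<or> b = 1" using R(1) \<open>a = 1\<close> by linarith
    moreover have "b\<^sup>2 = 4 * (c - n)" using R(2) n \<open>a = 1\<close> by simp
    hence "even (b\<^sup>2)" by simp
    ultimately have "b = 0" by auto
    hence "Q r = BQF 1 0 n" using R(2) n \<open>a = 1\<close> by (simp add: abc)
    thus False using listed_form_not_principal(2)[OF L D(2,3)] pr by simp
  next
    case 2
    define u where "u = n div 2"
    have u: "n = 2 * u" "odd u" "u > 2" using 2 unfolding u_def by presburger+
    have "coprime 2 u" using u by simp
    hence "BQF 2 0 u \<in> reduced_forms (- D)"
      using u n by (intro reduced_formsI) (auto simp: bqf_reduced_def)
    from no_ambiguous_forms(2)[OF L this] show False by (simp add: pr bqf_conj_def)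
  next
    case 3
    define u where "u = (n + 1) div 2"
    have u: "n = 2 * u - 1" "odd u" "u > 2" using 3 unfolding u_def by presburger+
    have "coprime 2 u" using u by simp
    hence "gcd 2 (gcd 2 u) = 1" by simp
    hence "BQF 2 2 u \<in> reduced_forms (- D)"
      using u n by (intro reduced_formsI) (auto simp: bqf_reduced_def)
    from no_ambiguous_forms(1)[OF L this] show False
      by (auto simp: pr bqf_conj_def reduced_forms_def bqf_reduced_def)
  qed
qed

text \<open>According to whether $u \le (u+v)/4$, the ambiguous form
  $(u, u, \frac{u+v}4)$ or $(\frac{u+v}4, \frac{v-u}2, \frac{u+v}4)$ is reduced.\<close>

lemma admissible_no_factorization:
  assumes adm: "admissible D r k Q" and uv: "D = u * v" "1 < u" "u < v"
  shows False
proof -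
  have L: "lists_reduced_forms D k Q" using adm by (auto simp: admissible_def)
  have D: "D mod 4 = 3" "squarefree D" using admissible_odd[OF adm] by auto
  have cop: "g dvd 1" if "g dvd u" "g dvd v" for g
  proof -
    have "g\<^sup>2 dvd D" unfolding uv(1) power2_eq_square using that by (rule mult_dvd_mono)
    thus ?thesis using D(2) by (auto simp: squarefree_def)
  qed
  have "u * v mod 4 = (u mod 4) * (v mod 4) mod 4" by (simp add: mod_mult_eq)
  hence 3: "(u mod 4) * (v mod 4) mod 4 = 3" using D uv by simp
  have "u mod 4 \<in> {0..3}" "v mod 4 \<in> {0..3}" by auto
  hence "u mod 4 \<in> {0,1,2,3}" "v mod 4 \<in> {0,1,2,3}" by auto
  with 3 have "u mod 4 = 1 \<and> v mod 4 = 3 \<or> u mod 4 = 3 \<and> v mod 4 = 1" by auto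
  hence "(u + v) mod 4 = 0" and odd: "odd u" "odd v" by presburger+
  define m where "m = (u + v) div 4"
  have m: "u + v = 4 * m" using \<open>(u + v) mod 4 = 0\<close> unfolding m_def by presburger
  define w where "w = (v - u) div 2"
  have w: "v - u = 2 * w" using odd unfolding w_def by presburger
  have pr: "coeff_a (principal_form (- D)) = 1" by (simp add: principal_form_def)
  show False
  proof (cases "u \<le> m")
    case True
    have "gcd u (gcd u m) dvd 1"
    proof (rule cop)
      have "gcd u (gcd u m) dvd 4 * m - u" by (intro dvd_diff dvd_mult) auto
      also have "4 * m - u = v" using m by simp
      finally show "gcd u (gcd u m) dvd v" .
    qed auto
    hence "gcd u (gcd u m) = 1" by simp
    moreover have "u\<^sup>2 - 4 * u * m = - D"
    proof -
      have "u\<^sup>2 - 4 * u * m = u\<^sup>2 - u * (4 * m)" by simp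
      also have "\<dots> = - D" unfolding m[symmetric] uv by (simp add: power2_eq_square algebra_simps)
      finally show ?thesis .
    qed
    ultimately have "BQF u u m \<in> reduced_forms (- D)"
      using uv True by (intro reduced_formsI) (auto simp: bqf_reduced_def)
    moreover have "BQF u u m \<noteq> principal_form (- D)" 
    proof
      assume "BQF u u m = principal_form (- D)"
      hence "u = 1" using pr by (cases "principal_form (- D)") auto
      thus False using uv by simp
    qed
    ultimately have "bqf_conj (BQF u u m) \<in> reduced_forms (- D)" by (rule no_ambiguous_forms(1)[OF L])
    thus False using uv by (simp add: bqf_conj_def reduced_forms_def bqf_reduced_def)
  next
    \<comment> \<open>\<open>u > m\<close> means \<open>v < 3u\<close>, which is the same as
      \<open>w < m\<close>; so exactly here the second form satisfies the inequality on its middle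
      coefficient.\<close>
    case False
    have "gcd m (gcd w m) dvd 1"
    proof (rule cop)
      have "gcd m (gcd w m) dvd 2 * m - w" "gcd m (gcd w m) dvd 2 * m + w"
        by (intro dvd_diff dvd_add dvd_mult; auto)+
      moreover have "2 * m - w = u" "2 * m + w = v" using m w by linarith+
      ultimately show "gcd m (gcd w m) dvd u" "gcd m (gcd w m) dvd v" by auto
    qed
    hence "gcd m (gcd w m) = 1" by simp
    moreover have "w\<^sup>2 - 4 * m * m = - D"
    proof -
      have "D = (2 * m - w) * (2 * m + w)"
        unfolding uv(1) using m w by (intro arg_cong2[where f = "(*)"]) linarith+
      thus ?thesis by (simp add: power2_eq_square algebra_simps)
    qed
    ultimately have "BQF m w m \<in> reduced_forms (- D)"
      using uv False m w by (intro reduced_formsI) (auto simp: bqf_reduced_def)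
    moreover have "BQF m w m \<noteq> principal_form (- D)"
    proof
      assume "BQF m w m = principal_form (- D)"
      hence "m = 1" using pr by (cases "principal_form (- D)") auto
      thus False using uv m by simp
    qed
    ultimately have "bqf_conj (BQF m w m) \<in> reduced_forms (- D)" by (rule no_ambiguous_forms(1)[OF L])
    thus False using uv w by (simp add: bqf_conj_def reduced_forms_def bqf_reduced_def)
  qed
qed

lemma admissible_prime:
  assumes adm: "admissible D r k Q"
  shows "prime (nat D)"
proof (rule ccontr)
  assume np: "\<not> prime (nat D)"
  have D: "D > 0" "D mod 4 = 3" "squarefree D"
    using adm admissible_odd[OF adm] by (auto simp: admissible_def)
  have "D \<noteq> 1" using D(2) by auto
  hence "nat D > 1" using D(1) by simp
  with np obtain x where x: "x dvd nat D" "x \<noteq> 1" "x \<noteq> nat D" by (auto simp: prime_nat_iff)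
  define u where "u = int x"
  have "u dvd D" using x(1) D(1) unfolding u_def by (metis of_nat_dvd_iff int_nat_eq less_imp_le)
  then obtain v where v: "D = u * v" by blast
  have u: "u > 1" using x D unfolding u_def by (cases x) auto
  have v1: "v > 0" using v u D by (simp add: zero_less_mult_iff)
  have "v \<noteq> 1" using v x D unfolding u_def by auto
  with v1 have v2: "v > 1" by simp
  have "u \<noteq> v"
  proof
    assume "u = v"
    hence "u\<^sup>2 dvd D" using v by (simp add: power2_eq_square)
    hence "u dvd 1" using D by (auto simp: squarefree_def)
    thus False using u by auto
  qed
  thus False
    using admissible_no_factorization[OF adm v] admissible_no_factorization[OF adm, of v u] v u v2
    by (cases "u < v") (auto simp: mult.commute)
qed

text \<open>A reduced form with \<open>a = 1\<close> has \<open>b\<close> odd, hence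
  \<open>b = 1\<close> by the sign rule, and is principal. So \<open>Q r\<close> has
  \<open>a >= 2\<close>, and \<open>3 a^2 <= D\<close> yields \<open>D >= 12\<close>; this in turn
  makes the last coefficient of the principal form at least 2.\<close>

lemma admissible_forms:
  assumes adm: "admissible D r k Q"
  shows "Q 0 = BQF 1 1 ((1 + D) div 4)" "Q 0 \<in> reduced_forms (- D)"
    "Q r \<in> reduced_forms (- D)" "coeff_a (Q r) \<ge> 2" "D \<ge> 12"
proof -
  have D: "D > 0" "1 \<le> r" "r \<le> k" and L: "lists_reduced_forms D k Q"
    using adm by (auto simp: admissible_def)
  have 3: "D mod 4 = 3" using admissible_odd[OF adm] by simp
  hence "(- D) mod 4 = 1" by presburger
  hence pr: "principal_form (- D) = BQF 1 1 ((1 + D) div 4)" by (simp add: principal_form_def)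
  show Q0: "Q 0 = BQF 1 1 ((1 + D) div 4)" using L pr by (simp add: lists_reduced_forms_def)
  show "Q 0 \<in> reduced_forms (- D)" using L by (auto simp: lists_reduced_forms_def Let_def)
  show Qr: "Q r \<in> reduced_forms (- D)" by (rule listed_form_not_principal(1)[OF L D(2,3)])
  obtain a b c where abc: "Q r = BQF a b c" by (cases "Q r")
  have R: "\<bar>b\<bar> \<le> a" "\<bar>b\<bar> = a \<Longrightarrow> b \<ge> 0" "b\<^sup>2 - 4 * a * c = - D" "a > 0" "3 * a\<^sup>2 \<le> D"
    using reduced_formsD[OF Qr] unfolding abc by (auto simp: bqf_reduced_def bqf_disc_def)
  have "a \<noteq> 1"
  proof
    assume a: "a = 1"
    have "b\<^sup>2 = 4 * c - D" using R(3) a by simp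
    hence "odd (b\<^sup>2)" using 3 by presburger
    hence "b \<noteq> 0" by auto
    hence "b = 1" using R(1,2) a by linarith
    hence "c = (1 + D) div 4" using R(3) a by simp
    thus False using listed_form_not_principal(2)[OF L D(2,3)] pr abc a \<open>b = 1\<close> by simp
  qed
  hence a: "a \<ge> 2" using R by simp
  thus "coeff_a (Q r) \<ge> 2" by (simp add: abc)
  have "2 * 2 \<le> a * a" using a by (intro mult_mono) auto
  thus "D \<ge> 12" using R(5) by (simp add: power2_eq_square)
qed

section \<open>Discriminant \<open>- 23\<close>\<close>

lemma reduced_forms_23: "reduced_forms (- 23) = {BQF 1 1 6, BQF 2 1 3, BQF 2 (-1) 3}"
proof (intro equalityI subsetI)
  fix P assume P: "P \<in> reduced_forms (- 23)"
  obtain a b c where abc: "P = BQF a b c" by (cases P)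
  have R: "\<bar>b\<bar> \<le> a" "\<bar>b\<bar> = a \<Longrightarrow> b \<ge> 0" "b\<^sup>2 - 4 * a * c = - 23" "a > 0" "3 * a\<^sup>2 \<le> 23"
    using reduced_formsD[OF P] unfolding abc by (auto simp: bqf_reduced_def bqf_disc_def)
  have "a \<le> 2"
  proof (rule ccontr)
    assume "\<not> a \<le> 2"
    hence "3 * 3 \<le> a * a" by (intro mult_mono) auto
    thus False using R(5) by (simp add: power2_eq_square)
  qed
  have "odd (b\<^sup>2)"
  proof -
    have "b\<^sup>2 = 4 * (a * c) - 23" using R(3) by simp
    thus ?thesis by presburger
  qed
  hence "odd b" by simp
  hence "b = 1 \<or> b = -1" using R(1) \<open>a \<le> 2\<close> by presburger
  hence "b\<^sup>2 = 1" by auto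
  hence ac: "a * c = 6" using R(3) by simp
  have "a = 1 \<or> a = 2" using R(4) \<open>a \<le> 2\<close> by linarith
  thus "P \<in> {BQF 1 1 6, BQF 2 1 3, BQF 2 (-1) 3}"
    using ac R(2) \<open>b = 1 \<or> b = -1\<close> by (auto simp: abc)
next
  fix P assume "P \<in> {BQF 1 1 6, BQF 2 1 3, BQF 2 (-1) 3}"
  moreover have "BQF 1 1 6 \<in> reduced_forms (- 23)" "BQF 2 1 3 \<in> reduced_forms (- 23)"
    "BQF 2 (-1) 3 \<in> reduced_forms (- 23)"
    by (rule reduced_formsI; simp add: bqf_reduced_def)+
  ultimately show "P \<in> reduced_forms (- 23)" by auto
qed

section \<open>Proper equivalence and the three classes of discriminant -23\<close>

lemma properly_equivalent_sym:
  assumes "properly_equivalent P P'"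
  shows "properly_equivalent P' P"
proof -
  obtain p q r s where d: "p * s - q * r = 1"
    and e: "\<And>x y. bqf_eval P' x y = bqf_eval P (p * x + q * y) (r * x + s * y)"
    using assms unfolding properly_equivalent_def by blast
  have "bqf_eval P x y = bqf_eval P' (s * x + (- q) * y) ((- r) * x + p * y)" for x y
  proof -
    have "p * (s * x + (- q) * y) + q * ((- r) * x + p * y) = (p * s - q * r) * x"
      "r * (s * x + (- q) * y) + s * ((- r) * x + p * y) = (p * s - q * r) * y"
      by (simp_all add: algebra_simps)
    thus ?thesis unfolding e d by simp
  qed
  moreover have "s * p - (- q) * (- r) = 1" using d by (simp add: algebra_simps)
  ultimately show ?thesis unfolding properly_equivalent_def by blast
qed

lemma properly_equivalent_trans:
  assumes "properly_equivalent P P'" "properly_equivalent P' P''"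
  shows "properly_equivalent P P''"
proof -
  obtain p q r s where d: "p * s - q * r = 1"
    and e: "\<And>x y. bqf_eval P' x y = bqf_eval P (p * x + q * y) (r * x + s * y)"
    using assms(1) unfolding properly_equivalent_def by blast
  obtain p' q' r' s' where d': "p' * s' - q' * r' = 1"
    and e': "\<And>x y. bqf_eval P'' x y = bqf_eval P' (p' * x + q' * y) (r' * x + s' * y)"
    using assms(2) unfolding properly_equivalent_def by blast
  have "bqf_eval P'' x y = bqf_eval P ((p * p' + q * r') * x + (p * q' + q * s') * y)
      ((r * p' + s * r') * x + (r * q' + s * s') * y)" for x y
    unfolding e e' by (intro arg_cong2[where f = "bqf_eval P"]) (simp_all add: algebra_simps)
  moreover have "(p * p' + q * r') * (r * q' + s * s') - (p * q' + q * s') * (r * p' + s * r') = 1"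
  proof -
    have "(p * p' + q * r') * (r * q' + s * s') - (p * q' + q * s') * (r * p' + s * r') =
      (p * s - q * r) * (p' * s' - q' * r')" by (simp add: algebra_simps)
    thus ?thesis using d d' by simp
  qed
  ultimately show ?thesis unfolding properly_equivalent_def by blast
qed

lemma properly_equivalent_translate:
  "properly_equivalent (BQF a b c) (BQF a (b + 2 * a * n) (a * n\<^sup>2 + b * n + c))"
  unfolding properly_equivalent_def
  by (rule exI[of _ 1], rule exI[of _ n], rule exI[of _ 0], rule exI[of _ 1])
     (simp add: bqf_eval_def power2_eq_square algebra_simps)

lemma properly_equivalent_swap: "properly_equivalent (BQF a b c) (BQF c (- b) a)"
  unfolding properly_equivalent_def
  by (rule exI[of _ 0], rule exI[of _ "-1"], rule exI[of _ 1], rule exI[of _ 0])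
     (simp add: bqf_eval_def power2_eq_square algebra_simps)

lemma properly_equivalent_refl: "properly_equivalent P P"
  unfolding properly_equivalent_def
  by (rule exI[of _ 1], rule exI[of _ 0], rule exI[of _ 0], rule exI[of _ 1]) simp

text \<open>Gauss reduction: translate to make \<open>|b| <= a\<close>, and swap if the last
  coefficient has become smaller than \<open>a\<close>, which decreases the first coefficient. The
  sign rule on the boundary is left out, so \<open>b'\<close> may be negative there.\<close>

lemma reduced_form_exists:
  assumes "a > 0" "b\<^sup>2 - 4 * a * c < 0"
  shows "\<exists>a' b' c'. properly_equivalent (BQF a b c) (BQF a' b' c') \<and> a' > 0 \<and>
    b'\<^sup>2 - 4 * a' * c' = b\<^sup>2 - 4 * a * c \<and> \<bar>b'\<bar> \<le> a' \<and> a' \<le> c'"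
  using assms
proof (induction "nat a" arbitrary: a b c rule: less_induct)
  case less
  \<comment> \<open>This moves \<open>b\<close> to its representative modulo \<open>2a\<close> in
    \<open>[-a, a)\<close>.\<close>
  define n where "n = - ((b + a) div (2 * a))"
  define b' where "b' = b + 2 * a * n"
  define c' where "c' = a * n\<^sup>2 + b * n + c"
  have "b' = (b + a) mod (2 * a) - a"
    unfolding b'_def n_def using minus_mult_div_eq_mod[of "b + a" "2 * a"] by (simp add: algebra_simps)
  moreover have "0 \<le> (b + a) mod (2 * a)" "(b + a) mod (2 * a) < 2 * a" using less.prems by auto
  ultimately have b': "\<bar>b'\<bar> \<le> a" by linarith
  have eqv: "properly_equivalent (BQF a b c) (BQF a b' c')"
    unfolding b'_def c'_def by (rule properly_equivalent_translate)
  have disc: "b'\<^sup>2 - 4 * a * c' = b\<^sup>2 - 4 * a * c"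
    unfolding b'_def c'_def by (simp add: power2_eq_square algebra_simps)
  have "0 \<le> b'\<^sup>2" by simp
  hence "0 < 4 * a * c'" using disc less.prems by linarith
  hence c': "c' > 0" using less.prems by (simp add: zero_less_mult_iff)
  show ?case
  proof (cases "a \<le> c'")
    case True
    thus ?thesis using eqv disc b' less.prems by blast
  next
    case False
    have disc': "(- b')\<^sup>2 - 4 * c' * a = b\<^sup>2 - 4 * a * c" using disc by (simp add: mult_ac)
    have "nat c' < nat a" using False c' by simp
    moreover have "(- b')\<^sup>2 - 4 * c' * a < 0" unfolding disc' using less.prems by simp
    ultimately obtain a2 b2 c2 where *: "properly_equivalent (BQF c' (- b') a) (BQF a2 b2 c2)" "a2 > 0"
      "b2\<^sup>2 - 4 * a2 * c2 = b\<^sup>2 - 4 * a * c" "\<bar>b2\<bar> \<le> a2" "a2 \<le> c2"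
      using less.hyps[of c' "- b'" a] c' disc' by auto
    have "properly_equivalent (BQF a b c) (BQF a2 b2 c2)"
      using eqv properly_equivalent_swap[of a b' c'] *(1) properly_equivalent_trans by blast
    thus ?thesis using * by blast
  qed
qed

lemma prim_pos_def_forms_23_equivalent:
  assumes "P \<in> prim_pos_def_forms (- 23)"
  shows "properly_equivalent P (BQF 1 1 6) \<or> properly_equivalent P (BQF 2 1 3) \<or>
    properly_equivalent P (BQF 2 (-1) 3)"
proof -
  obtain a b c where abc: "P = BQF a b c" by (cases P)
  have "a > 0" "b\<^sup>2 - 4 * a * c = - 23"
    using assms pos_def_coeff_a_pos[of P] by (auto simp: prim_pos_def_forms_def bqf_disc_def abc)
  then obtain a' b' c' where e: "properly_equivalent P (BQF a' b' c')" and R: "a' > 0"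
      "b'\<^sup>2 - 4 * a' * c' = - 23" "\<bar>b'\<bar> \<le> a'" "a' \<le> c'"
    using reduced_form_exists[of a b c] unfolding abc by auto
  show ?thesis
  \<comment> \<open>The one boundary form of discriminant -23 that violates the sign rule;
    translation by 1 makes it principal.\<close>
  proof (cases "BQF a' b' c' = BQF 1 (-1) 6")
    case True
    have "properly_equivalent (BQF 1 (-1) 6) (BQF 1 1 6)"
      using properly_equivalent_translate[of 1 "-1" 6 1] by simp
    thus ?thesis using e properly_equivalent_trans unfolding True by blast
  next
    case False
    have "b'\<^sup>2 \<le> a'\<^sup>2" using R power_mono[of "\<bar>b'\<bar>" a' 2] by simp
    moreover have "a' * a' \<le> a' * c'" using R by (intro mult_left_mono) auto
    ultimately have "3 * a'\<^sup>2 \<le> 23" using R(2) unfolding power2_eq_square by linarith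
    have "a' \<le> 2"
    proof (rule ccontr)
      assume "\<not> a' \<le> 2"
      hence "3 * 3 \<le> a' * a'" by (intro mult_mono) auto
      thus False using \<open>3 * a'\<^sup>2 \<le> 23\<close> by (simp add: power2_eq_square)
    qed
    have "b'\<^sup>2 = 4 * (a' * c') - 23" using R(2) by simp
    hence "odd (b'\<^sup>2)" by presburger
    hence "odd b'" by simp
    hence b: "b' = 1 \<or> b' = -1" using R(3) \<open>a' \<le> 2\<close> by presburger
    hence "b'\<^sup>2 = 1" by auto
    hence ac: "a' * c' = 6" using R(2) by simp
    have "a' = 1 \<or> a' = 2" using R(1) \<open>a' \<le> 2\<close> by linarith
    hence "BQF a' b' c' \<in> {BQF 1 1 6, BQF 2 1 3, BQF 2 (-1) 3}"
      using ac b False by auto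
    thus ?thesis using e by auto
  qed
qed

text \<open>The principal form represents 1, and a form with first coefficient 2 does not.\<close>

lemma not_equivalent_principal_23:
  assumes "b = 1 \<or> b = -1"
  shows "\<not> properly_equivalent (BQF 2 b 3) (BQF 1 1 6)"
proof
  assume "properly_equivalent (BQF 2 b 3) (BQF 1 1 6)"
  then obtain p q r s where "\<And>x y. bqf_eval (BQF 1 1 6) x y = bqf_eval (BQF 2 b 3) (p * x + q * y) (r * x + s * y)"
    unfolding properly_equivalent_def by blast
  from this[of 1 0] have "1 = bqf_eval (BQF 2 b 3) p r" by (simp add: bqf_eval_def)
  moreover have "2 * (p\<^sup>2 + r\<^sup>2) \<le> 2 * bqf_eval (BQF 2 b 3) p r"
    using bqf_reduced_lower_bound[of "BQF 2 b 3" p r] assms by (auto simp: bqf_reduced_def)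
  ultimately have 1: "p\<^sup>2 + r\<^sup>2 \<le> 1" and e: "2 * p\<^sup>2 + b * p * r + 3 * r\<^sup>2 = 1"
    by (simp_all add: bqf_eval_def)
  have "p = 0 \<or> p\<^sup>2 \<ge> 1" "r = 0 \<or> r\<^sup>2 \<ge> 1" by (auto simp: int_one_le_iff_zero_less)
  with 1 have "p = 0 \<or> r = 0" by (smt (verit))
  with e show False by (auto; presburger)
qed

text \<open>\<open>(2,1,3)\<close> represents 2 only at \<open>(1,0)\<close> and its negative, so
  the matrix is upper triangular up to sign. The value 3 at the second basis vector then removes the
  off-diagonal entry. The matrix is plus or minus the identity, but the two forms differ at
  \<open>(1,1)\<close>.\<close>

lemma not_equivalent_conj_23: "\<not> properly_equivalent (BQF 2 1 3) (BQF 2 (-1) 3)"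
proof
  assume "properly_equivalent (BQF 2 1 3) (BQF 2 (-1) 3)"
  then obtain p q r s where d: "p * s - q * r = 1"
    and E: "\<And>x y. bqf_eval (BQF 2 (-1) 3) x y = bqf_eval (BQF 2 1 3) (p * x + q * y) (r * x + s * y)"
    unfolding properly_equivalent_def by blast
  have e1: "2 * p\<^sup>2 + p * r + 3 * r\<^sup>2 = 2" using E[of 1 0] by (simp add: bqf_eval_def)
  have e2: "2 * q\<^sup>2 + q * s + 3 * s\<^sup>2 = 3" using E[of 0 1] by (simp add: bqf_eval_def)
  have "(4 * p + r)\<^sup>2 + 23 * r\<^sup>2 = 8 * (2 * p\<^sup>2 + p * r + 3 * r\<^sup>2)"
    by (simp add: power2_eq_square algebra_simps)
  hence 1: "(4 * p + r)\<^sup>2 + 23 * r\<^sup>2 = 16" using e1 by simp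
  have "r = 0"
  proof (rule ccontr)
    assume "r \<noteq> 0"
    hence "r\<^sup>2 \<ge> 1" by (simp add: int_one_le_iff_zero_less)
    thus False using 1 zero_le_power2[of "4 * p + r"] by linarith
  qed
  hence ps: "p * s = 1" using d by simp
  hence "p = 1 \<and> s = 1 \<or> p = -1 \<and> s = -1" by (rule pos_zmult_eq_1_iff_lemma[THEN disjE]) (use ps in auto)
  hence s: "s\<^sup>2 = 1" "p = s" by auto
  hence "q * (2 * q + s) = 0" using e2 by (simp add: power2_eq_square algebra_simps)
  moreover have "2 * q + s \<noteq> 0" using \<open>p = 1 \<and> s = 1 \<or> p = -1 \<and> s = -1\<close> by presburger
  ultimately have "q = 0" by simp
  have "bqf_eval (BQF 2 (-1) 3) 1 1 = bqf_eval (BQF 2 1 3) p s"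
    using E[of 1 1] \<open>q = 0\<close> \<open>r = 0\<close> by simp
  moreover have "s * s = 1" using ps unfolding s(2) .
  ultimately show False unfolding s(2) by (simp add: bqf_eval_def power2_eq_square)
qed

lemma class_number_23: "class_number (- 23) = 3"
proof -
  define A where "A = prim_pos_def_forms (- 23)"
  define R where "R = {(P, P'). P \<in> A \<and> P' \<in> A \<and> properly_equivalent P P'}"
  define f0 f1 f2 where "f0 = BQF 1 1 6" "f1 = BQF 2 1 3" "f2 = BQF 2 (-1) 3"
  have fA: "f0 \<in> A" "f1 \<in> A" "f2 \<in> A"
    using reduced_forms_23 unfolding reduced_forms_def A_def f0_f1_f2_def by blast+
  have equiv: "equiv A R"
  proof (rule equivI)
    show "R \<subseteq> A \<times> A" by (auto simp: R_def)
    show "refl_on A R" by (auto simp: R_def refl_on_def properly_equivalent_refl)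
    show "sym R" by (auto simp: R_def sym_def properly_equivalent_sym)
    show "trans R" unfolding R_def trans_def using properly_equivalent_trans by blast
  qed
  have "A // R = {R `` {f0}, R `` {f1}, R `` {f2}}"
  proof (intro equalityI subsetI)
    fix X assume "X \<in> A // R"
    then obtain P where P: "P \<in> A" "X = R `` {P}" by (auto simp: quotient_def)
    have "(P, f0) \<in> R \<or> (P, f1) \<in> R \<or> (P, f2) \<in> R"
      using prim_pos_def_forms_23_equivalent[of P] P fA unfolding R_def A_def f0_f1_f2_def by auto
    thus "X \<in> {R `` {f0}, R `` {f1}, R `` {f2}}" using equiv_class_eq[OF equiv] P(2) by blast
  qed (use fA in \<open>auto simp: quotient_def\<close>)
  moreover have "(f1, f0) \<notin> R" "(f2, f0) \<notin> R" "(f1, f2) \<notin> R"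
    using not_equivalent_principal_23[of 1] not_equivalent_principal_23[of "-1"] not_equivalent_conj_23
    unfolding R_def f0_f1_f2_def by auto
  hence "R `` {f1} \<noteq> R `` {f0}" "R `` {f2} \<noteq> R `` {f0}" "R `` {f1} \<noteq> R `` {f2}"
    using eq_equiv_class_iff[OF equiv] fA by blast+
  ultimately have "card (A // R) = 3" by (simp add: eq_commute)
  thus ?thesis unfolding class_number_def A_def R_def by simp
qed

text \<open>An instance has to be exhibited, so that the claim for the pair \<open>(23, 1)\<close>
  is not vacuous.\<close>

lemma admissible_23: "admissible 23 1 1 (\<lambda>i. if i = 0 then BQF 1 1 6 else BQF 2 1 3)"
proof -
  have "prime (23::int)" by simp
  hence "squarefree (- (23::int))" by (simp add: squarefree_prime del: prime_int_numeral_eq)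
  moreover have "(- 23 :: int) mod 4 = 1" by simp
  ultimately have "fundamental_discriminant (- 23)" unfolding fundamental_discriminant_def by simp
  moreover have "lists_reduced_forms 23 1 (\<lambda>i. if i = 0 then BQF 1 1 6 else BQF 2 1 3)"
    unfolding lists_reduced_forms_def reduced_forms_23
    by (auto simp: principal_form_def bqf_conj_def)
  ultimately show ?thesis using class_number_23 by (simp add: admissible_def)
qed

text \<open>Three reduced forms leave room for a single conjugate pair. A listing may name either
  member of it, so both signs occur for \<open>Q r\<close>.\<close>

lemma admissible_23D:
  assumes "admissible 23 r k Q"
  shows "r = 1" "Q 0 = BQF 1 1 6" "Q r = BQF 2 1 3 \<or> Q r = BQF 2 (-1) 3"
proof -
  have L: "lists_reduced_forms 23 k Q" and r: "1 \<le> r" "r \<le> k" using assms by (auto simp: admissible_def)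
  let ?Qs = "Q 0 # map Q [1..<k+1] @ map (\<lambda>i. bqf_conj (Q i)) [1..<k+1]"
  have "distinct ?Qs" "set ?Qs = reduced_forms (- 23)"
    using L unfolding lists_reduced_forms_def Let_def by blast+
  hence "length ?Qs = card (reduced_forms (- 23))" by (metis distinct_card)
  also have "\<dots> = 3" unfolding reduced_forms_23 by simp
  finally show "r = 1" using r by simp
  show "Q 0 = BQF 1 1 6" using admissible_forms(1)[OF assms] by simp
  show "Q r = BQF 2 1 3 \<or> Q r = BQF 2 (-1) 3"
    using admissible_forms(3,4)[OF assms] unfolding reduced_forms_23 by auto
qed

section \<open>The eta product of level 23\<close>

lemma eta_term_alt:
  "eta_term z n = of_real (alt_sign n) * exp (2 * of_real pi * \<i> * z * of_int ((6 * n + 1)\<^sup>2) / 24)"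
  unfolding eta_term_def minus_one_power_abs ..

text \<open>Over all $(u,v)$, sum $E(u,v) = e^{2\pi iz(u^2+23v^2)/24}$. The lattices
  $L_1 = \{u \equiv v\}$ and $L_5 = \{u \equiv 5v\}$ modulo 12 are parametrised such that $u^2+23v^2$ is
  24 times $x^2+xy+6y^2$ and $2x^2\pm xy+3y^2$, respectively. Points with $\gcd(v,6) > 1$ cancel in the difference;
  the others are $(\pm(6m+1), \pm(6n+1))$ with $m+n$ even for $L_1$ and odd for $L_5$.\<close>

theorem eta_product_23:
  assumes z: "Im z > 0" and b: "b = 1 \<or> b = -1"
  shows "dedekind_eta z * dedekind_eta (23 * z) =
    (theta_series (BQF 1 1 6) z - theta_series (BQF 2 b 3) z) / 2"
proof -
  define E where "E p = (case p of (u, v) \<Rightarrow> exp (2 * of_real pi * \<i> * z * of_int (u\<^sup>2 + 23 * v\<^sup>2) / 24))" for p :: "int \<times> int"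
  have E_cong: "E (u, v) = E (u', v')" if "u\<^sup>2 + 23 * v\<^sup>2 = u'\<^sup>2 + 23 * v'\<^sup>2" for u v u' v'
    unfolding E_def case_prod_conv that ..
  have E_nome: "E (u, v) = nome z powi n" if "u\<^sup>2 + 23 * v\<^sup>2 = 24 * n" for u v n
    unfolding E_def case_prod_conv that nome_powi by (simp add: field_simps)
  have sumE: "E summable_on S" for S
  proof -
    have "(\<lambda>p. norm (E p)) summable_on UNIV"
    proof (rule summable_on_comparison_test)
      show "(\<lambda>(u::int, v::int). exp (- (2 * pi * Im z / 24) * (of_int u ^ 2 + of_int v ^ 2))) summable_on UNIV"
        by (rule summable_gaussian_2d) (use z in simp)
      fix p :: "int \<times> int"
      obtain u v where p: "p = (u, v)" by (cases p)
      have "(of_int u ^ 2 + of_int v ^ 2 :: real) \<le> of_int u ^ 2 + 23 * of_int v ^ 2" by simp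
      hence "(2 * pi * Im z / 24) * (of_int u ^ 2 + of_int v ^ 2) \<le> (2 * pi * Im z / 24) * (of_int u ^ 2 + 23 * of_int v ^ 2)"
        using z by (intro mult_left_mono) auto
      thus "norm (E p) \<le> (case p of (u, v) \<Rightarrow> exp (- (2 * pi * Im z / 24) * (of_int u ^ 2 + of_int v ^ 2)))"
        unfolding p E_def by (simp add: norm_exp_eq_Re)
    qed simp_all
    hence "E summable_on UNIV" by (rule abs_summable_summable)
    thus ?thesis by (rule summable_on_subset_banach) simp
  qed
  define L1 where "L1 = {(u::int, v::int). 12 dvd u - v}"
  define L5 where "L5 = {(u::int, v::int). 12 dvd u - 5 * v}"
  define C where "C r = {(u::int, v::int). v mod 6 = r}" for r :: int
  define N where "N = {(u::int, v::int). v mod 6 \<noteq> 1 \<and> v mod 6 \<noteq> 5}"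
  \<comment> \<open>The identity behind this is
    \<open>(x + 12 y)^2 + 23 x^2 = 24 (x^2 + x y + 6 y^2)\<close>.\<close>
  have theta0: "theta_series (BQF 1 1 6) z = infsum E L1"
    unfolding theta_series_def
  proof (rule infsum_reindex_bij_witness[where j = "\<lambda>(x, y). (x + 12 * y, x)" and i = "\<lambda>(u, v). (v, (u - v) div 12)"])
    fix p :: "int \<times> int"
    show "E (case p of (x, y) \<Rightarrow> (x + 12 * y, x)) = (case p of (x, y) \<Rightarrow> nome z powi bqf_eval (BQF 1 1 6) x y)"
      by (cases p) (auto intro!: E_nome simp: bqf_eval_def power2_eq_square algebra_simps)
  qed (auto simp: L1_def)
  \<comment> \<open>Here \<open>(5 x + 7 y)^2 + 23 (x - y)^2 = 24 (2 x^2 + x y + 3 y^2)\<close>; the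
    sign \<open>b\<close> is absorbed into \<open>y\<close>, as \<open>b * b = 1\<close>.\<close>
  have theta1: "theta_series (BQF 2 b 3) z = infsum E L5"
    unfolding theta_series_def
  proof (rule infsum_reindex_bij_witness[where j = "\<lambda>(x, y). (5 * x + 7 * (b * y), x - b * y)"
      and i = "\<lambda>(u, v). (v + (u - 5 * v) div 12, b * ((u - 5 * v) div 12))"])
    fix p :: "int \<times> int"
    show "E (case p of (x, y) \<Rightarrow> (5 * x + 7 * (b * y), x - b * y)) = (case p of (x, y) \<Rightarrow> nome z powi bqf_eval (BQF 2 b 3) x y)"
      using b by (cases p) (auto intro!: E_nome simp: bqf_eval_def power2_eq_square algebra_simps)
    have e: "5 * x + 7 * (b * y) - 5 * (x - b * y) = 12 * (b * y)" for x y by simp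
    have bb: "b * (b * y) = y" "b * b = 1" for y using b by auto
    show "(case p of (x, y) \<Rightarrow> (5 * x + 7 * (b * y), x - b * y)) \<in> L5"
      by (cases p) (simp add: L5_def e del: right_diff_distrib)
    show "(case case p of (x, y) \<Rightarrow> (5 * x + 7 * (b * y), x - b * y) of
        (u, v) \<Rightarrow> (v + (u - 5 * v) div 12, b * ((u - 5 * v) div 12))) = p"
      by (cases p) (simp add: e bb)
    show "(case case p of (u, v) \<Rightarrow> (v + (u - 5 * v) div 12, b * ((u - 5 * v) div 12)) of
        (x, y) \<Rightarrow> (5 * x + 7 * (b * y), x - b * y)) = p" if "p \<in> L5"
    proof -
      obtain u v where p: "p = (u, v)" by (cases p)
      have "12 * ((u - 5 * v) div 12) = u - 5 * v" using that p by (auto simp: L5_def)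
      thus ?thesis by (simp add: p bb)
    qed
  qed auto
  \<comment> \<open>If 3 divides \<open>v\<close>, then \<open>4 v\<close> is 0 modulo 12 and the
    two congruences coincide. If \<open>v\<close> is even, then \<open>6 v\<close> is 0 modulo 12
    and \<open>u -> -u\<close> exchanges them. \<open>E\<close> is unchanged by both maps.\<close>
  have noncoprime: "infsum E (L1 \<inter> N) = infsum E (L5 \<inter> N)"
  proof (rule infsum_reindex_bij_witness[where j = "\<lambda>(u, v). (if 3 dvd v then u else - u, v)"
      and i = "\<lambda>(u, v). (if 3 dvd v then u else - u, v)"])
    have 3: "12 dvd u - v \<longleftrightarrow> 12 dvd u - 5 * v" if "3 dvd v" for u v :: int
    proof -
      from that obtain k where "v = 3 * k" by blast
      hence "u - 5 * v = (u - v) + (- k) * 12" by simp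
      thus ?thesis by (simp only: dvd_add_times_triv_right_iff)
    qed
    have 2: "12 dvd u - v \<longleftrightarrow> 12 dvd - u - 5 * v" "12 dvd - u - v \<longleftrightarrow> 12 dvd u - 5 * v" if "even v" for u v :: int
    proof -
      from that obtain k where "v = 2 * k" by blast
      hence "- u - 5 * v = - (u - v) + (- k) * 12" "u - 5 * v = - (- u - v) + (- k) * 12" by simp_all
      thus "12 dvd u - v \<longleftrightarrow> 12 dvd - u - 5 * v" "12 dvd - u - v \<longleftrightarrow> 12 dvd u - 5 * v"
        by (simp_all only: dvd_add_times_triv_right_iff dvd_minus_iff)
    qed
    have 6: "even v" if "v mod 6 \<noteq> 1" "v mod 6 \<noteq> 5" "\<not> 3 dvd v" for v :: int
      using that by presburger
    show "(case p of (u, v) \<Rightarrow> (if 3 dvd v then u else - u, v)) \<in> L5 \<inter> N" if "p \<in> L1 \<inter> N" for p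
    proof -
      obtain u v where p: "p = (u, v)" by (cases p)
      show ?thesis
        using that 2[where u = u and v = v] 3[where u = u and v = v] 6[of v]
        by (cases "3 dvd v") (simp_all add: p L1_def L5_def N_def)
    qed
    show "(case p of (u, v) \<Rightarrow> (if 3 dvd v then u else - u, v)) \<in> L1 \<inter> N" if "p \<in> L5 \<inter> N" for p
    proof -
      obtain u v where p: "p = (u, v)" by (cases p)
      show ?thesis
        using that 2[where u = u and v = v] 3[where u = u and v = v] 6[of v]
        by (cases "3 dvd v") (simp_all add: p L1_def L5_def N_def)
    qed
  qed (auto intro!: E_cong)
  define H where "H = (\<lambda>p. E (case p of (m, n) \<Rightarrow> (6 * m + 1, 6 * n + 1)))"
  define Ev where "Ev = {(m::int, n::int). even (m + n)}"
  define Od where "Od = {(m::int, n::int). odd (m + n)}"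
  have reindex: "infsum E T = infsum H W"
    if "\<And>p. p \<in> T \<Longrightarrow> i (j p) = p \<and> j p \<in> W" "\<And>p. p \<in> W \<Longrightarrow> j (i p) = p \<and> i p \<in> T" "\<And>p. E (i p) = H p"
    for T W i j
  proof (rule infsum_reindex_bij_witness[where i = i and j = j])
    show "H (j p) = E p" if "p \<in> T" for p
      using \<open>\<And>p. E (i p) = H p\<close>[of "j p"] \<open>\<And>p. p \<in> T \<Longrightarrow> i (j p) = p \<and> j p \<in> W\<close>[OF that] by simp
  qed (use that in blast)+
  have L11: "infsum E (L1 \<inter> C 1) = infsum H Ev"
  proof (rule reindex)
    let ?i = "\<lambda>(m, n). (6 * m + 1, 6 * n + 1)" and ?j = "\<lambda>(u, v). (u div 6, v div 6)"
    show "?i (?j p) = p \<and> ?j p \<in> Ev" if "p \<in> L1 \<inter> C 1" for p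
      using that by (auto simp: L1_def C_def Ev_def) presburger+
    show "?j (?i p) = p \<and> ?i p \<in> L1 \<inter> C 1" if "p \<in> Ev" for p
      using that by (auto simp: L1_def C_def Ev_def) presburger+
    show "E (?i p) = H p" for p
      unfolding H_def by (cases p) (auto intro!: E_cong simp: power2_eq_square algebra_simps)
  qed
  have L15: "infsum E (L1 \<inter> C 5) = infsum H Ev"
  proof (rule reindex)
    let ?i = "\<lambda>(m, n). (- (6 * m + 1), - (6 * n + 1))" and ?j = "\<lambda>(u, v). ((- u) div 6, (- v) div 6)"
    show "?i (?j p) = p \<and> ?j p \<in> Ev" if "p \<in> L1 \<inter> C 5" for p
      using that by (auto simp: L1_def C_def Ev_def) presburger+
    show "?j (?i p) = p \<and> ?i p \<in> L1 \<inter> C 5" if "p \<in> Ev" for p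
      using that by (auto simp: L1_def C_def Ev_def) presburger+
    show "E (?i p) = H p" for p
      unfolding H_def by (cases p) (auto intro!: E_cong simp: power2_eq_square algebra_simps)
  qed
  \<comment> \<open>With \<open>v = -(6n+1)\<close>, the congruence \<open>u = 5v + 12k\<close>
    gives \<open>u = 6m + 1\<close> for \<open>m = 2k - 5n - 1\<close>, so \<open>m + n\<close> is
    odd.\<close>
  have aux: "6 * (u div 6) + 1 = u" "6 * ((- v) div 6) + 1 = - v" "odd (u div 6 + (- v) div 6)"
    if "12 dvd u - 5 * v" "v mod 6 = 5" for u v :: int
  proof -
    define n where "n = (- v) div 6"
    have n: "6 * n + 1 = - v" using that(2) unfolding n_def by presburger
    from that(1) obtain k where "u - 5 * v = 12 * k" by blast
    hence u: "u = 6 * (2 * k - 5 * n - 1) + 1" using n by simp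
    hence "u div 6 = 2 * k - 5 * n - 1" by presburger
    thus "6 * (u div 6) + 1 = u" "6 * ((- v) div 6) + 1 = - v" "odd (u div 6 + (- v) div 6)"
      using u n unfolding n_def[symmetric] by simp_all
  qed
  have L55: "infsum E (L5 \<inter> C 5) = infsum H Od"
  proof (rule reindex)
    let ?i = "\<lambda>(m, n). (6 * m + 1, - (6 * n + 1))" and ?j = "\<lambda>(u, v). (u div 6, (- v) div 6)"
    show "?i (?j p) = p \<and> ?j p \<in> Od" if "p \<in> L5 \<inter> C 5" for p
    proof -
      obtain u v where p: "p = (u, v)" by (cases p)
      have "12 dvd u - 5 * v" "v mod 6 = 5" using that by (auto simp: p L5_def C_def)
      from aux[OF this] show ?thesis by (simp only: p Od_def mem_Collect_eq case_prod_conv minus_minus simp_thms)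
    qed
    show "?j (?i p) = p \<and> ?i p \<in> L5 \<inter> C 5" if "p \<in> Od" for p
      using that by (auto simp: L5_def C_def Od_def) presburger+
    show "E (?i p) = H p" for p
      unfolding H_def by (cases p) (auto intro!: E_cong simp: power2_eq_square algebra_simps)
  qed
  have L51: "infsum E (L5 \<inter> C 1) = infsum H Od"
  proof (rule reindex)
    let ?i = "\<lambda>(m, n). (- (6 * m + 1), 6 * n + 1)" and ?j = "\<lambda>(u, v). ((- u) div 6, v div 6)"
    show "?i (?j p) = p \<and> ?j p \<in> Od" if "p \<in> L5 \<inter> C 1" for p
    proof -
      obtain u v where p: "p = (u, v)" by (cases p)
      have uv: "12 dvd u - 5 * v" "v mod 6 = 1" using that by (auto simp: p L5_def C_def)
      have "- u - 5 * - v = - (u - 5 * v)" by simp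
      hence "12 dvd - u - 5 * - v" using uv(1) by (simp only: dvd_minus_iff)
      moreover have "(- v) mod 6 = 5" using uv(2) by presburger
      ultimately show ?thesis
        using aux[of "- u" "- v"] by (simp only: p Od_def mem_Collect_eq case_prod_conv minus_minus simp_thms)
    qed
    show "?j (?i p) = p \<and> ?i p \<in> L5 \<inter> C 1" if "p \<in> Od" for p
      using that by (auto simp: L5_def C_def Od_def) presburger+
    show "E (?i p) = H p" for p
      unfolding H_def by (cases p) (auto intro!: E_cong simp: power2_eq_square algebra_simps)
  qed
  have split: "infsum E L = infsum E (L \<inter> N) + infsum E (L \<inter> C 1) + infsum E (L \<inter> C 5)" for L
  proof -
    have "L = (L \<inter> N) \<union> (L \<inter> C 1) \<union> (L \<inter> C 5)" by (auto simp: N_def C_def)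
    hence "infsum E L = infsum E ((L \<inter> N) \<union> (L \<inter> C 1) \<union> (L \<inter> C 5))" by simp
    also have "\<dots> = infsum E ((L \<inter> N) \<union> (L \<inter> C 1)) + infsum E (L \<inter> C 5)"
      by (rule infsum_Un_disjoint) (auto simp: N_def C_def sumE)
    also have "infsum E ((L \<inter> N) \<union> (L \<inter> C 1)) = infsum E (L \<inter> N) + infsum E (L \<inter> C 1)"
      by (rule infsum_Un_disjoint) (auto simp: N_def C_def sumE)
    finally show ?thesis .
  qed
  \<comment> \<open>Each lattice meets the classes 1 and 5 of \<open>v\<close> in sets with equal
    sums; the resulting factor 2 cancels the 1/2 in the claim.\<close>
  have "theta_series (BQF 1 1 6) z - theta_series (BQF 2 b 3) z = 2 * (infsum H Ev - infsum H Od)"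
    unfolding theta0 theta1 split[of L1] split[of L5] noncoprime L11 L15 L55 L51 by simp
  moreover have "dedekind_eta z * dedekind_eta (23 * z) = infsum H Ev - infsum H Od"
  proof -
    have z': "Im (23 * z) > 0" using z by simp
    have sumH: "H summable_on S" for S
    proof -
      have "E summable_on (\<lambda>(m, n). (6 * m + 1, 6 * n + 1)) ` S" by (rule sumE)
      thus ?thesis by (subst (asm) summable_on_reindex) (auto simp: inj_on_def H_def o_def)
    qed
    have sgn: "eta_term z m * eta_term (23 * z) n = of_real (alt_sign (m + n)) * H (m, n)" for m n
    proof -
      have "2 * of_real pi * \<i> * z * of_int ((6 * m + 1)\<^sup>2) / 24 + 2 * of_real pi * \<i> * (23 * z) * of_int ((6 * n + 1)\<^sup>2) / 24 =
         2 * of_real pi * \<i> * z * of_int ((6 * m + 1)\<^sup>2 + 23 * (6 * n + 1)\<^sup>2) / 24"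
        by (simp add: field_simps)
      moreover have "alt_sign m * alt_sign n = alt_sign (m + n)" by (auto simp: alt_sign_def)
      hence "complex_of_real (alt_sign (m + n)) = of_real (alt_sign m) * of_real (alt_sign n)" by (simp flip: of_real_mult)
      ultimately show ?thesis unfolding eta_term_alt H_def E_def case_prod_conv
        by (simp only: exp_add[symmetric] mult_ac)
    qed
    have sums: "(\<lambda>(m, n). eta_term z m * eta_term (23 * z) n) summable_on UNIV \<times> UNIV"
    proof -
      have "(\<lambda>(m, n). norm (eta_term z m) * norm (eta_term (23 * z) n)) summable_on UNIV \<times> UNIV"
        by (intro summable_on_product_nonneg eta_term_abs_summable z z') auto
      hence "(\<lambda>p. norm (case p of (m, n) \<Rightarrow> eta_term z m * eta_term (23 * z) n)) summable_on UNIV \<times> UNIV"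
        by (simp add: case_prod_unfold norm_mult)
      thus ?thesis by (rule abs_summable_summable)
    qed
    have "dedekind_eta z * dedekind_eta (23 * z) = (\<Sum>\<^sub>\<infinity>m. eta_term z m * dedekind_eta (23 * z))"
      using infsumI[OF dedekind_eta_has_sum[OF z]] by (simp only: infsum_cmult_left')
    also have "\<dots> = (\<Sum>\<^sub>\<infinity>m. \<Sum>\<^sub>\<infinity>n. eta_term z m * eta_term (23 * z) n)"
      using infsumI[OF dedekind_eta_has_sum[OF z']] by (simp only: infsum_cmult_right')
    also have "\<dots> = infsum (\<lambda>(m, n). eta_term z m * eta_term (23 * z) n) (UNIV \<times> UNIV)"
      by (rule infsum_Sigma'_banach[OF sums])
    also have "\<dots> = infsum (\<lambda>(m, n). of_real (alt_sign (m + n)) * H (m, n)) (Ev \<union> Od)"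
      unfolding sgn by (rule arg_cong[of _ _ "infsum _"]) (auto simp: Ev_def Od_def)
    also have "\<dots> = infsum (\<lambda>(m, n). of_real (alt_sign (m + n)) * H (m, n)) Ev + infsum (\<lambda>(m, n). of_real (alt_sign (m + n)) * H (m, n)) Od"
      using sums unfolding sgn
      by (intro infsum_Un_disjoint) (auto simp: Ev_def Od_def intro: summable_on_subset_banach)
    also have "infsum (\<lambda>(m, n). of_real (alt_sign (m + n)) * H (m, n)) Ev = infsum H Ev"
      by (rule infsum_cong) (auto simp: Ev_def alt_sign_def)
    also have "infsum (\<lambda>(m, n). of_real (alt_sign (m + n)) * H (m, n)) Od = infsum (\<lambda>p. - H p) Od"
      by (rule infsum_cong) (auto simp: Od_def alt_sign_def)
    finally show ?thesis by (simp add: infsum_uminus)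
  qed
  ultimately show ?thesis by simp
qed

section \<open>Eta quotients\<close>

definition theta_imag :: "bqf \<Rightarrow> real \<Rightarrow> real" where
  "theta_imag Q t = (\<Sum>\<^sub>\<infinity>(x, y). exp (- 2 * pi * t * of_int (bqf_eval Q x y)))"

lemma theta_imag_summable:
  assumes "bqf_reduced Q" "coeff_a Q > 0" "t > 0"
  shows "(\<lambda>(x, y). exp (- 2 * pi * t * of_int (bqf_eval Q x y))) summable_on UNIV"
  using theta_norm_summable[of Q "\<i> * of_real t"] assms
  by (simp add: case_prod_unfold norm_nome_powi)

lemma theta_series_imag:
  assumes "bqf_reduced Q" "coeff_a Q > 0" "t > 0"
  shows "theta_series Q (\<i> * of_real t) = of_real (theta_imag Q t)"
  using has_sum_of_real[OF has_sum_infsum[OF theta_imag_summable[OF assms]], where ?'a = complex]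
  unfolding theta_series_def theta_imag_def nome_imag_powi
  by (intro infsumI) (simp add: case_prod_unfold)

text \<open>\<open>F\<close> is any finite set containing all points where the form is below 2. The
  tail at time \<open>t\<close> is compared with the convergent tail at time 1.\<close>

lemma theta_imag_asymp:
  assumes Q: "bqf_reduced Q" "coeff_a Q > 0" and F: "finite F"
    and ge: "\<And>x y. (x, y) \<notin> F \<Longrightarrow> bqf_eval Q x y \<ge> 2"
  shows "((\<lambda>t. exp (2 * pi * t) * (theta_imag Q t - (\<Sum>(x, y)\<in>F. exp (- 2 * pi * t * of_int (bqf_eval Q x y)))))
    \<longlongrightarrow> 0) at_top"
proof (rule tendsto_sandwich)
  define f where "f t p = (case p of (x, y) \<Rightarrow> exp (- 2 * pi * t * of_int (bqf_eval Q x y)))" for t p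
  have f_eq: "f t = (\<lambda>(x, y). exp (- 2 * pi * t * of_int (bqf_eval Q x y)))" for t
    by (auto simp: f_def fun_eq_iff)
  have sum: "f t summable_on S" if "t > 0" for t S
    using theta_imag_summable[OF Q that] unfolding f_eq[symmetric]
    by (rule summable_on_subset_banach) simp
  have tail: "theta_imag Q t - sum (f t) F = infsum (f t) (- F)" if "t > 0" for t
  proof -
    have "infsum (f t) (F \<union> - F) = infsum (f t) F + infsum (f t) (- F)"
      by (rule infsum_Un_disjoint) (auto intro: sum that)
    thus ?thesis using F by (simp add: theta_imag_def f_def[abs_def])
  qed
  define C where "C = exp (2 * pi) * infsum (f 1) (- F)"
  have bounds: "0 \<le> exp (2 * pi * t) * infsum (f t) (- F) \<and>
     exp (2 * pi * t) * infsum (f t) (- F) \<le> exp (- 2 * pi * (t - 1)) * C" if t: "t \<ge> 1" for t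
  proof
    show "0 \<le> exp (2 * pi * t) * infsum (f t) (- F)"
      by (intro mult_nonneg_nonneg infsum_nonneg) (auto simp: f_def)
    have "exp (2 * pi * t) * infsum (f t) (- F) = infsum (\<lambda>p. exp (2 * pi * t) * f t p) (- F)"
      by (rule infsum_cmult_right'[symmetric])
    also have "\<dots> \<le> infsum (\<lambda>p. (exp (- 2 * pi * (t - 1)) * exp (2 * pi)) * f 1 p) (- F)"
    proof (rule infsum_mono)
      show "(\<lambda>p. exp (2 * pi * t) * f t p) summable_on - F"
        by (intro summable_on_cmult_right sum) (use t in simp)
      show "(\<lambda>p. (exp (- 2 * pi * (t - 1)) * exp (2 * pi)) * f 1 p) summable_on - F"
        by (intro summable_on_cmult_right sum) simp
      fix p assume p: "p \<in> - F"
      obtain x y where xy: "p = (x, y)" by (cases p)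
      define n where "n = real_of_int (bqf_eval Q x y)"
      have "n \<ge> 2" using ge[of x y] p unfolding xy n_def by simp
      \<comment> \<open>The product \<open>(t - 1) (n - 2)\<close> is, up to the factor
        \<open>2 pi\<close>, exactly the difference of the two exponents to be compared.\<close>
      hence "0 \<le> 2 * pi * ((t - 1) * (n - 2))" using t by (intro mult_nonneg_nonneg) auto
      hence "2 * pi * t - 2 * pi * t * n \<le> - 2 * pi * (t - 1) + 2 * pi - 2 * pi * n"
        by (simp add: algebra_simps)
      thus "exp (2 * pi * t) * f t p \<le> (exp (- 2 * pi * (t - 1)) * exp (2 * pi)) * f 1 p"
        unfolding xy f_def case_prod_conv n_def[symmetric] by (simp add: mult_exp_exp)
    qed
    also have "\<dots> = exp (- 2 * pi * (t - 1)) * C"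
      unfolding infsum_cmult_right' C_def by simp
    finally show "exp (2 * pi * t) * infsum (f t) (- F) \<le> exp (- 2 * pi * (t - 1)) * C" .
  qed
  have sf: "(\<Sum>(x, y)\<in>F. exp (- 2 * pi * t * of_int (bqf_eval Q x y))) = sum (f t) F" for t
    by (simp add: f_def[abs_def])
  show "\<forall>\<^sub>F t in at_top. 0 \<le> exp (2 * pi * t) * (theta_imag Q t - (\<Sum>(x, y)\<in>F. exp (- 2 * pi * t * of_int (bqf_eval Q x y))))"
    unfolding sf using bounds tail by (intro eventually_at_top_linorderI[of 1]) simp
  show "\<forall>\<^sub>F t in at_top. exp (2 * pi * t) * (theta_imag Q t - (\<Sum>(x, y)\<in>F. exp (- 2 * pi * t * of_int (bqf_eval Q x y))))
      \<le> exp (- 2 * pi * (t - 1)) * C"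
    unfolding sf using bounds tail by (intro eventually_at_top_linorderI[of 1]) simp
  have "((\<lambda>t. exp (- 2 * pi * (t - 1))) \<longlongrightarrow> 0) at_top" by real_asymp
  thus "((\<lambda>t. exp (- 2 * pi * (t - 1)) * C) \<longlongrightarrow> 0) at_top" by (rule tendsto_mult_left_zero)
qed simp_all

lemma principal_eval_ge_2:
  assumes "c \<ge> 2" "(x, y) \<notin> {(0, 0), (1, 0), (-1, 0)}"
  shows "bqf_eval (BQF 1 1 c) x y \<ge> 2"
proof (cases "y = 0")
  case True
  hence "\<bar>x\<bar> \<ge> 2" using assms(2) by auto
  hence "2 * 2 \<le> \<bar>x\<bar> * \<bar>x\<bar>" by (intro mult_mono) auto
  thus ?thesis using True by (simp add: bqf_eval_def power2_eq_square)
next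
  case False
  hence "y\<^sup>2 \<ge> 1" by (simp add: int_one_le_iff_zero_less)
  hence "(4 * c - 1) * 1 \<le> (4 * c - 1) * y\<^sup>2" using assms(1) by (intro mult_left_mono) auto
  also have "\<dots> \<le> (2 * x + y)\<^sup>2 + (4 * c - 1) * y\<^sup>2" by simp
  also have "\<dots> = 4 * bqf_eval (BQF 1 1 c) x y"
    by (simp add: bqf_eval_def power2_eq_square algebra_simps)
  finally have "4 * c - 1 \<le> 4 * bqf_eval (BQF 1 1 c) x y" by simp
  thus ?thesis using assms(1) by linarith
qed

lemma reduced_eval_ge_2:
  assumes Q: "bqf_reduced Q" "coeff_a Q \<ge> 2" and xy: "(x, y) \<noteq> (0, 0)"
  shows "bqf_eval Q x y \<ge> 2"
proof -
  have c: "coeff_c Q \<ge> 2" using Q by (simp add: bqf_reduced_def)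
  have sq: "n\<^sup>2 \<ge> 1" if "n \<noteq> 0" for n :: int using that by (simp add: int_one_le_iff_zero_less)
  consider "y = 0" "x \<noteq> 0" | "x = 0" "y \<noteq> 0" | "x \<noteq> 0" "y \<noteq> 0" using xy by auto
  thus ?thesis
  proof cases
    case 1
    have "2 * 1 \<le> coeff_a Q * x\<^sup>2" using Q sq[OF 1(2)] by (intro mult_mono) auto
    thus ?thesis using 1 by (simp add: bqf_eval_def)
  next
    case 2
    have "2 * 1 \<le> coeff_c Q * y\<^sup>2" using c sq[OF 2(2)] by (intro mult_mono) auto
    thus ?thesis using 2 by (simp add: bqf_eval_def)
  next
    case 3
    have "2 * 2 \<le> coeff_a Q * (x\<^sup>2 + y\<^sup>2)"
      using Q sq[OF 3(1)] sq[OF 3(2)] by (intro mult_mono) auto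
    thus ?thesis using bqf_reduced_lower_bound[OF Q(1), of x y] by linarith
  qed
qed

text \<open>The constant terms cancel. The value 1 is taken twice by the principal form and never by
  \<open>Q r\<close>, so the factor 1/2 makes the leading coefficient 1.\<close>

lemma theta_diff_asymp:
  assumes adm: "admissible D r k Q"
  shows "((\<lambda>t. exp (2 * pi * t) * ((theta_imag (Q 0) t - theta_imag (Q r) t) / 2)) \<longlongrightarrow> 1) at_top"
proof -
  define c where "c = (1 + D) div 4"
  have Q0: "Q 0 = BQF 1 1 c" using admissible_forms(1)[OF adm] by (simp add: c_def)
  have c: "c \<ge> 2" using admissible_forms(5)[OF adm] by (simp add: c_def)
  note R0 = reduced_formsD[OF admissible_forms(2)[OF adm]]
  note Rr = reduced_formsD[OF admissible_forms(3)[OF adm]]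
  have 0: "((\<lambda>t. exp (2 * pi * t) * (theta_imag (Q 0) t - (1 + 2 * exp (- 2 * pi * t)))) \<longlongrightarrow> 0) at_top"
    using theta_imag_asymp[OF R0(1,3), of "{(0, 0), (1, 0), (-1, 0)}"] principal_eval_ge_2[OF c]
    by (simp add: Q0 bqf_eval_def)
  have 1: "((\<lambda>t. exp (2 * pi * t) * (theta_imag (Q r) t - 1)) \<longlongrightarrow> 0) at_top"
    using theta_imag_asymp[OF Rr(1,3), of "{(0, 0)}"] reduced_eval_ge_2[OF Rr(1) admissible_forms(4)[OF adm]]
    by (simp add: bqf_eval_def)
  have "((\<lambda>t. 1 + (exp (2 * pi * t) * (theta_imag (Q 0) t - (1 + 2 * exp (- 2 * pi * t))) -
      exp (2 * pi * t) * (theta_imag (Q r) t - 1)) / 2) \<longlongrightarrow> 1 + (0 - 0) / 2) at_top"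
    by (intro tendsto_intros 0 1) simp
  moreover have "(\<lambda>t. 1 + (exp (2 * pi * t) * (theta_imag (Q 0) t - (1 + 2 * exp (- 2 * pi * t))) -
      exp (2 * pi * t) * (theta_imag (Q r) t - 1)) / 2) =
      (\<lambda>t. exp (2 * pi * t) * ((theta_imag (Q 0) t - theta_imag (Q r) t) / 2))"
  proof
    fix t
    have "exp (2 * pi * t) * exp (- 2 * pi * t) = 1" by (simp add: mult_exp_exp)
    thus "1 + (exp (2 * pi * t) * (theta_imag (Q 0) t - (1 + 2 * exp (- 2 * pi * t))) -
      exp (2 * pi * t) * (theta_imag (Q r) t - 1)) / 2 =
      exp (2 * pi * t) * ((theta_imag (Q 0) t - theta_imag (Q r) t) / 2)" by (simp add: field_simps)
  qed
  ultimately show ?thesis by (simp only:) simp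
qed

section \<open>Exponents of an eta quotient\<close>

lemma ln_power_int: "x > 0 \<Longrightarrow> ln (x powi n) = of_int n * ln (x :: real)"
  using exp_power_int[of "ln x" n] by (simp add: ln_exp)

lemma sum_over_fibres:
  assumes "finite S" "finite X" "g ` S \<subseteq> X"
  shows "(\<Sum>x\<in>X. (\<Sum>d\<in>{d \<in> S. g d = x}. e d) * f x) = (\<Sum>d\<in>S. e d * f (g d) :: real)"
proof -
  have "(\<Sum>x\<in>X. (\<Sum>d\<in>{d \<in> S. g d = x}. e d) * f x) = (\<Sum>x\<in>X. \<Sum>d\<in>{d \<in> S. g d = x}. e d * f (g d))"
    by (intro sum.cong refl) (simp add: sum_distrib_right)
  also have "\<dots> = (\<Sum>d\<in>S. e d * f (g d))" by (rule sum.group[OF assms])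
  finally show ?thesis .
qed

text \<open>The sum over \<open>\<delta>'\<close> in the second conclusion has at most one term. It
  encodes equality with the exponent at \<open>D / \<delta>\<close>, read as 0 when that number is
  not an integer or not a divisor of \<open>N\<close>.\<close>

theorem eta_quotient_exponents:
  fixes e :: "nat \<Rightarrow> int"
  assumes adm: "admissible D r k Q" and N: "N \<ge> 1"
    and eq: "\<forall>z. Im z > 0 \<longrightarrow> theta_diff Q r z = (\<Prod>\<delta> | \<delta> dvd N. dedekind_eta (of_nat \<delta> * z) powi e \<delta>)"
  defines "S \<equiv> {\<delta>. \<delta> dvd N}"
  defines "G \<equiv> \<lambda>t. \<Prod>\<delta>\<in>S. eta_imag (real \<delta> * t) powi e \<delta>"
  shows "(\<Sum>\<delta>\<in>S. e \<delta>) = 2"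
    and "\<And>\<delta>. \<delta> \<in> S \<Longrightarrow> e \<delta> = (\<Sum>\<delta>'\<in>{\<delta>' \<in> S. int (\<delta> * \<delta>') = D}. e \<delta>')"
    and "\<And>t. t > 0 \<Longrightarrow> G t = (theta_imag (Q 0) t - theta_imag (Q r) t) / 2"
proof -
  have finS: "finite S" using N by (simp add: S_def)
  have pos: "\<delta> > 0" if "\<delta> \<in> S" for \<delta> using that N unfolding S_def by (auto intro: Nat.gr0I)
  have D: "D > 0" using adm by (simp add: admissible_def)
  note R0 = reduced_formsD[OF admissible_forms(2)[OF adm]]
  note Rr = reduced_formsD[OF admissible_forms(3)[OF adm]]
  have Gpos: "G t > 0" if "t > 0" for t
    unfolding G_def using that by (intro prod_pos ballI zero_less_power_int eta_imag_pos) (simp add: pos)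
  have td: "theta_diff Q r (\<i> * of_real t) = of_real (G t)" if t: "t > 0" for t
  proof -
    have "theta_diff Q r (\<i> * of_real t) = (\<Prod>\<delta>\<in>S. dedekind_eta (of_nat \<delta> * (\<i> * of_real t)) powi e \<delta>)"
      unfolding S_def by (rule eq[rule_format]) (use t in simp)
    also have "\<dots> = (\<Prod>\<delta>\<in>S. of_real (eta_imag (real \<delta> * t) powi e \<delta>))"
    proof (rule prod.cong)
      fix \<delta> assume "\<delta> \<in> S"
      hence "real \<delta> * t > 0" using pos t by simp
      hence "dedekind_eta (\<i> * of_real (real \<delta> * t)) = of_real (eta_imag (real \<delta> * t))" by (rule dedekind_eta_imag)
      moreover have "\<i> * of_real (real \<delta> * t) = of_nat \<delta> * (\<i> * complex_of_real t)" by simp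
      ultimately show "dedekind_eta (of_nat \<delta> * (\<i> * of_real t)) powi e \<delta> = of_real (eta_imag (real \<delta> * t) powi e \<delta>)"
        by (simp only: of_real_power_int)
    qed simp
    finally show ?thesis by (simp add: G_def)
  qed
  show G_theta: "G t = (theta_imag (Q 0) t - theta_imag (Q r) t) / 2" if t: "t > 0" for t
  proof -
    have "complex_of_real (G t) = of_real ((theta_imag (Q 0) t - theta_imag (Q r) t) / 2)"
      unfolding td[OF t, symmetric] theta_diff_def theta_series_imag[OF R0(1,3) t] theta_series_imag[OF Rr(1,3) t]
      by simp
    thus ?thesis by (simp only: of_real_eq_iff)
  qed
  define d where "d = real_of_int D"
  have d: "d > 0" using D by (simp add: d_def)
  have inv: "G t = G (1 / (d * t)) / (t * sqrt d)" if t: "t > 0" for t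
  proof -
    have "complex_of_real (G t) = of_real (G (1 / (d * t)) / (t * sqrt d))"
      unfolding of_real_divide td[OF t, symmetric] using d t
      by (subst td[symmetric])
         (simp_all add: theta_diff_def d_def theta_series_inversion[OF R0(1,3,2) D t]
           theta_series_inversion[OF Rr(1,3,2) D t] diff_divide_distrib mult_ac)
    thus ?thesis by (simp only: of_real_eq_iff)
  qed
  define L where "L x = ln (eta_imag x)" for x
  have lnG: "ln (G t) = (\<Sum>\<delta>\<in>S. e \<delta> * L (real \<delta> * t))" if t: "t > 0" for t
  proof -
    have "ln (G t) = (\<Sum>\<delta>\<in>S. ln (eta_imag (real \<delta> * t) powi e \<delta>))"
      unfolding G_def
    proof (intro ln_prod finS)
      fix \<delta> assume "\<delta> \<in> S"
      hence "real \<delta> * t > 0" using t pos by simp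
      from eta_imag_pos[OF this] show "eta_imag (real \<delta> * t) powi e \<delta> \<noteq> 0"
        by (simp add: power_int_eq_0_iff)
    qed
    also have "\<dots> = (\<Sum>\<delta>\<in>S. e \<delta> * L (real \<delta> * t))"
      using t pos by (intro sum.cong) (auto simp: ln_power_int eta_imag_pos L_def)
    finally show ?thesis .
  qed
  \<comment> \<open>Inverting eta at \<open>\<delta> / (D t)\<close> produces half of
    \<open>ln (D t / \<delta>)\<close> per unit of exponent; the theta side subtracts
    \<open>ln (t sqrt D)\<close>. Hence the constant \<open>A\<close> and the coefficient
    \<open>w\<close> of \<open>ln t\<close>.\<close>
  define A where "A = (\<Sum>\<delta>\<in>S. e \<delta> * (ln (d / real \<delta>) / 2)) - ln (sqrt d)"
  define w where "w = (\<Sum>\<delta>\<in>S. real_of_int (e \<delta>)) / 2 - 1"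
  have rel: "(\<Sum>\<delta>\<in>S. e \<delta> * L (real \<delta> * t)) - (\<Sum>\<delta>\<in>S. e \<delta> * L (d / real \<delta> * t)) = A + w * ln t" if t: "t > 0" for t
  proof -
    have "(\<Sum>\<delta>\<in>S. e \<delta> * L (real \<delta> * t)) = ln (G (1 / (d * t)) / (t * sqrt d))"
      using lnG[OF t] inv[OF t] by simp
    also have "\<dots> = ln (G (1 / (d * t))) - ln (t * sqrt d)"
      using Gpos[of "1 / (d * t)"] t d by (intro ln_divide_pos) auto
    also have "ln (t * sqrt d) = ln t + ln (sqrt d)" using t d by (intro ln_mult_pos) auto
    also have "ln (G (1 / (d * t))) = (\<Sum>\<delta>\<in>S. e \<delta> * L (real \<delta> * (1 / (d * t))))"
      by (rule lnG) (use t d in simp)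
    also have "\<dots> = (\<Sum>\<delta>\<in>S. e \<delta> * L (d / real \<delta> * t) + (e \<delta> * (ln (d / real \<delta>) / 2) + real_of_int (e \<delta>) / 2 * ln t))"
    proof (rule sum.cong)
      fix \<delta> assume "\<delta> \<in> S"
      define s where "s = d / real \<delta>"
      have s: "s > 0" "s * t > 0" using pos[OF \<open>\<delta> \<in> S\<close>] d t by (auto simp: s_def)
      have "real \<delta> * (1 / (d * t)) = 1 / (s * t)" using pos[OF \<open>\<delta> \<in> S\<close>] d t by (simp add: s_def field_simps)
      hence "L (real \<delta> * (1 / (d * t))) = ln (sqrt (s * t) * eta_imag (s * t))"
        unfolding L_def using eta_imag_inversion[OF s(2)] by simp
      also have "\<dots> = ln (sqrt (s * t)) + L (s * t)"
        unfolding L_def using s eta_imag_pos by (intro ln_mult_pos) auto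
      also have "ln (sqrt (s * t)) = (ln s + ln t) / 2"
        using s t by (simp add: ln_sqrt ln_mult_pos)
      finally show "e \<delta> * L (real \<delta> * (1 / (d * t))) =
          e \<delta> * L (d / real \<delta> * t) + (e \<delta> * (ln (d / real \<delta>) / 2) + real_of_int (e \<delta>) / 2 * ln t)"
        unfolding s_def[symmetric] by (simp add: field_simps)
    qed simp
    also have "\<dots> = (\<Sum>\<delta>\<in>S. e \<delta> * L (d / real \<delta> * t)) + ((\<Sum>\<delta>\<in>S. e \<delta> * (ln (d / real \<delta>) / 2)) +
       (\<Sum>\<delta>\<in>S. real_of_int (e \<delta>)) / 2 * ln t)"
      by (simp add: sum.distrib sum_distrib_right sum_divide_distrib)
    finally show ?thesis unfolding A_def w_def by (simp add: algebra_simps)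
  qed
  \<comment> \<open>Collect equal arguments, which may occur both as some \<open>\<delta>\<close> and as some \<open>D / \<delta>'\<close>.\<close>
  define X where "X = real ` S \<union> (\<lambda>\<delta>. d / real \<delta>) ` S"
  define c where "c x = (\<Sum>\<delta>\<in>{\<delta>\<in>S. real \<delta> = x}. real_of_int (e \<delta>)) - (\<Sum>\<delta>\<in>{\<delta>\<in>S. d / real \<delta> = x}. real_of_int (e \<delta>))" for x
  have X: "finite X" "\<And>x. x \<in> X \<Longrightarrow> x > 0" using finS pos d by (auto simp: X_def)
  have sumX: "(\<Sum>x\<in>X. c x * ln (eta_imag (x * t))) = A + w * ln t" if t: "t > 0" for t
    unfolding c_def left_diff_distrib sum_subtractf rel[OF t, symmetric] L_def[symmetric]
    by (intro arg_cong2[where f = "(-)"] sum_over_fibres finS X) (auto simp: X_def)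
  have w: "w = 0" and c: "\<And>x. x \<in> X \<Longrightarrow> c x = 0"
    using ln_eta_imag_independent[OF X sumX] by blast+
  have "real_of_int (\<Sum>\<delta>\<in>S. e \<delta>) = real_of_int 2" using w by (simp add: w_def)
  thus "(\<Sum>\<delta>\<in>S. e \<delta>) = 2" by (simp only: of_int_eq_iff)
  \<comment> \<open>The coefficient at the argument \<open>\<delta>\<close> collects
    \<open>e \<delta>\<close> from one side and, from the other, the exponents of all
    \<open>\<delta>'\<close> with \<open>D / \<delta>' = \<delta>\<close>.\<close>
  show "e \<delta> = (\<Sum>\<delta>'\<in>{\<delta>' \<in> S. int (\<delta> * \<delta>') = D}. e \<delta>')" if \<delta>: "\<delta> \<in> S" for \<delta>
  proof -
    have "{\<delta>'\<in>S. real \<delta>' = real \<delta>} = {\<delta>}" using \<delta> by auto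
    moreover have "{\<delta>'\<in>S. d / real \<delta>' = real \<delta>} = {\<delta>' \<in> S. int (\<delta> * \<delta>') = D}"
    proof (intro Collect_cong conj_cong refl)
      fix \<delta>' assume "\<delta>' \<in> S"
      hence "d / real \<delta>' = real \<delta> \<longleftrightarrow> real_of_int (int (\<delta> * \<delta>')) = real_of_int D"
        using pos[of \<delta>'] by (auto simp: d_def field_simps)
      thus "d / real \<delta>' = real \<delta> \<longleftrightarrow> int (\<delta> * \<delta>') = D" by (simp only: of_int_eq_iff)
    qed
    moreover have "c (real \<delta>) = 0" by (rule c) (use \<delta> in \<open>simp add: X_def\<close>)
    ultimately have "real_of_int (e \<delta>) = real_of_int (\<Sum>\<delta>'\<in>{\<delta>' \<in> S. int (\<delta> * \<delta>') = D}. e \<delta>')"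
      unfolding c_def by simp
    thus ?thesis by (simp only: of_int_eq_iff)
  qed
qed

lemma eta_quotient_imp_23:
  assumes adm: "admissible D r k Q" and quot: "is_eta_quotient (theta_diff Q r)"
  shows "D = 23"
proof -
  obtain N :: nat and e :: "nat \<Rightarrow> int" where N: "N \<ge> 1"
    and eq: "\<forall>z. Im z > 0 \<longrightarrow> theta_diff Q r z = (\<Prod>\<delta> | \<delta> dvd N. dedekind_eta (of_nat \<delta> * z) powi e \<delta>)"
    using quot unfolding is_eta_quotient_def by blast
  define S where "S = {\<delta>. \<delta> dvd N}"
  define p where "p = nat D"
  note E = eta_quotient_exponents[OF adm N eq, folded S_def]
  have finS: "finite S" and 1: "1 \<in> S" using N by (auto simp: S_def)
  have p: "prime p" using admissible_prime[OF adm] by (simp add: p_def)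
  have D: "D = int p" using adm by (simp add: admissible_def p_def)
  have sym: "e \<delta> = (\<Sum>\<delta>'\<in>{\<delta>' \<in> S. \<delta> * \<delta>' = p}. e \<delta>')" if "\<delta> \<in> S" for \<delta>
    using E(2)[OF that] unfolding D of_nat_eq_iff .
  have supp: "e \<delta> = 0" if "\<delta> \<in> S" "\<delta> \<noteq> 1" "\<delta> \<noteq> p" for \<delta>
  proof -
    have "\<not> \<delta> dvd p" using p that by (auto simp: prime_nat_iff)
    hence empty: "{\<delta>' \<in> S. \<delta> * \<delta>' = p} = {}" by auto
    show ?thesis using sym[OF that(1)] unfolding empty by simp
  qed
  have p1: "p \<noteq> 1" using p by auto
  \<comment> \<open>If \<open>p\<close> did not divide \<open>N\<close>, the divisor 1 would have no
    partner either. All exponents would vanish, contradicting their sum 2.\<close>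
  have pS: "p \<in> S"
  proof (rule ccontr)
    assume "p \<notin> S"
    hence empty: "{\<delta>' \<in> S. 1 * \<delta>' = p} = {}" by auto
    have "e 1 = 0" using sym[OF 1] unfolding empty by simp
    hence "(\<Sum>\<delta>\<in>S. e \<delta>) = 0" using supp \<open>p \<notin> S\<close> by (intro sum.neutral) metis
    thus False using E(1) by simp
  qed
  have single: "{\<delta>' \<in> S. 1 * \<delta>' = p} = {p}" using pS by auto
  have e1p: "e 1 = e p" using sym[OF 1] unfolding single by simp
  have "(\<Sum>\<delta>\<in>S. e \<delta>) = (\<Sum>\<delta>\<in>{1, p}. e \<delta>)"
    by (rule sum.mono_neutral_right) (use finS 1 pS supp in auto)
  hence e1: "e 1 = 1" "e p = 1" using E(1) e1p p1 by auto
  have G: "(theta_imag (Q 0) t - theta_imag (Q r) t) / 2 = eta_imag t * eta_imag (real p * t)" if t: "t > 0" for t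
  proof -
    have "(\<Prod>\<delta>\<in>S. eta_imag (real \<delta> * t) powi e \<delta>) = (\<Prod>\<delta>\<in>{1, p}. eta_imag (real \<delta> * t) powi e \<delta>)"
      by (rule prod.mono_neutral_right) (use finS 1 pS supp in auto)
    also have "\<dots> = eta_imag t * eta_imag (real p * t)" using p1 e1 by simp
    finally show ?thesis using E(3)[OF t] by simp
  qed
  \<comment> \<open>The growth rate of \<open>exp (2 pi t)\<close> minus the decay rate
    \<open>pi / 12\<close> per unit argument of the two eta factors. A finite limit of the logarithm
    forces it to be 0, that is, \<open>1 + p = 24\<close>.\<close>
  define B where "B = 2 * pi - pi * (1 + real p) / 12"
  have p0: "p > 0" using p by (simp add: prime_gt_0_nat)
  have "((\<lambda>t. ln (exp (2 * pi * t) * ((theta_imag (Q 0) t - theta_imag (Q r) t) / 2))) \<longlongrightarrow> ln 1) at_top"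
    by (rule tendsto_ln[OF theta_diff_asymp[OF adm]]) simp
  moreover have "ln (exp (2 * pi * t) * ((theta_imag (Q 0) t - theta_imag (Q r) t) / 2)) =
     B * t + ln (euler_phi (exp (- 2 * pi * (1 * t)))) + ln (euler_phi (exp (- 2 * pi * (real p * t))))" if t: "t > 0" for t
  proof -
    have pt: "real p * t > 0" using p0 t by simp
    have "ln (exp (2 * pi * t) * ((theta_imag (Q 0) t - theta_imag (Q r) t) / 2)) =
        2 * pi * t + (ln (eta_imag t) + ln (eta_imag (real p * t)))"
      unfolding G[OF t] using eta_imag_pos[OF t] eta_imag_pos[OF pt] by (simp add: ln_mult_pos)
    also have "\<dots> = B * t + ln (euler_phi (exp (- 2 * pi * (1 * t)))) + ln (euler_phi (exp (- 2 * pi * (real p * t))))"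
      unfolding ln_eta_imag[OF t] ln_eta_imag[OF pt] B_def by (simp add: field_simps)
    finally show ?thesis .
  qed
  ultimately have "((\<lambda>t. B * t + ln (euler_phi (exp (- 2 * pi * (1 * t)))) + ln (euler_phi (exp (- 2 * pi * (real p * t)))))
      \<longlongrightarrow> ln 1) at_top"
    by (subst (asm) tendsto_cong[OF eventually_at_top_linorderI[of 1]]) auto
  from tendsto_diff[OF tendsto_diff[OF this ln_euler_phi_tendsto_0[of "real p"]] ln_euler_phi_tendsto_0[of 1]]
  have "((\<lambda>t. 0 + 0 * ln t + B * t) \<longlongrightarrow> 0) at_top" using p0 by simp
  from log_affine_tendsto_0(2)[OF this] have "real p = 23" by (simp add: B_def field_simps)
  thus ?thesis unfolding D by simp
qed

theorem proposition1p3: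
  shows "(\<exists>k Q. admissible 23 1 k Q) \<and>
    (\<forall>(D :: int) (r :: nat) (k :: nat) (Q :: nat \<Rightarrow> bqf). admissible D r k Q \<longrightarrow>
       (is_eta_quotient (theta_diff Q r) \<longleftrightarrow> (D, r) = (23, 1)))"
proof (intro conjI allI impI iffI)
  show "\<exists>k Q. admissible 23 1 k Q" using admissible_23 by blast
next
  fix D r k Q assume adm: "admissible D r k Q" and quot: "is_eta_quotient (theta_diff Q r)"
  have "D = 23" by (rule eta_quotient_imp_23[OF adm quot])
  thus "(D, r) = (23, 1)" using adm admissible_23D(1) by blast
next
  fix D r k Q assume adm: "admissible D r k Q" and Dr: "(D, r) = (23, 1)"
  have adm': "admissible 23 r k Q" using adm Dr by simp
  obtain b where b: "b = 1 \<or> b = -1" "Q r = BQF 2 b 3" using admissible_23D(3)[OF adm'] by blast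
  have "prime (23::nat)" by simp
  hence div: "{\<delta>::nat. \<delta> dvd 23} = {1, 23}" by (auto simp: prime_nat_iff simp del: prime_nat_numeral_eq)
  have "theta_diff Q r z = (\<Prod>\<delta> | \<delta> dvd (23::nat). dedekind_eta (of_nat \<delta> * z) powi 1)"
    if "Im z > 0" for z
    unfolding div theta_diff_def admissible_23D(2)[OF adm'] b(2) eta_product_23[OF that b(1), symmetric]
    by simp
  thus "is_eta_quotient (theta_diff Q r)"
    unfolding is_eta_quotient_def by (intro exI[of _ 23] exI[of _ "\<lambda>_. 1"]) auto
qed

end
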